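(* Let $p\ge2$ be an integer not divisible by $3$. The matrix $\big(\psi_y^{(\mu)}\big)_{y\in\mathcal W_p^{(+)},\,\mu\in E_p}$ is a unitary square matrix: $$\sum_{y\in\mathcal W_p^{(+)}}\psi_y^{(\mu)}\,\overline{\psi_y^{(\mu')}}=\delta_{\mu\mu'},\qquad \sum_{\mu\in E_p}\psi_y^{(\mu)}\,\overline{\psi_x^{(\mu)}}=\delta_{yx},$$ and the fusion rule multiplicities are given, for all $x,y,z\in\mathcal W_p^{(+)}$, by the Pasquier--Verlinde type formula $${}^{(p)}N^z_{x,y}=\sum_{\mu\in E_p}\frac{\psi_x^{(\mu)}}{\psi_{\mathbf 1}^{(\mu)}}\,\psi_y^{(\mu)}\,\overline{\psi_z^{(\mu)}}.$$
   Context: Setting: $sl(3)$ with simple roots $\alpha_1,\alpha_2$, positive roots $\alpha_1,\alpha_2,\theta=\alpha_1+\alpha_2$, $\langle\alpha_i,\alpha_i\rangle=2$, root lattice $Q$, weight lattice $P$, fundamental weights $\bar\Lambda_1,\bar\Lambda_2$, $\bar\rho=\bar\Lambda_1+\bar\Lambda_2$, dominant weights $P_+$; triality $\tau(\lambda)=\langle\lambda,\alpha_1\rangle+2\langle\lambda,\alpha_2\rangle$ mod 3. $\overline W$ is the finite Weyl group, $\det(w)=\pm1$, shifted action $w\cdot\lambda=w(\lambda+\bar\rho)-\bar\rho$. $W=\overline W\ltimes t_Q$ is the affine Weyl group ($w\,t_\beta w^{-1}=t_{w(\beta)}$), each $y\in W$ being uniquely $y=\bar y\,t_{-\lambda}$,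 $\bar y\in\overline W$, $\lambda\in Q$. $\iota(\bar y\,t_{-\lambda})=3\lambda+\bar y^{-1}\cdot0$. $W^{[p]}=\overline W\ltimes t_{pQ}\subset W$. For $w\in\overline W$ let $P_{+,p}^{(w)}$ be the set of $\lambda\in P_+$ with $\langle\lambda,\alpha_i\rangle>0$ whenever $w(\alpha_i)<0$ ($i=1,2$), and with $\langle\lambda,\theta\rangle<p$ if $w(\theta)>0$, $\langle\lambda,\theta\rangle\le p$ if $w(\theta)<0$. $\mathcal W^{(+)}_p=\{\bar y\,t_{-\lambda}\in W:\lambda\in P_{+,p}^{(\bar y)}\cap Q\}$. Let $K_\beta$ be the Kostant partition function of $sl(3)$ and $\bar m^\lambda_\nu=\sum_{w\in\overline W}\det(w)K_{w\cdot\lambda-\nu}$ for $\lambda,\nu\in P$ (the weight multiplicity of $\nu$ in the irreducible module of highest weight $\lambda$ if $\lambda\in P_+$). For $x,y,z\in\mathcal W_p^{(+)}$ the fusion multiplicities are ${}^{(p)}N^z_{x,y}=\sum_{w\in W^{[p]}}\det(\bar w)\,\bar m^{\iota(x)}_{\iota(zwy^{-1})}$ (a finite sum). For $\lambda,\mu\in P$: $\bar\chi^{(p)}_\lambda(\mu)=\sum_{\nu\in P}\bar m^\lambda_\nu\,e^{-\frac{2\pi i}{p}\langle\nu,\mu+\bar\rho\rangle}$. $E_p=\{\mu\in P_+:0\le\langle\mu,\alpha_i\rangle\le p-1,\ i=1,2\}$; for $\mu\in E_p$ put $\varepsilon(\mu)=1$ if $\langle\mu,\theta\rangle\le p-2$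 and $\varepsilon(\mu)=-1$ otherwise, and $F(\mu)=\varepsilon(\mu)\sqrt{3+\bar\chi^{(p)}_{\bar\Lambda_1}(\mu)+\bar\chi^{(p)}_{\bar\Lambda_2}(\mu)}$ (nonnegative square root of a nonnegative real number). For $y=\bar y\,t_{-\lambda}\in\mathcal W_p^{(+)}$ and $\mu\in E_p$: $$\chi_y^{(p)}(\mu)=e^{-\frac{2\pi i p}{3}\tau(\mu)\tau(\lambda)}\Big(\bar\chi^{(p)}_{\lambda+\bar y^{-1}\cdot0}(\mu)+\bar\chi^{(p)}_{\lambda+\bar y^{-1}\cdot(-2\bar\Lambda_1)}(\mu)+\bar\chi^{(p)}_{\lambda+\bar y^{-1}\cdot(-2\bar\Lambda_2)}(\mu)+(F(\mu)+2)\big(\bar\chi^{(p)}_{\lambda+\bar y^{-1}\cdot(-\bar\rho)}(\mu)+\bar\chi^{(p)}_{\lambda+\bar y^{-1}\cdot(-\bar\Lambda_2)}(\mu)+\bar\chi^{(p)}_{\lambda+\bar y^{-1}\cdot(-\bar\Lambda_1)}(\mu)\big)\Big)$$ (the overall phase equals $1$ for $y\in\mathcal W^{(+)}_p$). The normalised eigenvector matrix is $\psi_y^{(\mu)}=\chi_y^{(p)}(\mu)\,\psi_{\mathbf 1}^{(\mu)}$ with $\psi_{\mathbf 1}^{(\mu)}=\big(\sum_{y\in\mathcal W_p^{(+)}}|\chi_y^{(p)}(\mu)|^2\big)^{-1/2}>0$, where $\mathbf 1$ is the unit of $W$ (and $\chi^{(p)}_{\mathbf 1}(\mu)=1$). One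 has $|\mathcal W_p^{(+)}|=|E_p|=p^2$. *)

theory Defs
  imports Complex_Main "HOL-Library.Product_Plus"
begin

section \<open>Weights of sl(3)\<close>

text \<open>
  The weight \<open>a \<Lambda>\<^sub>1 + b \<Lambda>\<^sub>2\<close> is the pair \<open>(a, b)\<close> of its Dynkin labels, so the weight lattice is
  the whole type. The Gram matrix of the fundamental weights is the inverse Cartan matrix,
  \<open>\<langle>\<Lambda>\<^sub>1,\<Lambda>\<^sub>1\<rangle> = \<langle>\<Lambda>\<^sub>2,\<Lambda>\<^sub>2\<rangle> = 2/3\<close> and \<open>\<langle>\<Lambda>\<^sub>1,\<Lambda>\<^sub>2\<rangle> = 1/3\<close>.
\<close>

type_synonym weight = "int \<times> int"

definition ip :: "weight \<Rightarrow> weight \<Rightarrow> real" where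
  "ip \<kappa> \<mu> = of_int (2 * fst \<kappa> * fst \<mu> + fst \<kappa> * snd \<mu> + snd \<kappa> * fst \<mu> + 2 * snd \<kappa> * snd \<mu>) / 3"

definition scale :: "int \<Rightarrow> weight \<Rightarrow> weight" where
  "scale n \<kappa> = (n * fst \<kappa>, n * snd \<kappa>)"

definition Lam1 :: weight where "Lam1 = (1, 0)"
definition Lam2 :: weight where "Lam2 = (0, 1)"
definition rho :: weight where "rho = Lam1 + Lam2"
definition alpha1 :: weight where "alpha1 = (2, -1)"
definition alpha2 :: weight where "alpha2 = (-1, 2)"
definition theta :: weight where "theta = alpha1 + alpha2"

lemma ip_alpha1: "ip \<kappa> alpha1 = of_int (fst \<kappa>)"
  and ip_alpha2: "ip \<kappa> alpha2 = of_int (snd \<kappa>)"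
  by (simp_all add: ip_def alpha1_def alpha2_def)

definition pos_roots :: "weight set" where
  "pos_roots = {alpha1, alpha2, theta}"

abbreviation positive :: "weight \<Rightarrow> bool" where
  "positive \<beta> \<equiv> \<beta> \<in> pos_roots"

abbreviation negative :: "weight \<Rightarrow> bool" where
  "negative \<beta> \<equiv> - \<beta> \<in> pos_roots"

definition root_lattice :: "weight set" where
  "root_lattice = {scale m alpha1 + scale n alpha2 | m n. True}"

definition dominant :: "weight set" where
  "dominant = {\<kappa>. ip \<kappa> alpha1 \<ge> 0 \<and> ip \<kappa> alpha2 \<ge> 0}"

text \<open>The triality, as a representative in \<open>{0, 1, 2}\<close>; the labels are the products with the simple
  roots by \<open>ip_alpha1\<close> and \<open>ip_alpha2\<close>.\<close>

definition triality :: "weight \<Rightarrow> int" where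
  "triality \<kappa> = (fst \<kappa> + 2 * snd \<kappa>) mod 3"


section \<open>The finite and the affine Weyl group\<close>

definition refl1 :: "weight \<Rightarrow> weight" where
  "refl1 \<kappa> = \<kappa> - scale (fst \<kappa>) alpha1"

definition refl2 :: "weight \<Rightarrow> weight" where
  "refl2 \<kappa> = \<kappa> - scale (snd \<kappa>) alpha2"

inductive_set weyl :: "(weight \<Rightarrow> weight) set" where
  weyl_id: "id \<in> weyl"
| weyl_refl1: "w \<in> weyl \<Longrightarrow> refl1 \<circ> w \<in> weyl"
| weyl_refl2: "w \<in> weyl \<Longrightarrow> refl2 \<circ> w \<in> weyl"

text \<open>Determinant of a linear map in the basis of fundamental weights.\<close>

definition wdet :: "(weight \<Rightarrow> weight) \<Rightarrow> int" where
  "wdet w = fst (w Lam1) * snd (w Lam2) - snd (w Lam1) * fst (w Lam2)"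

definition dot :: "(weight \<Rightarrow> weight) \<Rightarrow> weight \<Rightarrow> weight" where
  "dot w \<kappa> = w (\<kappa> + rho) - rho"

definition transl :: "weight \<Rightarrow> weight \<Rightarrow> weight" where
  "transl \<beta> \<kappa> = \<kappa> + \<beta>"

text \<open>
  The affine Weyl group consists of the maps \<open>w \<circ> transl \<beta>\<close> with \<open>w\<close> in the finite Weyl group
  and \<open>\<beta>\<close> in the root lattice. It acts faithfully on the weight lattice, so its elements are
  taken to be these maps, with composition as product and \<^term>\<open>id\<close> as unit; then
  \<open>w \<circ> transl \<beta> \<circ> inv w = transl (w \<beta>)\<close>. The subgroup \<open>W\<^sup>[\<^sup>p\<^sup>]\<close> is \<open>affine_weyl_lev p\<close>.
\<close>

definition affine_weyl_lev :: "nat \<Rightarrow> (weight \<Rightarrow> weight) set" where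
  "affine_weyl_lev p = {w \<circ> transl (scale (int p) \<beta>) | w \<beta>. w \<in> weyl \<and> \<beta> \<in> root_lattice}"

text \<open>
  The components \<open>w\<close> and \<open>\<kappa>\<close> of \<open>y = w \<circ> transl (- \<kappa>)\<close>. They are unique by the lemma
  \<open>affine_decomp_unique\<close>.
\<close>

definition lin_part :: "(weight \<Rightarrow> weight) \<Rightarrow> weight \<Rightarrow> weight" where
  "lin_part y = (THE w. w \<in> weyl \<and> (\<exists>\<kappa>\<in>root_lattice. y = w \<circ> transl (- \<kappa>)))"

definition shift_part :: "(weight \<Rightarrow> weight) \<Rightarrow> weight" where
  "shift_part y = (THE \<kappa>. \<kappa> \<in> root_lattice \<and> (\<exists>w\<in>weyl. y = w \<circ> transl (- \<kappa>)))"

lemma weyl_zero_iff: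
  assumes "w \<in> weyl" shows "w \<mu> = 0 \<longleftrightarrow> \<mu> = 0"
proof -
  have "refl1 v = 0 \<longleftrightarrow> v = 0" "refl2 v = 0 \<longleftrightarrow> v = 0" for v
    by (cases v; auto simp: refl1_def refl2_def scale_def alpha1_def alpha2_def zero_prod_def)+
  with assms show ?thesis by induction simp_all
qed

lemma affine_decomp_unique:
  assumes "w \<in> weyl" "w' \<in> weyl" and eq: "w \<circ> transl (- \<kappa>) = w' \<circ> transl (- \<kappa>')"
  shows "w = w' \<and> \<kappa> = \<kappa>'"
proof
  from fun_cong[OF eq, of \<kappa>'] have "w (\<kappa>' - \<kappa>) = w' 0"
    by (simp add: transl_def)
  also have "w' 0 = 0" using weyl_zero_iff[OF assms(2)] by blast
  finally show "\<kappa> = \<kappa>'" using weyl_zero_iff[OF assms(1)] by simp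
  show "w = w'"
  proof
    fix \<mu>
    from fun_cong[OF eq, of "\<mu> + \<kappa>"] \<open>\<kappa> = \<kappa>'\<close> show "w \<mu> = w' \<mu>"
      by (simp add: transl_def)
  qed
qed

definition iota :: "(weight \<Rightarrow> weight) \<Rightarrow> weight" where
  "iota y = scale 3 (shift_part y) + dot (inv (lin_part y)) 0"

definition dominant_level :: "nat \<Rightarrow> (weight \<Rightarrow> weight) \<Rightarrow> weight set" where
  "dominant_level p w = {\<kappa> \<in> dominant.
     (negative (w alpha1) \<longrightarrow> ip \<kappa> alpha1 > 0) \<and>
     (negative (w alpha2) \<longrightarrow> ip \<kappa> alpha2 > 0) \<and>
     (positive (w theta) \<longrightarrow> ip \<kappa> theta < real p) \<and>
     (negative (w theta) \<longrightarrow> ip \<kappa> theta \<le> real p)}"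

definition Wplus :: "nat \<Rightarrow> (weight \<Rightarrow> weight) set" where
  "Wplus p = {w \<circ> transl (- \<kappa>) | w \<kappa>. w \<in> weyl \<and> \<kappa> \<in> dominant_level p w \<inter> root_lattice}"


section \<open>Weight multiplicities and fusion multiplicities\<close>

definition kostant :: "weight \<Rightarrow> nat" where
  "kostant \<beta> = card {(a :: nat, b :: nat, c :: nat).
     scale (int a) alpha1 + scale (int b) alpha2 + scale (int c) theta = \<beta>}"

definition mult :: "weight \<Rightarrow> weight \<Rightarrow> int" where
  "mult \<kappa> \<nu> = (\<Sum>w\<in>weyl. wdet w * int (kostant (dot w \<kappa> - \<nu>)))"

text \<open>
  The sums over \<open>W\<^sup>[\<^sup>p\<^sup>]\<close> and over the weight lattice below have only finitely many nonzero terms;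
  they are restricted to these terms because \<^const>\<open>sum\<close> is 0 on infinite index sets.
\<close>

definition fusion ::
  "nat \<Rightarrow> (weight \<Rightarrow> weight) \<Rightarrow> (weight \<Rightarrow> weight) \<Rightarrow> (weight \<Rightarrow> weight) \<Rightarrow> int" where
  "fusion p x y z =
     (\<Sum>w\<in>{w \<in> affine_weyl_lev p. mult (iota x) (iota (z \<circ> w \<circ> inv y)) \<noteq> 0}.
        wdet (lin_part w) * mult (iota x) (iota (z \<circ> w \<circ> inv y)))"

definition wchar :: "nat \<Rightarrow> weight \<Rightarrow> weight \<Rightarrow> complex" where
  "wchar p \<kappa> \<mu> = (\<Sum>\<nu>\<in>{\<nu>. mult \<kappa> \<nu> \<noteq> 0}.
     of_int (mult \<kappa> \<nu>) * exp (- (2 * of_real pi * \<i> / of_nat p) * of_real (ip \<nu> (\<mu> + rho))))"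


section \<open>The eigenvector matrix\<close>

definition Exps :: "nat \<Rightarrow> weight set" where
  "Exps p = {\<mu> \<in> dominant. 0 \<le> ip \<mu> alpha1 \<and> ip \<mu> alpha1 \<le> real p - 1 \<and>
     0 \<le> ip \<mu> alpha2 \<and> ip \<mu> alpha2 \<le> real p - 1}"

definition eps :: "nat \<Rightarrow> weight \<Rightarrow> complex" where
  "eps p \<mu> = (if ip \<mu> theta \<le> real p - 2 then 1 else - 1)"

text \<open>The argument of the principal square root \<^const>\<open>csqrt\<close> is a nonnegative real number.\<close>

definition Ffun :: "nat \<Rightarrow> weight \<Rightarrow> complex" where
  "Ffun p \<mu> = eps p \<mu> * csqrt (3 + wchar p Lam1 \<mu> + wchar p Lam2 \<mu>)"

definition chi :: "nat \<Rightarrow> (weight \<Rightarrow> weight) \<Rightarrow> weight \<Rightarrow> complex" where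
  "chi p y \<mu> =
    (let \<kappa> = shift_part y; v = inv (lin_part y) in
      exp (- (2 * of_real pi * \<i> * of_nat p / 3) * of_int (triality \<mu>) * of_int (triality \<kappa>)) *
      (wchar p (\<kappa> + dot v 0) \<mu>
       + wchar p (\<kappa> + dot v (- scale 2 Lam1)) \<mu>
       + wchar p (\<kappa> + dot v (- scale 2 Lam2)) \<mu>
       + (Ffun p \<mu> + 2) *
         (wchar p (\<kappa> + dot v (- rho)) \<mu>
          + wchar p (\<kappa> + dot v (- Lam2)) \<mu>
          + wchar p (\<kappa> + dot v (- Lam1)) \<mu>)))"

definition psi_norm :: "nat \<Rightarrow> weight \<Rightarrow> real" where
  "psi_norm p \<mu> = (\<Sum>y\<in>Wplus p. (cmod (chi p y \<mu>))\<^sup>2) powr (- (1 / 2))"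

definition psi :: "nat \<Rightarrow> (weight \<Rightarrow> weight) \<Rightarrow> weight \<Rightarrow> complex" where
  "psi p y \<mu> = chi p y \<mu> * of_real (psi_norm p \<mu>)"

end

theory Submission
  imports Defs
begin

text \<open>The idea is to turn the statement into the spectral theory of the discrete Laplacian on a
triangular piece of a honeycomb lattice.

The map \<open>y \<mapsto> iota y + rho\<close> identifies the affine Weyl group with the set \<open>honeycomb\<close> of vertices of
a honeycomb: the root lattice without the sublattice of hexagon centres. Right multiplication by an
element of \<open>W\<^sup>[\<^sup>p\<^sup>]\<close> becomes the action of the affine reflection group with translations \<open>3 p Q\<close>, so
\<open>Wplus p\<close> becomes the set of vertices in the open dominant alcove (\<open>Wplus_bij\<close>). By Weyl invariance
of the weight multiplicities, the fusion matrix of \<open>x\<close> is then the convolution by the character of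
highest weight \<open>iota x\<close>, acting on the functions that are antisymmetric under the reflection group
(\<open>fusion_kernel\<close>, \<open>kernel_sum\<close>).

The joint eigenfunctions of such convolutions can be written down.
\<open>eigenfun p \<mu>\<close> is a combination of six plane waves; it is an eigenfunction of the nearest-neighbour
hopping operator with eigenvalue \<open>Ffun p \<mu> = \<plusminus>|h|\<close>, where \<open>h\<close> is the amplitude \<open>hop p \<mu>\<close> for a hop
from one sublattice to the other, and of the convolutions by the Weyl invariant functions on \<open>3 P\<close>,
which preserve the two sublattices. A character of highest weight \<open>iota x\<close> is a
polynomial in these operators, linear in the hopping operator (\<open>charsum_mod3\<close>). The coefficients are
the six characters in the definition of \<open>chi\<close>, hence \<open>eigenfun p \<mu>\<close> has eigenvalue \<open>chi p x \<mu>\<close>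
(\<open>charsum_iota\<close>). On the other hand a character acts on an antisymmetric function by evaluation at its
highest weight (\<open>charsum_antisym\<close>), so
\<open>eigenfun p \<mu> (iota x + rho) = chi p x \<mu> * eigenfun p \<mu> rho\<close>. Up to normalisation \<open>chi\<close> is thus the
matrix of values of the eigenfunctions. They do not vanish at \<open>rho\<close> (\<open>eigenfun_rho_nonzero\<close>), and they
are orthogonal since the operators are normal and separate the points of \<open>Exps p\<close>
(\<open>eigenvalues_distinct\<close>). Since there are as many of them as there are vertices (\<open>card_Wplus\<close>), the
matrix is unitary, and the formula for the fusion multiplicities is the spectral decomposition of the
fusion matrices.\<close>

section \<open>The finite Weyl group\<close>

lemma refl1_pair: "refl1 (a, b) = (- a, a + b)"
  by (simp add: refl1_def scale_def alpha1_def)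

lemma refl2_pair: "refl2 (a, b) = (a + b, - b)"
  by (simp add: refl2_def scale_def alpha2_def)

lemma rho_pair: "rho = (1, 1)"
  by (simp add: rho_def Lam1_def Lam2_def)

lemma theta_pair: "theta = (1, 1)"
  by (simp add: theta_def alpha1_def alpha2_def)

lemma scale_pair [simp]: "scale n (a, b) = (n * a, n * b)"
  by (simp add: scale_def)

lemmas refl_pair = refl1_pair refl2_pair

lemma weyl_eq:
  "weyl = {id, refl1, refl2, refl1 \<circ> refl2, refl2 \<circ> refl1, refl1 \<circ> refl2 \<circ> refl1}"
    (is "_ = ?W")
proof
  show "weyl \<subseteq> ?W"
  proof
    fix w assume "w \<in> weyl"
    then show "w \<in> ?W"
      by induction (auto simp: fun_eq_iff refl_pair)
  qed
  have "id \<in> weyl" "refl1 \<in> weyl" "refl2 \<in> weyl"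
    using weyl_id weyl_refl1[OF weyl_id] weyl_refl2[OF weyl_id] by simp_all
  then show "?W \<subseteq> weyl"
    by (auto intro: weyl_refl1 weyl_refl2 simp: comp_assoc)
qed

lemma weyl_cases:
  assumes "w \<in> weyl"
  obtains "w = id" | "w = refl1" | "w = refl2" | "w = refl1 \<circ> refl2" | "w = refl2 \<circ> refl1"
    | "w = refl1 \<circ> refl2 \<circ> refl1"
  using assms by (auto simp: weyl_eq)

lemma finite_weyl [simp]: "finite weyl"
  by (simp add: weyl_eq)

lemma sum_weyl:
  fixes f :: "(weight \<Rightarrow> weight) \<Rightarrow> 'a::comm_monoid_add"
  shows "(\<Sum>w\<in>weyl. f w) = f id + (f refl1 + (f refl2 + (f (refl1 \<circ> refl2) +
    (f (refl2 \<circ> refl1) + f (refl1 \<circ> refl2 \<circ> refl1)))))"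
proof -
  have ne: "f \<noteq> g" if "f (1, 2) \<noteq> g (1, 2)" for f g :: "weight \<Rightarrow> weight"
    using that by auto
  show ?thesis
    unfolding weyl_eq by (simp add: ne refl_pair)
qed

lemma wdet_simps:
  "wdet id = 1" "wdet refl1 = - 1" "wdet refl2 = - 1"
  "wdet (refl1 \<circ> refl2) = 1" "wdet (refl2 \<circ> refl1) = 1" "wdet (refl1 \<circ> refl2 \<circ> refl1) = - 1"
  by (simp_all add: wdet_def Lam1_def Lam2_def refl_pair)

lemma weyl_add: "w \<in> weyl \<Longrightarrow> w (x + y) = w x + w y"
  by (cases x; cases y; erule weyl_cases) (simp_all add: refl_pair)

lemma weyl_scale: "w \<in> weyl \<Longrightarrow> w (scale n x) = scale n (w x)"
  by (cases x; erule weyl_cases) (simp_all add: refl_pair algebra_simps)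

lemma weyl_zero: "w \<in> weyl \<Longrightarrow> w 0 = 0"
  by (simp add: weyl_zero_iff)

lemma weyl_minus: "w \<in> weyl \<Longrightarrow> w (- x) = - w x"
  by (metis add_eq_0_iff weyl_add weyl_zero)

lemma weyl_diff: "w \<in> weyl \<Longrightarrow> w (x - y) = w x - w y"
  by (metis diff_conv_add_uminus weyl_add weyl_minus)

lemma weyl_comp:
  assumes "w \<in> weyl" "u \<in> weyl" shows "w \<circ> u \<in> weyl"
  using assms(1)
proof induction
  case weyl_id
  then show ?case by (simp add: assms(2))
next
  case (weyl_refl1 w)
  then show ?case by (metis comp_assoc weyl.weyl_refl1)
next
  case (weyl_refl2 w)
  then show ?case by (metis comp_assoc weyl.weyl_refl2)
qed

lemma weyl_inverse:
  assumes "w \<in> weyl" obtains u where "u \<in> weyl" "u \<circ> w = id" "w \<circ> u = id"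
proof -
  have "\<exists>u\<in>weyl. u \<circ> w = id \<and> w \<circ> u = id"
    using assms
    by (elim weyl_cases; simp add: weyl_eq) (auto simp: fun_eq_iff refl_pair)
  then show ?thesis using that by blast
qed

lemma weyl_bij: "w \<in> weyl \<Longrightarrow> bij w"
  by (metis weyl_inverse o_bij)

lemma weyl_inv: "w \<in> weyl \<Longrightarrow> inv w \<in> weyl"
  by (metis weyl_inverse inv_unique_comp)

lemma weyl_inv_apply [simp]: "w \<in> weyl \<Longrightarrow> inv w (w x) = x" "w \<in> weyl \<Longrightarrow> w (inv w x) = x"
  by (simp_all add: weyl_bij bij_is_inj bij_is_surj surj_f_inv_f)

lemma weyl_inv_inv [simp]: "w \<in> weyl \<Longrightarrow> inv (inv w) = w"
  by (simp add: weyl_bij inv_inv_eq)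

lemma wdet_comp:
  assumes "w \<in> weyl" "u \<in> weyl" shows "wdet (w \<circ> u) = wdet w * wdet u"
  using assms
  by (elim weyl_cases; simp only:) (simp_all add: wdet_def Lam1_def Lam2_def refl_pair)

lemma wdet_square: "w \<in> weyl \<Longrightarrow> wdet w * wdet w = 1"
  by (erule weyl_cases) (simp_all add: wdet_simps)

lemma wdet_inv:
  assumes "w \<in> weyl" shows "wdet (inv w) = wdet w"
proof -
  have "wdet (inv w) * wdet w = 1"
    using wdet_comp[OF weyl_inv[OF assms] assms] assms
    by (simp add: inv_o_cancel weyl_bij bij_is_inj wdet_simps)
  then show ?thesis using wdet_square[OF assms]
    by (metis mult.assoc mult.left_neutral mult.right_neutral)
qed

lemma weyl_inv_comp: "u \<in> weyl \<Longrightarrow> inv u \<circ> (u \<circ> w) = w" "u \<in> weyl \<Longrightarrow> u \<circ> (inv u \<circ> w) = w"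
  by (simp_all add: fun_eq_iff)

lemma sum_weyl_comp_left:
  assumes "u \<in> weyl" shows "(\<Sum>w\<in>weyl. f (u \<circ> w)) = (\<Sum>w\<in>weyl. f w)"
  by (rule sum.reindex_bij_witness[where i = "\<lambda>w. inv u \<circ> w" and j = "\<lambda>w. u \<circ> w"])
    (simp_all add: assms weyl_comp weyl_inv weyl_inv_comp)

lemma root_lattice_iff: "(a, b) \<in> root_lattice \<longleftrightarrow> 3 dvd a - b"
proof
  assume "(a, b) \<in> root_lattice"
  then obtain m n where "(a, b) = scale m alpha1 + scale n alpha2"
    by (auto simp: root_lattice_def)
  then have "a - b = 3 * (m - n)"
    by (simp add: alpha1_def alpha2_def)
  then show "3 dvd a - b" by simp
next
  assume "3 dvd a - b"
  then obtain k where "a = b + 3 * k" by (auto simp: dvd_def algebra_simps)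
  then have "(a, b) = scale (b + 2 * k) alpha1 + scale (b + k) alpha2"
    by (simp add: alpha1_def alpha2_def)
  then show "(a, b) \<in> root_lattice"
    unfolding root_lattice_def by blast
qed

lemma root_lattice_add: "x \<in> root_lattice \<Longrightarrow> y \<in> root_lattice \<Longrightarrow> x + y \<in> root_lattice"
  by (cases x; cases y) (simp add: root_lattice_iff add_diff_add)

lemma root_lattice_minus: "x \<in> root_lattice \<Longrightarrow> - x \<in> root_lattice"
  by (cases x) (simp add: root_lattice_iff, presburger)

lemma root_lattice_weyl: "w \<in> weyl \<Longrightarrow> x \<in> root_lattice \<Longrightarrow> w x \<in> root_lattice"
  by (cases x; erule weyl_cases; simp add: root_lattice_iff refl_pair) presburger+

lemma weyl_coset: "w \<in> weyl \<Longrightarrow> w x - x \<in> root_lattice"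
  by (cases x; erule weyl_cases; simp add: root_lattice_iff refl_pair zero_prod_def)

lemma scale_add: "scale n (x + y) = scale n x + scale n y"
  by (cases x; cases y) (simp add: algebra_simps)

lemma scale_minus: "scale n (- x) = - scale n x"
  by (cases x) simp

lemma scale_diff: "scale n (x - y) = scale n x - scale n y"
  by (cases x; cases y) (simp add: algebra_simps)

section \<open>Weight multiplicities\<close>

lemma kostant_root:
  "int (kostant (2 * m - n, 2 * n - m)) = max 0 (min m n + 1)"
proof -
  have "{(a :: nat, b :: nat, c :: nat).
     scale (int a) alpha1 + scale (int b) alpha2 + scale (int c) theta = (2 * m - n, 2 * n - m)}
     = (\<lambda>c. (nat (m - int c), nat (n - int c), c)) ` {c. int c \<le> min m n}" (is "?L = ?R")
  proof (intro equalityI subsetI)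
    fix t assume "t \<in> ?L"
    then obtain a b c where t: "t = (a, b, c)" and
      e: "2 * int a - int b + int c = 2 * m - n" "2 * int b - int a + int c = 2 * n - m"
      by (auto simp: alpha1_def alpha2_def theta_def)
    from e have "int a = m - int c" "int b = n - int c" by linarith+
    then have "a = nat (m - int c)" "b = nat (n - int c)" "int c \<le> min m n" by linarith+
    then show "t \<in> ?R" using t by blast
  next
    fix t assume "t \<in> ?R"
    then show "t \<in> ?L"
      by (auto simp: alpha1_def alpha2_def theta_def)
  qed
  then have "kostant (2 * m - n, 2 * n - m)
      = card ((\<lambda>c. (nat (m - int c), nat (n - int c), c)) ` {c. int c \<le> min m n})"
    unfolding kostant_def by (rule arg_cong)
  also have "\<dots> = card {c. int c \<le> min m n}"
    by (rule card_image) (auto simp: inj_on_def)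
  also have "{c. int c \<le> min m n} = {..<nat (min m n + 1)}"
    by auto
  finally show ?thesis by simp
qed

lemma kostant_not_root:
  assumes "v \<notin> root_lattice" shows "kostant v = 0"
proof -
  have "scale (int a) alpha1 + scale (int b) alpha2 + scale (int c) theta \<in> root_lattice" for a b c
  proof -
    have "scale (int a) alpha1 + scale (int b) alpha2 + scale (int c) theta =
        scale (int (a + c)) alpha1 + scale (int (b + c)) alpha2"
      by (simp add: alpha1_def alpha2_def theta_pair algebra_simps)
    then show ?thesis unfolding root_lattice_def by blast
  qed
  then have "{(a :: nat, b :: nat, c :: nat).
     scale (int a) alpha1 + scale (int b) alpha2 + scale (int c) theta = v} = {}"
    using assms by auto
  then show ?thesis unfolding kostant_def by (metis card.empty)
qed

text \<open>In root coordinates the Kostant partition function depends only on the minimum. Away from the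
diagonal the six terms cancel in pairs, and on the diagonal they add up to the second difference of
\<open>max 0 (d + 1)\<close>.\<close>

lemma kostant_alternating_sum:
  fixes m n :: int
  defines "K \<equiv> \<lambda>a b. max 0 (min a b + 1)"
  shows "K m n - K (m - 1) n - K m (n - 1) + K (m - 2) (n - 1) + K (m - 1) (n - 2)
    - K (m - 2) (n - 2) = (if m = 0 \<and> n = 0 then 1 else 0)"
proof -
  define x where "x = (\<lambda>d :: int. max 0 (d + 1))"
  have K1: "K a b = x a" if "a \<le> b" for a b using that by (simp add: K_def x_def)
  have K2: "K a b = x b" if "b \<le> a" for a b using that by (simp add: K_def x_def)
  consider "m < n" | "n < m" | "m = n" by linarith
  then show ?thesis
  proof cases
    case 1
    then have "K m n = x m" "K (m - 1) n = x (m - 1)" "K m (n - 1) = x m"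
      "K (m - 2) (n - 1) = x (m - 2)" "K (m - 1) (n - 2) = x (m - 1)" "K (m - 2) (n - 2) = x (m - 2)"
      by (simp_all add: K1)
    then show ?thesis using 1 by simp
  next
    case 2
    then have "K m n = x n" "K (m - 1) n = x n" "K m (n - 1) = x (n - 1)"
      "K (m - 2) (n - 1) = x (n - 1)" "K (m - 1) (n - 2) = x (n - 2)" "K (m - 2) (n - 2) = x (n - 2)"
      by (simp_all add: K2)
    then show ?thesis using 2 by simp
  next
    case 3
    then have "K m n = x m" "K (m - 1) n = x (m - 1)" "K m (n - 1) = x (m - 1)"
      "K (m - 2) (n - 1) = x (m - 2)" "K (m - 1) (n - 2) = x (m - 2)" "K (m - 2) (n - 2) = x (m - 2)"
      by (simp_all add: K1 K2)
    then have "K m n - K (m - 1) n - K m (n - 1) + K (m - 2) (n - 1) + K (m - 1) (n - 2)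
      - K (m - 2) (n - 2) = x m - 2 * x (m - 1) + x (m - 2)" by simp
    also have "\<dots> = (if m = 0 then 1 else 0)" by (auto simp: x_def max_def)
    finally show ?thesis using 3 by simp
  qed
qed

text \<open>The Kostant partition function is the inverse of the Weyl denominator, the product of the factors
\<open>1 - e\<^sup>-\<^sup>\<alpha>\<close> over the positive roots.\<close>

lemma kostant_denominator:
  "(\<Sum>u\<in>weyl. wdet u * int (kostant (v + u rho - rho))) = (if v = 0 then 1 else 0)"
proof (cases "v \<in> root_lattice")
  case True
  then obtain m n where "v = scale m alpha1 + scale n alpha2"
    by (auto simp: root_lattice_def)
  then have v: "v = (2 * m - n, 2 * n - m)"
    by (simp add: alpha1_def alpha2_def)
  have k: "int (kostant (x, y)) = max 0 (min m' n' + 1)"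
    if "x = 2 * m' - n'" "y = 2 * n' - m'" for x y m' n'
    using kostant_root that by simp
  have six: "int (kostant (v + id rho - rho)) = max 0 (min m n + 1)"
    "int (kostant (v + refl1 rho - rho)) = max 0 (min (m - 1) n + 1)"
    "int (kostant (v + refl2 rho - rho)) = max 0 (min m (n - 1) + 1)"
    "int (kostant (v + (refl1 \<circ> refl2) rho - rho)) = max 0 (min (m - 2) (n - 1) + 1)"
    "int (kostant (v + (refl2 \<circ> refl1) rho - rho)) = max 0 (min (m - 1) (n - 2) + 1)"
    "int (kostant (v + (refl1 \<circ> refl2 \<circ> refl1) rho - rho)) = max 0 (min (m - 2) (n - 2) + 1)"
    by (simp add: v rho_pair refl_pair; rule k; simp)+
  have v0: "(v = 0) = (m = 0 \<and> n = 0)" by (auto simp: v zero_prod_def)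
  show ?thesis
    unfolding sum_weyl wdet_simps six v0 using kostant_alternating_sum[of m n] by linarith
next
  case False
  have "v + u rho - rho \<notin> root_lattice" if "u \<in> weyl" for u
    using False that
    by (cases v; elim weyl_cases; simp add: root_lattice_iff refl_pair rho_pair; presburger)
  moreover have "v \<noteq> 0" using False by (auto simp: zero_prod_def root_lattice_iff)
  ultimately show ?thesis by (simp add: kostant_not_root)
qed

lemma mult_outside_coset:
  assumes "\<kappa> - \<nu> \<notin> root_lattice" shows "mult \<kappa> \<nu> = 0"
proof -
  have "dot w \<kappa> - \<nu> \<notin> root_lattice" if "w \<in> weyl" for w
  proof
    assume "dot w \<kappa> - \<nu> \<in> root_lattice"
    from root_lattice_add[OF this root_lattice_minus[OF weyl_coset[OF that, of "\<kappa> + rho"]]]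
    show False using assms by (simp add: dot_def)
  qed
  then show ?thesis
    by (simp add: mult_def kostant_not_root)
qed

text \<open>Here \<open>\<kappa> + rho\<close> is \<open>(k, l)\<close>, and \<open>\<kappa> - \<nu>\<close> has the root coordinates \<open>m\<close> and \<open>n\<close>. Each of the three
reflections preserves a linear form, namely one of the two root coordinates or their difference;
so each value of the first argument, of the second argument, and of their difference occurs
twice, with opposite signs.\<close>

lemma mult_explicit:
  fixes k l m n :: int
  defines "K \<equiv> \<lambda>a b. max 0 (min a b + 1)"
  shows "mult (k - 1, l - 1) (k - 1 - (2 * m - n), l - 1 - (2 * n - m)) =
    K m n - K (m - k) n - K m (n - l) + K (m - k - l) (n - l) + K (m - k) (n - k - l)
    - K (m - k - l) (n - k - l)"
proof -
  have k: "int (kostant (x, y)) = K m' n'"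
    if "x = 2 * m' - n'" "y = 2 * n' - m'" for x y m' n'
    using kostant_root that by (simp add: K_def)
  have "int (kostant (dot id (k - 1, l - 1) - (k - 1 - (2 * m - n), l - 1 - (2 * n - m)))) = K m n"
    "int (kostant (dot refl1 (k - 1, l - 1) - (k - 1 - (2 * m - n), l - 1 - (2 * n - m)))) = K (m - k) n"
    "int (kostant (dot refl2 (k - 1, l - 1) - (k - 1 - (2 * m - n), l - 1 - (2 * n - m)))) = K m (n - l)"
    "int (kostant (dot (refl1 \<circ> refl2) (k - 1, l - 1) - (k - 1 - (2 * m - n), l - 1 - (2 * n - m)))) = 
      K (m - k - l) (n - l)"
    "int (kostant (dot (refl2 \<circ> refl1) (k - 1, l - 1) - (k - 1 - (2 * m - n), l - 1 - (2 * n - m)))) = 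
      K (m - k) (n - k - l)"
    "int (kostant (dot (refl1 \<circ> refl2 \<circ> refl1) (k - 1, l - 1) - (k - 1 - (2 * m - n), l - 1 - (2 * n - m)))) = 
      K (m - k - l) (n - k - l)"
    by (simp add: dot_def rho_pair refl_pair; rule k; simp)+
  then show ?thesis
    unfolding mult_def sum_weyl wdet_simps by simp
qed

text \<open>Where \<open>K a b\<close> is a function of \<open>a\<close> alone or of \<open>b\<close> alone, the terms of \<open>mult_explicit\<close> cancel in
pairs. In the remaining strip near the diagonal \<open>K a b\<close> is \<open>a + 1\<close> plus a function of \<open>b - a\<close> as soon
as both arguments are nonnegative, and both contributions cancel in pairs.\<close>

lemma finite_mult [simp]: "finite {\<nu>. mult \<kappa> \<nu> \<noteq> 0}"
proof -
  define k where "k = fst \<kappa> + 1"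
  define l where "l = snd \<kappa> + 1"
  have \<kappa>: "\<kappa> = (k - 1, l - 1)" by (simp add: k_def l_def prod_eq_iff)
  define C where "C = \<bar>k\<bar> + \<bar>l\<bar>"
  define g where "g = (\<lambda>(m, n). (k - 1 - (2 * m - n), l - 1 - (2 * n - m)))"
  \<comment> \<open>In the support \<open>\<bar>m - n\<bar> < 2 * C\<close> and one of \<open>m\<close> and \<open>n\<close> is less than \<open>C\<close>.\<close>
  have "{\<nu>. mult \<kappa> \<nu> \<noteq> 0} \<subseteq> g ` ({- C..5 * C} \<times> {- C..5 * C})"
  proof
    fix \<nu> assume "\<nu> \<in> {\<nu>. mult \<kappa> \<nu> \<noteq> 0}"
    then have nz: "mult \<kappa> \<nu> \<noteq> 0" by simp
    then have "\<kappa> - \<nu> \<in> root_lattice" using mult_outside_coset by blast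
    then obtain m n where "\<kappa> - \<nu> = scale m alpha1 + scale n alpha2"
      by (auto simp: root_lattice_def)
    then have \<nu>: "\<nu> = g (m, n)"
      by (cases \<nu>) (auto simp: g_def \<kappa> alpha1_def alpha2_def)
    define K where "K = (\<lambda>a b :: int. max 0 (min a b + 1))"
    have nz': "K m n - K (m - k) n - K m (n - l) + K (m - k - l) (n - l) + K (m - k) (n - k - l)
      - K (m - k - l) (n - k - l) \<noteq> 0"
      using nz unfolding \<nu> \<kappa> g_def K_def by (simp add: mult_explicit)
    have C: "\<bar>k\<bar> \<le> C" "\<bar>l\<bar> \<le> C" "\<bar>k + l\<bar> \<le> C" by (auto simp: C_def)
    have K0: "K a b = 0" if "a < 0 \<or> b < 0" for a b using that by (auto simp: K_def)
    have K1: "K a b = max 0 (a + 1)" if "a \<le> b" for a b using that by (auto simp: K_def)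
    have K2: "K a b = max 0 (b + 1)" if "b \<le> a" for a b using that by (auto simp: K_def)
    define x' where "x' = (\<lambda>d :: int. max 0 (d + 1))"
    define x where "x = (\<lambda>d :: int. min 0 d)"
    have K3: "K a b = a + 1 + x d" if "a \<ge> 0" "b \<ge> 0" "d = b - a" for a b d
      using that by (auto simp: K_def x_def)
    have "m \<ge> - C"
    proof (rule ccontr)
      assume "\<not> ?thesis"
      then have "m < 0" "m - k < 0" "m - k - l < 0" using C by linarith+
      then show False using nz' by (simp add: K0)
    qed
    moreover have "n \<ge> - C"
    proof (rule ccontr)
      assume "\<not> ?thesis"
      then have "n < 0" "n - l < 0" "n - k - l < 0" using C by linarith+
      then show False using nz' by (simp add: K0)
    qed
    moreover have "m < n + 2 * C"
    proof (rule ccontr)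
      assume "\<not> ?thesis"
      then have "n \<le> m" "n \<le> m - k" "n - l \<le> m" "n - l \<le> m - k - l" "n - k - l \<le> m - k"
        "n - k - l \<le> m - k - l" using C by linarith+
      then have "K m n = x' n" "K (m - k) n = x' n" "K m (n - l) = x' (n - l)"
        "K (m - k - l) (n - l) = x' (n - l)" "K (m - k) (n - k - l) = x' (n - k - l)"
        "K (m - k - l) (n - k - l) = x' (n - k - l)"
        by (simp_all add: K2 x'_def)
      then show False using nz' by linarith
    qed
    moreover have "n < m + 2 * C"
    proof (rule ccontr)
      assume "\<not> ?thesis"
      then have "m \<le> n" "m - k \<le> n" "m \<le> n - l" "m - k - l \<le> n - l" "m - k \<le> n - k - l"
        "m - k - l \<le> n - k - l" using C by linarith+
      then have "K m n = x' m" "K (m - k) n = x' (m - k)" "K m (n - l) = x' m"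
        "K (m - k - l) (n - l) = x' (m - k - l)" "K (m - k) (n - k - l) = x' (m - k)"
        "K (m - k - l) (n - k - l) = x' (m - k - l)"
        by (simp_all add: K1 x'_def)
      then show False using nz' by linarith
    qed
    moreover have "m < C \<or> n < C"
    proof (rule ccontr)
      assume "\<not> ?thesis"
      then have nonneg: "0 \<le> m" "0 \<le> m - k" "0 \<le> m - k - l" "0 \<le> n" "0 \<le> n - l"
        "0 \<le> n - k - l"
        using C by linarith+
      have "K m n = m + 1 + x (n - m)" "K (m - k) n = m - k + 1 + x (n - m + k)"
        "K m (n - l) = m + 1 + x (n - m - l)"
        "K (m - k - l) (n - l) = m - k - l + 1 + x (n - m + k)"
        "K (m - k) (n - k - l) = m - k + 1 + x (n - m - l)"
        "K (m - k - l) (n - k - l) = m - k - l + 1 + x (n - m)"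
        by (rule K3; use nonneg in simp)+
      then show False using nz' by linarith
    qed
    ultimately have "m \<in> {- C..5 * C}" "n \<in> {- C..5 * C}" using C by auto
    then show "\<nu> \<in> g ` ({- C..5 * C} \<times> {- C..5 * C})" using \<nu> by blast
  qed
  then show ?thesis by (rule finite_subset) simp
qed

lemma scale_zero [simp]: "scale n 0 = 0"
  by (simp add: zero_prod_def)

lemma card_weyl: "card weyl = 6"
  using sum_weyl[of "\<lambda>_. 1 :: nat"] by simp

section \<open>Characters as functionals\<close>

text \<open>The formal character paired with an arbitrary function \<open>g\<close> in place of \<open>e\<^sup>\<nu>\<close>. Identities between
characters are proved for all \<open>g\<close>; they are then available also at the points of the torus at which
the Weyl denominator vanishes.\<close>

definition charsum :: "weight \<Rightarrow> (weight \<Rightarrow> complex) \<Rightarrow> complex" where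
  "charsum \<kappa> g = (\<Sum>\<nu>\<in>{\<nu>. mult \<kappa> \<nu> \<noteq> 0}. of_int (mult \<kappa> \<nu>) * g \<nu>)"

lemma charsum_superset:
  assumes "finite S" "\<And>\<nu>. mult \<kappa> \<nu> \<noteq> 0 \<Longrightarrow> \<nu> \<in> S"
  shows "charsum \<kappa> g = (\<Sum>\<nu>\<in>S. of_int (mult \<kappa> \<nu>) * g \<nu>)"
  unfolding charsum_def using assms by (intro sum.mono_neutral_left) auto

lemma charsum_add: "charsum \<kappa> (\<lambda>\<nu>. g \<nu> + h \<nu>) = charsum \<kappa> g + charsum \<kappa> h"
  by (simp add: charsum_def distrib_left sum.distrib)

lemma charsum_cmult: "charsum \<kappa> (\<lambda>\<nu>. c * g \<nu>) = c * charsum \<kappa> g"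
  by (simp add: charsum_def sum_distrib_left mult.left_commute)

lemma charsum_sum: "charsum \<kappa> (\<lambda>\<nu>. \<Sum>i\<in>I. g i \<nu>) = (\<Sum>i\<in>I. charsum \<kappa> (g i))"
  unfolding charsum_def by (simp add: sum_distrib_left, rule sum.swap)

lemma charsum_shift:
  assumes "finite S" "\<And>\<nu>. mult \<kappa> \<nu> \<noteq> 0 \<Longrightarrow> \<nu> + c \<in> S"
  shows "charsum \<kappa> (\<lambda>\<nu>. g (\<nu> + c)) = (\<Sum>\<xi>\<in>S. of_int (mult \<kappa> (\<xi> - c)) * g \<xi>)"
proof -
  have "charsum \<kappa> (\<lambda>\<nu>. g (\<nu> + c)) = (\<Sum>\<nu>\<in>(\<lambda>\<xi>. \<xi> - c) ` S. of_int (mult \<kappa> \<nu>) * g (\<nu> + c))"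
    by (rule charsum_superset) (use assms in \<open>auto simp: image_iff intro!: bexI[of _ "_ + c"]\<close>)
  also have "\<dots> = (\<Sum>\<xi>\<in>S. of_int (mult \<kappa> (\<xi> - c)) * g \<xi>)"
    by (subst sum.reindex) (auto simp: inj_on_def)
  finally show ?thesis .
qed

lemma mult_denominator:
  "(\<Sum>u\<in>weyl. wdet u * mult \<kappa> (\<xi> - (u rho - rho))) =
   (\<Sum>w\<in>weyl. wdet w * (if dot w \<kappa> = \<xi> then 1 else 0))"
proof -
  have "(\<Sum>u\<in>weyl. wdet u * mult \<kappa> (\<xi> - (u rho - rho))) =
      (\<Sum>u\<in>weyl. \<Sum>w\<in>weyl. wdet w * (wdet u * int (kostant ((dot w \<kappa> - \<xi>) + u rho - rho))))"
    by (simp add: mult_def sum_distrib_left mult.left_commute algebra_simps)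
  also have "\<dots> = (\<Sum>w\<in>weyl. wdet w *
      (\<Sum>u\<in>weyl. wdet u * int (kostant ((dot w \<kappa> - \<xi>) + u rho - rho))))"
    by (subst sum.swap) (simp only: sum_distrib_left)
  finally show ?thesis
    by (simp only: kostant_denominator right_minus_eq)
qed

text \<open>Weyl's character formula in the dual form: the denominator acts on \<open>g\<close> as a difference operator.\<close>

lemma weyl_character_formula:
  "charsum \<kappa> (\<lambda>\<nu>. \<Sum>u\<in>weyl. of_int (wdet u) * g (\<nu> + (u rho - rho))) =
   (\<Sum>w\<in>weyl. of_int (wdet w) * g (dot w \<kappa>))"
proof -
  define S where "S = (\<Union>u\<in>weyl. (\<lambda>\<nu>. \<nu> + (u rho - rho)) ` {\<nu>. mult \<kappa> \<nu> \<noteq> 0}) \<union> (\<lambda>w. dot w \<kappa>) ` weyl"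
  have fin: "finite S" by (simp add: S_def)
  have mem: "\<nu> + (u rho - rho) \<in> S" if "u \<in> weyl" "mult \<kappa> \<nu> \<noteq> 0" for u \<nu>
    using that unfolding S_def by blast
  have "charsum \<kappa> (\<lambda>\<nu>. \<Sum>u\<in>weyl. of_int (wdet u) * g (\<nu> + (u rho - rho))) =
      (\<Sum>u\<in>weyl. of_int (wdet u) * charsum \<kappa> (\<lambda>\<nu>. g (\<nu> + (u rho - rho))))"
    by (simp only: charsum_sum charsum_cmult)
  also have "\<dots> = (\<Sum>u\<in>weyl. of_int (wdet u) *
      (\<Sum>\<xi>\<in>S. of_int (mult \<kappa> (\<xi> - (u rho - rho))) * g \<xi>))"
    by (rule sum.cong[OF refl], subst charsum_shift[OF fin]) (auto intro: mem)
  also have "\<dots> = (\<Sum>\<xi>\<in>S. g \<xi> * of_int (\<Sum>u\<in>weyl. wdet u * mult \<kappa> (\<xi> - (u rho - rho))))"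
    by (simp add: sum_distrib_left sum.swap[of _ weyl S] mult_ac)
  also have "\<dots> = (\<Sum>\<xi>\<in>S. \<Sum>w\<in>weyl. of_int (wdet w) * (if dot w \<kappa> = \<xi> then g \<xi> else 0))"
    unfolding mult_denominator of_int_sum of_int_mult sum_distrib_left
    by (intro sum.cong refl) auto
  also have "\<dots> = (\<Sum>w\<in>weyl. of_int (wdet w) * (\<Sum>\<xi>\<in>S. if dot w \<kappa> = \<xi> then g \<xi> else 0))"
    by (subst sum.swap) (simp only: sum_distrib_left)
  also have "\<dots> = (\<Sum>w\<in>weyl. of_int (wdet w) * g (dot w \<kappa>))"
    by (rule sum.cong[OF refl]) (simp add: fin S_def)
  finally show ?thesis .
qed

text \<open>A difference equation is solved by summing along each line in direction \<open>\<alpha>\<close>, starting from the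
points with \<open>0 \<le> fst \<eta> < fst \<alpha>\<close>.\<close>

lemma difference_onto_aux:
  fixes g :: "weight \<Rightarrow> complex"
  assumes "fst \<alpha> > 0"
  shows "\<exists>h. \<forall>\<eta>. g \<eta> = h \<eta> - h (\<eta> - \<alpha>)"
proof -
  define a where "a = fst \<alpha>"
  define G where "G = (\<lambda>n \<eta>. (\<Sum>i\<in>{0..n}. g (\<eta> + scale i \<alpha>)) - (\<Sum>i\<in>{n + 1..-1}. g (\<eta> + scale i \<alpha>)))"
  define h where "h = (\<lambda>\<eta>. G (fst \<eta> div a) (\<eta> - scale (fst \<eta> div a) \<alpha>))"
  have step: "G n \<eta> - G (n - 1) \<eta> = g (\<eta> + scale n \<alpha>)" for n \<eta>
  proof (cases "n \<ge> 0")
    case True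
    then have "{0..n} = insert n {0..n - 1}" "{n + 1..-1} = {}" "{n..-1} = {}" by auto
    then show ?thesis by (simp add: G_def)
  next
    case False
    then have "{n..-1} = insert n {n + 1..-1}" "{0..n} = {}" "{0..n - 1} = {}" by auto
    then show ?thesis by (simp add: G_def)
  qed
  have "g \<eta> = h \<eta> - h (\<eta> - \<alpha>)" for \<eta>
  proof -
    define n where "n = fst \<eta> div a"
    have "fst (\<eta> - \<alpha>) = fst \<eta> + (- 1) * a" by (simp add: a_def)
    then have "fst (\<eta> - \<alpha>) div a = n - 1" 
      using assms unfolding n_def a_def by (metis add.commute div_mult_self1 less_irrefl uminus_add_conv_diff)
    moreover have "\<eta> - \<alpha> - scale (n - 1) \<alpha> = \<eta> - scale n \<alpha>"
      by (cases \<eta>; cases \<alpha>) (simp add: algebra_simps)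
    ultimately have "h (\<eta> - \<alpha>) = G (n - 1) (\<eta> - scale n \<alpha>)"
      by (simp only: h_def)
    moreover have "h \<eta> = G n (\<eta> - scale n \<alpha>)" by (simp only: h_def n_def)
    ultimately show ?thesis
      using step[of n "\<eta> - scale n \<alpha>"] by simp
  qed
  then show ?thesis by blast
qed

lemma difference_onto:
  fixes g :: "weight \<Rightarrow> complex"
  assumes "fst \<alpha> \<noteq> 0"
  obtains h where "\<And>\<eta>. g \<eta> = h \<eta> - h (\<eta> - \<alpha>)"
proof (cases "fst \<alpha> > 0")
  case True
  then show ?thesis using difference_onto_aux that by blast
next
  case False
  then have "fst (- \<alpha>) > 0" using assms by simp
  from difference_onto_aux[OF this, of g]
  obtain h where "\<And>\<eta>. g \<eta> = h \<eta> - h (\<eta> - - \<alpha>)" by blast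
  then have "g \<eta> = (- h (\<eta> + \<alpha>)) - (- h ((\<eta> - \<alpha>) + \<alpha>))" for \<eta> by simp
  then show ?thesis by (rule that[of "\<lambda>\<eta>. - h (\<eta> + \<alpha>)"])
qed

text \<open>Consequently every \<open>g\<close> has the form required in \<open>weyl_character_formula\<close>, which therefore determines
\<open>charsum\<close>. For general \<open>n\<close> this is the denominator with all exponents multiplied by \<open>n\<close>.\<close>

lemma denominator_onto:
  fixes g :: "weight \<Rightarrow> complex"
  assumes "n \<noteq> 0"
  obtains h where "\<And>\<eta>. g \<eta> = (\<Sum>u\<in>weyl. of_int (wdet u) * h (\<eta> + scale n (u rho - rho)))"
proof -
  have "fst (scale n alpha1) \<noteq> 0" "fst (scale n alpha2) \<noteq> 0" "fst (scale n theta) \<noteq> 0"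
    using assms by (simp_all add: alpha1_def alpha2_def theta_pair)
  then obtain h1 h2 h where
    "\<And>\<eta>. g \<eta> = h1 \<eta> - h1 (\<eta> - scale n alpha1)"
    "\<And>\<eta>. h1 \<eta> = h2 \<eta> - h2 (\<eta> - scale n alpha2)"
    "\<And>\<eta>. h2 \<eta> = h \<eta> - h (\<eta> - scale n theta)"
    by (metis difference_onto)
  then have h: "g (x, y) = h1 (x, y) - h1 (x - 2 * n, y + n)"
    "h1 (x, y) = h2 (x, y) - h2 (x + n, y - 2 * n)"
    "h2 (x, y) = h (x, y) - h (x - n, y - n)" for x y
    by (simp_all add: alpha1_def alpha2_def theta_pair mult.commute)
  have "g \<eta> = (\<Sum>u\<in>weyl. of_int (wdet u) * h (\<eta> + scale n (u rho - rho)))" for \<eta>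
    unfolding sum_weyl wdet_simps
    by (cases \<eta>) (simp add: h refl_pair rho_pair algebra_simps)
  then show ?thesis by (rule that)
qed

lemma dot_comp: "w \<in> weyl \<Longrightarrow> dot w (dot u \<kappa>) = dot (w \<circ> u) \<kappa>"
  by (simp add: dot_def)

text \<open>If \<open>g\<close> is the image of \<open>h\<close> under the denominator, then \<open>g \<circ> w\<close> is the image of \<open>wdet w * (h \<circ> dot w)\<close>,
which leaves the alternating sum over the orbit of the highest weight unchanged.\<close>

lemma charsum_weyl:
  assumes w: "w \<in> weyl"
  shows "charsum \<kappa> (\<lambda>\<nu>. g (w \<nu>)) = charsum \<kappa> g"
proof -
  obtain h where h: "\<And>\<eta>. g \<eta> = (\<Sum>u\<in>weyl. of_int (wdet u) * h (\<eta> + scale 1 (u rho - rho)))"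
    by (rule denominator_onto[of 1 g]) auto
  have s1: "scale 1 v = v" for v by (cases v) simp
  note h = h[unfolded s1]
  let ?d = "complex_of_int (wdet w)"
  have "charsum \<kappa> (\<lambda>\<nu>. g (w \<nu>)) = charsum \<kappa> (\<lambda>\<nu>. ?d *
     (\<Sum>u\<in>weyl. of_int (wdet u) * (\<lambda>\<nu>. h (dot w \<nu>)) (\<nu> + (u rho - rho))))"
  proof (rule arg_cong[of _ _ "charsum \<kappa>"], rule ext)
    fix \<nu>
    have "g (w \<nu>) = (\<Sum>u\<in>weyl. of_int (wdet (w \<circ> u)) * h (w \<nu> + ((w \<circ> u) rho - rho)))"
      unfolding h by (rule sum_weyl_comp_left[OF w, symmetric])
    also have "\<dots> = (\<Sum>u\<in>weyl. of_int (wdet w) * (of_int (wdet u) * h (dot w (\<nu> + (u rho - rho)))))"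
      by (rule sum.cong) (simp_all add: wdet_comp w dot_def weyl_add weyl_diff algebra_simps)
    finally show "g (w \<nu>) = ?d * (\<Sum>u\<in>weyl. of_int (wdet u) * h (dot w (\<nu> + (u rho - rho))))"
      by (simp add: sum_distrib_left)
  qed
  also have "\<dots> = ?d * (\<Sum>u\<in>weyl. of_int (wdet u) * h (dot (w \<circ> u) \<kappa>))"
    unfolding charsum_cmult
    using weyl_character_formula[of \<kappa> "\<lambda>\<nu>. h (dot w \<nu>)"] by (simp add: dot_comp w)
  also have "\<dots> = (\<Sum>u\<in>weyl. of_int (wdet (w \<circ> u)) * h (dot (w \<circ> u) \<kappa>))"
    unfolding sum_distrib_left by (rule sum.cong) (simp_all add: wdet_comp w)
  also have "\<dots> = (\<Sum>u\<in>weyl. of_int (wdet u) * h (dot u \<kappa>))"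
    by (rule sum_weyl_comp_left[OF w])
  also have "\<dots> = charsum \<kappa> g"
    unfolding h weyl_character_formula ..
  finally show ?thesis .
qed

lemma mult_weyl:
  assumes "w \<in> weyl" shows "mult \<kappa> (w \<nu>) = mult \<kappa> \<nu>"
proof -
  have delta: "charsum \<kappa> (\<lambda>\<xi>. if \<xi> = v then 1 else 0) = of_int (mult \<kappa> v)" for v
    by (simp add: charsum_superset[of "insert v {\<nu>. mult \<kappa> \<nu> \<noteq> 0}"] if_distrib[of "(*) _"]
        cong: if_cong)
  have "(\<lambda>\<xi>. if w \<xi> = w \<nu> then 1 else (0 :: complex)) = (\<lambda>\<xi>. if \<xi> = \<nu> then 1 else 0)"
    using assms by (metis weyl_inv_apply(1))
  then have "complex_of_int (mult \<kappa> (w \<nu>)) = of_int (mult \<kappa> \<nu>)"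
    using charsum_weyl[OF assms, of \<kappa> "\<lambda>\<xi>. if \<xi> = w \<nu> then 1 else 0"] by (simp add: delta)
  then show ?thesis by simp
qed

text \<open>On antisymmetric functions the average over the Weyl group becomes the denominator, so a character
acts by evaluation at its highest weight.\<close>

lemma charsum_antisym:
  assumes anti: "\<And>w v. w \<in> weyl \<Longrightarrow> g (w v) = of_int (wdet w) * g v"
  shows "charsum \<kappa> (\<lambda>\<nu>. g (\<nu> + rho)) = g (\<kappa> + rho)"
proof -
  have "6 * charsum \<kappa> (\<lambda>\<nu>. g (\<nu> + rho)) = (\<Sum>u\<in>weyl. charsum \<kappa> (\<lambda>\<nu>. g (inv u \<nu> + rho)))"
    by (simp add: charsum_weyl[OF weyl_inv, of _ _ "\<lambda>\<nu>. g (\<nu> + rho)"] card_weyl)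
  also have "\<dots> = charsum \<kappa> (\<lambda>\<nu>. \<Sum>u\<in>weyl. of_int (wdet u) * (\<lambda>\<nu>. g (\<nu> + rho)) (\<nu> + (u rho - rho)))"
    unfolding charsum_sum
  proof (intro sum.cong refl arg_cong[of _ _ "charsum \<kappa>"] ext)
    fix u \<nu> assume u: "u \<in> weyl"
    have "g (\<nu> + u rho) = of_int (wdet u) * g (inv u \<nu> + rho)"
      using anti[OF u, of "inv u \<nu> + rho"] u by (simp add: weyl_add)
    then have "of_int (wdet u) * g (\<nu> + u rho) = of_int (wdet u * wdet u) * g (inv u \<nu> + rho)"
      by simp
    then show "g (inv u \<nu> + rho) = of_int (wdet u) * g (\<nu> + (u rho - rho) + rho)"
      using wdet_square[OF u] by (simp add: add_diff_eq)
  qed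
  also have "\<dots> = (\<Sum>w\<in>weyl. of_int (wdet w) * g (w (\<kappa> + rho)))"
    using weyl_character_formula[of \<kappa> "\<lambda>\<nu>. g (\<nu> + rho)"] by (simp add: dot_def)
  also have "\<dots> = (\<Sum>w\<in>weyl. of_int (wdet w * wdet w) * g (\<kappa> + rho))"
    by (rule sum.cong) (simp_all add: anti)
  also have "\<dots> = (\<Sum>w\<in>weyl. g (\<kappa> + rho))"
    by (rule sum.cong) (simp_all add: wdet_square)
  also have "\<dots> = 6 * g (\<kappa> + rho)" by (simp add: card_weyl)
  finally show ?thesis by simp
qed

lemma charsum_Lam1: "charsum Lam1 g = g (1, 0) + g (- 1, 1) + g (0, - 1)"
  and charsum_Lam2: "charsum Lam2 g = g (0, 1) + g (1, - 1) + g (- 1, 0)"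
proof -
  obtain h where h: "\<And>\<eta>. g \<eta> = (\<Sum>u\<in>weyl. of_int (wdet u) * h (\<eta> + scale 1 (u rho - rho)))"
    by (rule denominator_onto[of 1 g]) auto
  have s1: "scale 1 v = v" for v by (cases v) simp
  note h = h[unfolded s1]
  have "charsum \<kappa> g = (\<Sum>w\<in>weyl. of_int (wdet w) * h (dot w \<kappa>))" for \<kappa>
    unfolding h weyl_character_formula ..
  then show "charsum Lam1 g = g (1, 0) + g (- 1, 1) + g (0, - 1)"
    "charsum Lam2 g = g (0, 1) + g (1, - 1) + g (- 1, 0)"
    unfolding h sum_weyl wdet_simps
    by (simp_all add: dot_def Lam1_def Lam2_def refl_pair rho_pair)
qed

section \<open>Decomposition of characters modulo three\<close>

text \<open>The sum over the six roots, so that \<open>2 * k 0 + rootsum k\<close> is the pairing with the adjoint character.\<close>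

definition rootsum :: "(weight \<Rightarrow> complex) \<Rightarrow> complex" where
  "rootsum k = k (2, - 1) + k (- 1, 2) + k (1, 1) + k (- 2, 1) + k (1, - 2) + k (- 1, - 1)"

text \<open>The pairing with the character of highest weight \<open>2 \<rho>\<close>, which is the product of the factors
\<open>e\<^sup>\<alpha> + 1 + e\<^sup>-\<^sup>\<alpha>\<close> over the positive roots.\<close>

definition sum27 :: "(weight \<Rightarrow> complex) \<Rightarrow> complex" where
  "sum27 k = (\<Sum>a\<in>{-1, 0, 1}. \<Sum>b\<in>{-1, 0, 1}. \<Sum>c\<in>{-1, 0, 1}.
     k (scale a alpha1 + scale b alpha2 + scale c theta))"

lemma rootsum_weyl: "w \<in> weyl \<Longrightarrow> rootsum (\<lambda>\<nu>. k (w \<nu>)) = rootsum k"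
  by (erule weyl_cases) (simp_all add: rootsum_def refl_pair)

lemma sum27_weyl: "w \<in> weyl \<Longrightarrow> sum27 (\<lambda>\<nu>. k (w \<nu>)) = sum27 k"
proof (induction arbitrary: k rule: weyl.induct)
  case weyl_id
  then show ?case by simp
next
  case (weyl_refl1 w)
  have "sum27 (\<lambda>\<nu>. k (refl1 \<nu>)) = sum27 k"
    by (simp add: sum27_def alpha1_def alpha2_def theta_pair refl_pair)
  then show ?case using weyl_refl1.IH[of "\<lambda>\<nu>. k (refl1 \<nu>)"] by simp
next
  case (weyl_refl2 w)
  have "sum27 (\<lambda>\<nu>. k (refl2 \<nu>)) = sum27 k"
    by (simp add: sum27_def alpha1_def alpha2_def theta_pair refl_pair)
  then show ?case using weyl_refl2.IH[of "\<lambda>\<nu>. k (refl2 \<nu>)"] by simp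
qed

text \<open>The factorisation \<open>1 - e\<^sup>-\<^sup>3\<^sup>\<alpha> = (1 - e\<^sup>-\<^sup>\<alpha>) (1 + e\<^sup>-\<^sup>\<alpha> + e\<^sup>-\<^sup>2\<^sup>\<alpha>)\<close>, multiplied over the positive roots.\<close>

lemma denominator_cube:
  "(\<Sum>u\<in>weyl. of_int (wdet u) * h (\<eta> + scale 3 (u rho - rho))) =
   (\<Sum>u\<in>weyl. of_int (wdet u) * sum27 (\<lambda>\<nu>. h (\<eta> + (u rho - rho) - scale 2 rho + \<nu>)))"
  unfolding sum_weyl wdet_simps
  by (cases \<eta>) (simp add: sum27_def alpha1_def alpha2_def theta_pair refl_pair rho_pair algebra_simps)

text \<open>The weights of highest weight \<open>2 \<rho>\<close>, shifted by \<open>\<rho>\<close>, consist of three single points and of three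
adjoint weight diagrams, all centred at points of \<open>3 P\<close>.\<close>

lemma sum27_decomp:
  "sum27 (\<lambda>\<nu>. k (rho + \<nu>)) =
   (\<Sum>j\<in>{0, scale 2 Lam1, scale 2 Lam2}. k (scale 3 (rho - j))) +
   (\<Sum>j\<in>{rho, Lam1, Lam2}. 2 * k (scale 3 (rho - j)) + rootsum (\<lambda>\<beta>. k (scale 3 (rho - j) + \<beta>)))"
  by (simp add: sum27_def rootsum_def alpha1_def alpha2_def theta_pair rho_pair Lam1_def Lam2_def
      zero_prod_def)

text \<open>Sorts the weights of the module of highest weight \<open>3 l + y \<cdot> 0\<close> by their class modulo \<open>3 P\<close>: its
character is a combination of the trivial and the adjoint character, with coefficients that are
characters with all exponents multiplied by three. Both sides are compared after multiplication by
the denominator with tripled exponents. There the left-hand side becomes an alternating sum over the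
27 weights of \<open>2 \<rho>\<close> by \<open>denominator_cube\<close>, and \<open>sum27_decomp\<close> regroups them.\<close>

lemma charsum_mod3:
  assumes y: "y \<in> weyl"
  shows "charsum (scale 3 l + dot y 0) g =
    (\<Sum>j\<in>{0, scale 2 Lam1, scale 2 Lam2}. charsum (l + dot y (- j)) (\<lambda>\<nu>. g (scale 3 \<nu>))) +
    (\<Sum>j\<in>{rho, Lam1, Lam2}. charsum (l + dot y (- j))
       (\<lambda>\<nu>. 2 * g (scale 3 \<nu>) + rootsum (\<lambda>\<beta>. g (scale 3 \<nu> + \<beta>))))"
proof -
  obtain h where h: "\<And>\<eta>. g \<eta> = (\<Sum>u\<in>weyl. of_int (wdet u) * h (\<eta> + scale 3 (u rho - rho)))"
    by (rule denominator_onto[of 3 g]) auto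
  define J where "J = (\<lambda>v. \<Sum>w\<in>weyl. complex_of_int (wdet w) * h (w v - scale 3 rho))"
  define k where "k = (\<lambda>v. J (scale 3 l + y v))"
  have s27: "sum27 (\<lambda>\<nu>. \<Sum>w\<in>weyl. f w * G w \<nu>) = (\<Sum>w\<in>weyl. f w * sum27 (G w))" for f G
    unfolding sum27_def by (simp add: sum_weyl algebra_simps)
  have rs: "rootsum (\<lambda>\<nu>. \<Sum>w\<in>weyl. f w * G w \<nu>) = (\<Sum>w\<in>weyl. f w * rootsum (G w))" for f G
    unfolding rootsum_def by (simp add: sum.distrib sum_distrib_left algebra_simps)
  have ch_root: "charsum \<kappa> (\<lambda>\<nu>. rootsum (G \<nu>)) = rootsum (\<lambda>\<beta>. charsum \<kappa> (\<lambda>\<nu>. G \<nu> \<beta>))" for \<kappa> G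
    unfolding rootsum_def by (simp only: charsum_add)
  have "charsum (scale 3 l + dot y 0) g = (\<Sum>w\<in>weyl. of_int (wdet w) *
      sum27 (\<lambda>\<nu>. h (dot w (scale 3 l + dot y 0) - scale 2 rho + \<nu>)))"
    unfolding h denominator_cube 
    using weyl_character_formula[of "scale 3 l + dot y 0" "\<lambda>\<eta>. sum27 (\<lambda>\<nu>. h (\<eta> - scale 2 rho + \<nu>))"]
    by simp
  also have "\<dots> = (\<Sum>w\<in>weyl. of_int (wdet w) *
      sum27 (\<lambda>\<nu>. h (w (scale 3 l + y (rho + \<nu>)) - scale 3 rho)))"
  proof (intro sum.cong refl arg_cong2[of _ _ _ _ "(*)"])
    fix w assume w: "w \<in> weyl"
    have "sum27 (\<lambda>\<nu>. h (dot w (scale 3 l + dot y 0) - scale 2 rho + \<nu>)) =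
        sum27 (\<lambda>\<nu>. h (dot w (scale 3 l + dot y 0) - scale 2 rho + (w \<circ> y) \<nu>))"
      by (rule sum27_weyl[OF weyl_comp[OF w y], symmetric])
    also have "\<dots> = sum27 (\<lambda>\<nu>. h (w (scale 3 l + y (rho + \<nu>)) - scale 3 rho))"
      by (simp add: dot_def weyl_add w y rho_pair algebra_simps)
    finally show "sum27 (\<lambda>\<nu>. h (dot w (scale 3 l + dot y 0) - scale 2 rho + \<nu>)) =
      sum27 (\<lambda>\<nu>. h (w (scale 3 l + y (rho + \<nu>)) - scale 3 rho))" .
  qed
  also have "\<dots> = sum27 (\<lambda>\<nu>. k (rho + \<nu>))"
    by (simp only: k_def J_def s27)
  finally have lhs: "charsum (scale 3 l + dot y 0) g = sum27 (\<lambda>\<nu>. k (rho + \<nu>))" .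
  have dot3: "scale 3 (dot w (l + dot y (- j))) = w (scale 3 l + y (scale 3 (rho - j))) - scale 3 rho"
    if w: "w \<in> weyl" for w j
    by (simp add: dot_def weyl_add weyl_diff weyl_minus w y scale_add scale_diff weyl_scale algebra_simps)
  have g3: "g (scale 3 \<nu> + \<beta>) = (\<Sum>u\<in>weyl. of_int (wdet u) * (\<lambda>\<nu>. h (scale 3 \<nu> + \<beta>)) (\<nu> + (u rho - rho)))" for \<nu> \<beta>
    unfolding h by (simp only: scale_add add.assoc add.left_commute add.commute)
  have c3: "charsum (l + dot y (- j)) (\<lambda>\<nu>. g (scale 3 \<nu> + \<beta>)) =
     (\<Sum>w\<in>weyl. of_int (wdet w) * h (w (scale 3 l + y (scale 3 (rho - j))) - scale 3 rho + \<beta>))" for j \<beta>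
    unfolding g3 weyl_character_formula[of _ "\<lambda>\<nu>. h (scale 3 \<nu> + \<beta>)"]
    by (rule sum.cong) (simp_all add: dot3)
  have c0: "charsum (l + dot y (- j)) (\<lambda>\<nu>. g (scale 3 \<nu>)) = k (scale 3 (rho - j))" for j
    using c3[of j 0] by (simp add: k_def J_def)
  have c1: "charsum (l + dot y (- j)) (\<lambda>\<nu>. rootsum (\<lambda>\<beta>. g (scale 3 \<nu> + \<beta>))) =
     rootsum (\<lambda>\<beta>. k (scale 3 (rho - j) + \<beta>))" for j
  proof -
    have "charsum (l + dot y (- j)) (\<lambda>\<nu>. rootsum (\<lambda>\<beta>. g (scale 3 \<nu> + \<beta>))) =
      (\<Sum>w\<in>weyl. of_int (wdet w) *
         rootsum (\<lambda>\<beta>. h (w (scale 3 l + y (scale 3 (rho - j))) - scale 3 rho + \<beta>)))"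
      by (simp only: ch_root c3 rs)
    also have "\<dots> = (\<Sum>w\<in>weyl. of_int (wdet w) *
         rootsum (\<lambda>\<beta>. h (w (scale 3 l + y (scale 3 (rho - j) + \<beta>)) - scale 3 rho)))"
    proof (intro sum.cong refl arg_cong2[of _ _ _ _ "(*)"])
      fix w assume w: "w \<in> weyl"
      let ?c = "w (scale 3 l + y (scale 3 (rho - j))) - scale 3 rho"
      have "rootsum (\<lambda>\<beta>. h (?c + \<beta>)) = rootsum (\<lambda>\<beta>. h (?c + (w \<circ> y) \<beta>))"
        by (rule rootsum_weyl[OF weyl_comp[OF w y], symmetric])
      also have "\<dots> = rootsum (\<lambda>\<beta>. h (w (scale 3 l + y (scale 3 (rho - j) + \<beta>)) - scale 3 rho))"
        by (simp add: weyl_add w y algebra_simps)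
      finally show "rootsum (\<lambda>\<beta>. h (?c + \<beta>)) =
        rootsum (\<lambda>\<beta>. h (w (scale 3 l + y (scale 3 (rho - j) + \<beta>)) - scale 3 rho))" .
    qed
    also have "\<dots> = rootsum (\<lambda>\<beta>. k (scale 3 (rho - j) + \<beta>))"
      by (simp only: k_def J_def rs)
    finally show ?thesis .
  qed
  show ?thesis
    unfolding lhs sum27_decomp charsum_add charsum_cmult c0 c1 ..
qed

section \<open>Plane waves\<close>

text \<open>The plane wave \<open>exp (- 2 \<pi> i \<langle>v, \<mu> + \<rho>\<rangle> / (3 p))\<close>. Compared with \<open>wchar\<close> its argument is divided by
three, because the translation by \<open>- \<kappa>\<close> sits at the vertex \<open>3 \<kappa> + \<rho>\<close> of the honeycomb.\<close>

definition wave :: "nat \<Rightarrow> weight \<Rightarrow> weight \<Rightarrow> complex" where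
  "wave p \<mu> v = cis (- (2 * pi / (3 * real p)) * ip v (\<mu> + rho))"

lemma ip_add_left: "ip (v + w) \<mu> = ip v \<mu> + ip w \<mu>"
  by (cases v; cases w; cases \<mu>) (simp add: ip_def add_divide_distrib[symmetric] algebra_simps)

lemma ip_scale_left: "ip (scale n v) \<mu> = of_int n * ip v \<mu>"
  by (cases v; cases \<mu>) (simp add: ip_def algebra_simps)

lemma ip_minus_left: "ip (- v) \<mu> = - ip v \<mu>"
  by (cases v; cases \<mu>) (simp add: ip_def add_divide_distrib[symmetric] minus_divide_left del: of_int_minus, simp)

lemma wave_add: "wave p \<mu> (v + w) = wave p \<mu> v * wave p \<mu> w"
  by (simp add: wave_def ip_add_left cis_mult ring_distribs)

lemma wave_minus: "wave p \<mu> (- v) = cnj (wave p \<mu> v)"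
  by (simp add: wave_def ip_minus_left cis_cnj)

lemma wave_zero [simp]: "wave p \<mu> 0 = 1"
  by (cases \<mu>) (simp add: wave_def ip_def)

lemma wave_scale3:
  "wave p \<mu> (scale 3 \<nu>) = exp (- (2 * of_real pi * \<i> / of_nat p) * of_real (ip \<nu> (\<mu> + rho)))"
  by (simp add: wave_def ip_scale_left cis_conv_exp mult_ac)

lemma wchar_charsum: "wchar p \<kappa> \<mu> = charsum \<kappa> (\<lambda>\<nu>. wave p \<mu> (scale 3 \<nu>))"
  by (simp only: wchar_def charsum_def wave_scale3)

lemma wave_period:
  assumes "p > 0" "\<beta> \<in> root_lattice"
  shows "wave p \<mu> (scale (3 * int p) \<beta>) = 1"
proof -
  obtain m n where \<beta>: "\<beta> = scale m alpha1 + scale n alpha2"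
    using assms by (auto simp: root_lattice_def)
  obtain c d where cd: "\<mu> + rho = (c, d)" by (cases "\<mu> + rho")
  have "ip \<beta> (\<mu> + rho) = of_int (m * c + n * d)"
    unfolding \<beta> cd by (simp add: ip_def alpha1_def alpha2_def field_simps)
  then obtain k :: int where k: "ip \<beta> (\<mu> + rho) = of_int k" by blast
  have "- (2 * pi / (3 * real p)) * ip (scale (3 * int p) \<beta>) (\<mu> + rho) = 2 * pi * of_int (- k)"
    using assms by (simp add: ip_scale_left k)
  then show ?thesis by (simp only: wave_def cis_multiple_2pi Ints_of_int)
qed

text \<open>The antisymmetric combinations of the waves \<open>wave p \<mu> \<circ> w\<close> are split into rotations and reflections,
because the two sublattices of the honeycomb call for different coefficients.\<close>

definition rotsum :: "nat \<Rightarrow> weight \<Rightarrow> weight \<Rightarrow> complex" where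
  "rotsum p \<mu> v = wave p \<mu> v + wave p \<mu> (refl1 (refl2 v)) + wave p \<mu> (refl2 (refl1 v))"

definition reflsum :: "nat \<Rightarrow> weight \<Rightarrow> weight \<Rightarrow> complex" where
  "reflsum p \<mu> v = wave p \<mu> (refl1 v) + wave p \<mu> (refl2 v) + wave p \<mu> (refl1 (refl2 (refl1 v)))"

lemma rotsum_refl:
  "rotsum p \<mu> (refl1 v) = reflsum p \<mu> v" "rotsum p \<mu> (refl2 v) = reflsum p \<mu> v"
  "reflsum p \<mu> (refl1 v) = rotsum p \<mu> v" "reflsum p \<mu> (refl2 v) = rotsum p \<mu> v"
proof -
  have "refl1 (refl1 x) = x" "refl2 (refl2 x) = x"
    "refl2 (refl1 (refl2 x)) = refl1 (refl2 (refl1 x))" for x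
    by (cases x; simp add: refl_pair)+
  then show "rotsum p \<mu> (refl1 v) = reflsum p \<mu> v" "rotsum p \<mu> (refl2 v) = reflsum p \<mu> v"
    "reflsum p \<mu> (refl1 v) = rotsum p \<mu> v" "reflsum p \<mu> (refl2 v) = rotsum p \<mu> v"
    by (simp_all only: rotsum_def reflsum_def add_ac)
qed

lemma rotsum_period:
  assumes "p > 0" "\<beta> \<in> root_lattice"
  shows "rotsum p \<mu> (v + scale (3 * int p) \<beta>) = rotsum p \<mu> v"
    "reflsum p \<mu> (v + scale (3 * int p) \<beta>) = reflsum p \<mu> v"
proof -
  have w: "wave p \<mu> (w (v + scale (3 * int p) \<beta>)) = wave p \<mu> (w v)" if "w \<in> weyl" for w
    using wave_period[OF assms(1) root_lattice_weyl[OF that assms(2)], of \<mu>]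
    by (simp add: weyl_add weyl_scale that wave_add)
  show "rotsum p \<mu> (v + scale (3 * int p) \<beta>) = rotsum p \<mu> v"
    using w[of id] w[of "refl1 \<circ> refl2"] w[of "refl2 \<circ> refl1"]
    by (simp add: rotsum_def weyl_eq)
  show "reflsum p \<mu> (v + scale (3 * int p) \<beta>) = reflsum p \<mu> v"
    using w[of refl1] w[of refl2] w[of "refl1 \<circ> refl2 \<circ> refl1"]
    by (simp add: reflsum_def weyl_eq)
qed

text \<open>From a vertex of the first sublattice the three neighbours are reached by the rotated copies of
\<open>\<rho>\<close>, so a plane wave picks up this factor in a hop. From the second sublattice it is the conjugate.\<close>

definition hop :: "nat \<Rightarrow> weight \<Rightarrow> complex" where
  "hop p \<mu> = rotsum p \<mu> rho"

lemma hop_eq: "hop p \<mu> = wave p \<mu> (1, 1) + wave p \<mu> (- 2, 1) + wave p \<mu> (1, - 2)"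
  by (simp add: hop_def rotsum_def rho_pair refl_pair)

lemma cnj_hop_eq:
  "cnj (hop p \<mu>) = wave p \<mu> (- 1, - 1) + wave p \<mu> (2, - 1) + wave p \<mu> (- 1, 2)"
  by (simp add: hop_eq flip: wave_minus)

lemma reflsum_rho: "reflsum p \<mu> rho = cnj (hop p \<mu>)"
  by (simp add: cnj_hop_eq reflsum_def rho_pair refl_pair)

lemma hop_rotsum:
  "rotsum p \<mu> (v + (1, 1)) + rotsum p \<mu> (v + (- 2, 1)) + rotsum p \<mu> (v + (1, - 2)) = hop p \<mu> * rotsum p \<mu> v"
  "reflsum p \<mu> (v + (1, 1)) + reflsum p \<mu> (v + (- 2, 1)) + reflsum p \<mu> (v + (1, - 2)) = cnj (hop p \<mu>) * reflsum p \<mu> v"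
  "rotsum p \<mu> (v + (- 1, - 1)) + rotsum p \<mu> (v + (2, - 1)) + rotsum p \<mu> (v + (- 1, 2)) = cnj (hop p \<mu>) * rotsum p \<mu> v"
  "reflsum p \<mu> (v + (- 1, - 1)) + reflsum p \<mu> (v + (2, - 1)) + reflsum p \<mu> (v + (- 1, 2)) = hop p \<mu> * reflsum p \<mu> v"
proof -
  have a: "refl1 (x + y) = refl1 x + refl1 y" "refl2 (x + y) = refl2 x + refl2 y" for x y
    by (rule weyl_add; simp add: weyl_eq)+
  show "rotsum p \<mu> (v + (1, 1)) + rotsum p \<mu> (v + (- 2, 1)) + rotsum p \<mu> (v + (1, - 2)) = hop p \<mu> * rotsum p \<mu> v"
    "reflsum p \<mu> (v + (1, 1)) + reflsum p \<mu> (v + (- 2, 1)) + reflsum p \<mu> (v + (1, - 2)) = cnj (hop p \<mu>) * reflsum p \<mu> v"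
    "rotsum p \<mu> (v + (- 1, - 1)) + rotsum p \<mu> (v + (2, - 1)) + rotsum p \<mu> (v + (- 1, 2)) = cnj (hop p \<mu>) * rotsum p \<mu> v"
    "reflsum p \<mu> (v + (- 1, - 1)) + reflsum p \<mu> (v + (2, - 1)) + reflsum p \<mu> (v + (- 1, 2)) = hop p \<mu> * reflsum p \<mu> v"
    unfolding rotsum_def reflsum_def a wave_add cnj_hop_eq refl_pair unfolding hop_eq
    by (simp_all add: algebra_simps)
qed

lemma charsum_rotsum:
  "charsum \<kappa> (\<lambda>\<nu>. rotsum p \<mu> (v + scale 3 \<nu>)) = wchar p \<kappa> \<mu> * rotsum p \<mu> v"
  "charsum \<kappa> (\<lambda>\<nu>. reflsum p \<mu> (v + scale 3 \<nu>)) = wchar p \<kappa> \<mu> * reflsum p \<mu> v"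
proof -
  have w: "charsum \<kappa> (\<lambda>\<nu>. wave p \<mu> (w (v + scale 3 \<nu>))) = wchar p \<kappa> \<mu> * wave p \<mu> (w v)"
    if "w \<in> weyl" for w
  proof -
    have "charsum \<kappa> (\<lambda>\<nu>. wave p \<mu> (scale 3 (w \<nu>))) = wchar p \<kappa> \<mu>"
      unfolding wchar_charsum by (rule charsum_weyl[OF that, of \<kappa> "\<lambda>\<nu>. wave p \<mu> (scale 3 \<nu>)"])
    then show ?thesis by (simp add: weyl_add weyl_scale that wave_add charsum_cmult mult.commute)
  qed
  show "charsum \<kappa> (\<lambda>\<nu>. rotsum p \<mu> (v + scale 3 \<nu>)) = wchar p \<kappa> \<mu> * rotsum p \<mu> v"
    using w[of id] w[of "refl1 \<circ> refl2"] w[of "refl2 \<circ> refl1"]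
    by (simp add: rotsum_def weyl_eq charsum_add distrib_left)
  show "charsum \<kappa> (\<lambda>\<nu>. reflsum p \<mu> (v + scale 3 \<nu>)) = wchar p \<kappa> \<mu> * reflsum p \<mu> v"
    using w[of refl1] w[of refl2] w[of "refl1 \<circ> refl2 \<circ> refl1"]
    by (simp add: reflsum_def weyl_eq charsum_add distrib_left)
qed

section \<open>The eigenfunctions on the honeycomb\<close>

text \<open>In terms of \<open>v = \<eta> + \<rho>\<close> the root lattice without \<open>3 P\<close>. Even elements of the affine Weyl group lie
in the sublattice of class 1 modulo 3, odd ones in that of class 2; reflections exchange the two.\<close>

definition honeycomb :: "weight set" where
  "honeycomb = {v. fst v mod 3 = snd v mod 3 \<and> fst v mod 3 \<noteq> 0}"

lemma eps_cases: "eps p \<mu> = 1 \<or> eps p \<mu> = - 1" by (simp add: eps_def)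

text \<open>The radicand in the definition of \<open>Ffun\<close> is the squared modulus of the hopping amplitude.\<close>

lemma hop_square: "3 + wchar p Lam1 \<mu> + wchar p Lam2 \<mu> = hop p \<mu> * cnj (hop p \<mu>)"
  unfolding cnj_hop_eq unfolding hop_eq
  by (simp add: distrib_left distrib_right wchar_charsum charsum_Lam1 charsum_Lam2 zero_prod_def[symmetric] flip: wave_add)

lemma Ffun_eq: "Ffun p \<mu> = eps p \<mu> * of_real (cmod (hop p \<mu>))"
proof -
  have "3 + wchar p Lam1 \<mu> + wchar p Lam2 \<mu> = of_real ((cmod (hop p \<mu>))\<^sup>2)"
    unfolding hop_square complex_norm_square ..
  then have "csqrt (3 + wchar p Lam1 \<mu> + wchar p Lam2 \<mu>) = of_real (sqrt ((cmod (hop p \<mu>))\<^sup>2))"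
    by (simp only: csqrt_of_real zero_le_power2)
  then show ?thesis by (simp add: Ffun_def)
qed

lemma Ffun_square: "Ffun p \<mu> * Ffun p \<mu> = hop p \<mu> * cnj (hop p \<mu>)"
  unfolding Ffun_eq using eps_cases[of p \<mu>]
  by (auto simp: complex_norm_square[symmetric] power2_eq_square simp del: of_real_mult simp flip: of_real_mult)

lemma cnj_Ffun: "cnj (Ffun p \<mu>) = Ffun p \<mu>"
  unfolding Ffun_eq using eps_cases[of p \<mu>] by auto

text \<open>Antisymmetry under reflections determines the coefficients on the second sublattice from those on the
first, with rotations and reflections exchanged and the opposite sign. For coefficients \<open>c\<close> and \<open>d\<close>
of \<open>rotsum\<close> and \<open>reflsum\<close> on the first sublattice, the eigenvalue equation with eigenvalue \<open>f\<close> then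
reads \<open>- d h = f c\<close> and \<open>- c h\<^sup>* = f d\<close>, where \<open>h\<close> is \<open>hop p \<mu>\<close>. Hence \<open>f\<^sup>2 = |h|\<^sup>2\<close>, and \<open>c = h\<close>,
\<open>d = - f\<close> is a solution.\<close>

definition eigenfun :: "nat \<Rightarrow> weight \<Rightarrow> weight \<Rightarrow> complex" where
  "eigenfun p \<mu> v =
    (if v \<notin> honeycomb then 0
     else if fst v mod 3 = 1 then hop p \<mu> * rotsum p \<mu> v - Ffun p \<mu> * reflsum p \<mu> v
     else Ffun p \<mu> * rotsum p \<mu> v - hop p \<mu> * reflsum p \<mu> v)"

lemma honeycomb_iff: "(a, b) \<in> honeycomb \<longleftrightarrow> a mod 3 = b mod 3 \<and> a mod 3 \<noteq> 0"
  by (simp add: honeycomb_def)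

lemma honeycomb_refl:
  "refl1 v \<in> honeycomb \<longleftrightarrow> v \<in> honeycomb" "refl2 v \<in> honeycomb \<longleftrightarrow> v \<in> honeycomb"
  "v \<in> honeycomb \<Longrightarrow> fst (refl1 v) mod 3 = 1 \<longleftrightarrow> fst v mod 3 \<noteq> 1"
  "v \<in> honeycomb \<Longrightarrow> fst (refl2 v) mod 3 = 1 \<longleftrightarrow> fst v mod 3 \<noteq> 1"
proof -
  obtain a b where v: "v = (a, b)" by (cases v)
  define r where "r = a mod 3"
  define s where "s = b mod 3"
  have neg: "(- a) mod 3 = (- r) mod 3" "(- b) mod 3 = (- s) mod 3"
    and add: "(a + b) mod 3 = (r + s) mod 3"
    by (simp_all add: r_def s_def mod_simps)
  have mem: "(a, b) \<in> honeycomb \<longleftrightarrow> r = s \<and> r \<noteq> 0"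
    "(- a, a + b) \<in> honeycomb \<longleftrightarrow> (- r) mod 3 = (r + s) mod 3 \<and> (- r) mod 3 \<noteq> 0"
    "(a + b, - b) \<in> honeycomb \<longleftrightarrow> (r + s) mod 3 = (- s) mod 3 \<and> (r + s) mod 3 \<noteq> 0"
    by (simp_all only: honeycomb_iff neg add r_def[symmetric] s_def[symmetric])
  have "r = 0 \<or> r = 1 \<or> r = 2" "s = 0 \<or> s = 1 \<or> s = 2" unfolding r_def s_def by presburger+
  then show "refl1 v \<in> honeycomb \<longleftrightarrow> v \<in> honeycomb" "refl2 v \<in> honeycomb \<longleftrightarrow> v \<in> honeycomb"
    "v \<in> honeycomb \<Longrightarrow> fst (refl1 v) mod 3 = 1 \<longleftrightarrow> fst v mod 3 \<noteq> 1"
    "v \<in> honeycomb \<Longrightarrow> fst (refl2 v) mod 3 = 1 \<longleftrightarrow> fst v mod 3 \<noteq> 1"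
    unfolding v refl_pair fst_conv mem neg add r_def[symmetric]
    by (elim disjE; simp)+
qed

lemma honeycomb_weyl: "w \<in> weyl \<Longrightarrow> w v \<in> honeycomb \<longleftrightarrow> v \<in> honeycomb"
  by (induction rule: weyl.induct) (simp_all add: honeycomb_refl)

lemma eigenfun_weyl:
  assumes "w \<in> weyl" shows "eigenfun p \<mu> (w v) = of_int (wdet w) * eigenfun p \<mu> v"
proof -
  have r: "eigenfun p \<mu> (refl1 v) = - eigenfun p \<mu> v" "eigenfun p \<mu> (refl2 v) = - eigenfun p \<mu> v" for v
    by (simp_all add: eigenfun_def honeycomb_refl rotsum_refl)
  have refl: "refl1 \<in> weyl" "refl2 \<in> weyl" by (simp_all add: weyl_eq)
  show ?thesis
    using assms
  proof induction
    case weyl_id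
    then show ?case by (simp only: wdet_simps) simp
  next
    case (weyl_refl1 w)
    have "wdet (refl1 \<circ> w) = - wdet w"
      using wdet_comp[OF refl(1) weyl_refl1.hyps] by (simp only: wdet_simps mult_minus1)
    then show ?case unfolding \<open>wdet (refl1 \<circ> w) = - wdet w\<close> using weyl_refl1.IH by (simp add: r)
  next
    case (weyl_refl2 w)
    have "wdet (refl2 \<circ> w) = - wdet w"
      using wdet_comp[OF refl(2) weyl_refl2.hyps] by (simp only: wdet_simps mult_minus1)
    then show ?case unfolding \<open>wdet (refl2 \<circ> w) = - wdet w\<close> using weyl_refl2.IH by (simp add: r)
  qed
qed

lemma honeycomb_shift: "v + scale (3 * n) \<beta> \<in> honeycomb \<longleftrightarrow> v \<in> honeycomb"
  by (cases v; cases \<beta>) (simp add: honeycomb_iff mult.assoc)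

lemma eigenfun_period:
  assumes "p > 0" "\<beta> \<in> root_lattice"
  shows "eigenfun p \<mu> (v + scale (3 * int p) \<beta>) = eigenfun p \<mu> v"
proof -
  have "fst (v + scale (3 * int p) \<beta>) mod 3 = fst v mod 3"
    by (cases v; cases \<beta>) (simp add: mult.assoc)
  then show ?thesis
    by (simp add: eigenfun_def honeycomb_shift rotsum_period assms)
qed

text \<open>Of the six points at root distance from a vertex, three are its neighbours and three are centres of
hexagons, where \<open>eigenfun\<close> is zero. So this is the equation for the hopping operator.\<close>

lemma eigenfun_roots:
  assumes v: "v \<in> honeycomb"
  shows "rootsum (\<lambda>\<beta>. eigenfun p \<mu> (v + \<beta>)) = Ffun p \<mu> * eigenfun p \<mu> v"
proof -
  obtain a b where ab: "v = (a, b)" by (cases v)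
  let ?h = "hop p \<mu>" and ?f = "Ffun p \<mu>"
  consider "a mod 3 = 1" "b mod 3 = 1" | "a mod 3 = 2" "b mod 3 = 2"
  proof -
    have "a mod 3 = 0 \<or> a mod 3 = 1 \<or> a mod 3 = 2" by presburger
    then show thesis using v that unfolding ab honeycomb_iff by auto
  qed
  then show ?thesis
  proof cases
    case 1
    have o: "(a + 2, b - 1) \<notin> honeycomb" "(a - 1, b + 2) \<notin> honeycomb" "(a - 1, b - 1) \<notin> honeycomb"
      using 1 unfolding honeycomb_iff by presburger+
    have i: "(a + 1, b + 1) \<in> honeycomb" "(a - 2, b + 1) \<in> honeycomb" "(a + 1, b - 2) \<in> honeycomb"
      "(a + 1) mod 3 \<noteq> 1" "(a - 2) mod 3 \<noteq> 1"
      using 1 unfolding honeycomb_iff by presburger+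
    have "rootsum (\<lambda>\<beta>. eigenfun p \<mu> (v + \<beta>)) =
        ?f * (rotsum p \<mu> (v + (1, 1)) + rotsum p \<mu> (v + (- 2, 1)) + rotsum p \<mu> (v + (1, - 2)))
        - ?h * (reflsum p \<mu> (v + (1, 1)) + reflsum p \<mu> (v + (- 2, 1)) + reflsum p \<mu> (v + (1, - 2)))"
      by (simp add: rootsum_def eigenfun_def ab o i) (simp add: algebra_simps)
    also have "\<dots> = ?f * (?h * rotsum p \<mu> v) - (?h * cnj ?h) * reflsum p \<mu> v"
      unfolding hop_rotsum by simp
    also have "\<dots> = ?f * eigenfun p \<mu> v"
      unfolding Ffun_square[symmetric] using v 1 by (simp add: eigenfun_def ab algebra_simps)
    finally show ?thesis .
  next
    case 2
    have o: "(a + 1, b + 1) \<notin> honeycomb" "(a - 2, b + 1) \<notin> honeycomb" "(a + 1, b - 2) \<notin> honeycomb"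
      using 2 unfolding honeycomb_iff by presburger+
    have i: "(a + 2, b - 1) \<in> honeycomb" "(a - 1, b + 2) \<in> honeycomb" "(a - 1, b - 1) \<in> honeycomb"
      "(a + 2) mod 3 = 1" "(a - 1) mod 3 = 1"
      using 2 unfolding honeycomb_iff by presburger+
    have "rootsum (\<lambda>\<beta>. eigenfun p \<mu> (v + \<beta>)) =
        ?h * (rotsum p \<mu> (v + (- 1, - 1)) + rotsum p \<mu> (v + (2, - 1)) + rotsum p \<mu> (v + (- 1, 2)))
        - ?f * (reflsum p \<mu> (v + (- 1, - 1)) + reflsum p \<mu> (v + (2, - 1)) + reflsum p \<mu> (v + (- 1, 2)))"
      by (simp add: rootsum_def eigenfun_def ab o i) (simp add: algebra_simps)
    also have "\<dots> = (?h * cnj ?h) * rotsum p \<mu> v - ?f * (?h * reflsum p \<mu> v)"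
      unfolding hop_rotsum by simp
    also have "\<dots> = ?f * eigenfun p \<mu> v"
      unfolding Ffun_square[symmetric] using v 2 by (simp add: eigenfun_def ab algebra_simps)
    finally show ?thesis .
  qed
qed

lemma charsum_eigenfun_scale3:
  "charsum \<kappa> (\<lambda>\<nu>. eigenfun p \<mu> (v + scale 3 \<nu>)) = wchar p \<kappa> \<mu> * eigenfun p \<mu> v"
proof -
  have a: "(v + scale 3 \<nu> \<in> honeycomb) = (v \<in> honeycomb)" for \<nu>
    using honeycomb_shift[of v 1 \<nu>] by simp
  have b: "fst (v + scale 3 \<nu>) mod 3 = fst v mod 3" for \<nu>
    by (cases v; cases \<nu>) simp
  have d: "charsum \<kappa> (\<lambda>\<nu>. c * g \<nu> - e * h \<nu>) = c * charsum \<kappa> g - e * charsum \<kappa> h" for c e g h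
    using charsum_add[of \<kappa> "\<lambda>\<nu>. c * g \<nu>" "\<lambda>\<nu>. - e * h \<nu>"] by (simp only: charsum_cmult) simp
  have z: "charsum \<kappa> (\<lambda>\<nu>. 0) = 0" by (simp add: charsum_def)
  show ?thesis
    unfolding eigenfun_def a b by (simp add: d z charsum_rotsum algebra_simps)
qed

text \<open>In \<open>charsum_mod3\<close> the tripled characters act by \<open>charsum_eigenfun_scale3\<close>, and the adjoint character
acts as \<open>Ffun p \<mu> + 2\<close> by \<open>eigenfun_roots\<close>.\<close>

lemma charsum_eigenfun:
  assumes v: "v \<in> honeycomb" and y: "y \<in> weyl"
  shows "charsum (scale 3 l + dot y 0) (\<lambda>\<nu>. eigenfun p \<mu> (v + \<nu>)) =
    ((\<Sum>j\<in>{0, scale 2 Lam1, scale 2 Lam2}. wchar p (l + dot y (- j)) \<mu>) +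
     (Ffun p \<mu> + 2) * (\<Sum>j\<in>{rho, Lam1, Lam2}. wchar p (l + dot y (- j)) \<mu>)) * eigenfun p \<mu> v"
proof -
  have v3: "v + scale 3 \<nu> \<in> honeycomb" for \<nu>
    using v honeycomb_shift[of v 1 \<nu>] by simp
  have "2 * eigenfun p \<mu> (v + scale 3 \<nu>) + rootsum (\<lambda>\<beta>. eigenfun p \<mu> (v + (scale 3 \<nu> + \<beta>))) =
      (Ffun p \<mu> + 2) * eigenfun p \<mu> (v + scale 3 \<nu>)" for \<nu>
    using eigenfun_roots[OF v3, of p \<mu> \<nu>] by (simp add: add.assoc algebra_simps)
  then show ?thesis
    unfolding charsum_mod3[OF y]
    by (simp only: charsum_cmult charsum_eigenfun_scale3)
      (simp add: sum_distrib_left sum_distrib_right algebra_simps)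
qed

section \<open>The eigenfunctions do not vanish at the base vertex\<close>

lemma cis_eq_1D:
  fixes p :: nat and n :: int
  assumes "cis (2 * pi * of_int n / of_nat p) = 1" "p > 0"
  shows "int p dvd n"
proof -
  have "cos (2 * pi * of_int n / of_nat p) = 1"
    using assms(1) by (simp add: complex_eq_iff)
  then obtain k :: int where "2 * pi * of_int n / of_nat p = of_int k * 2 * pi"
    using cos_one_2pi_int by blast
  then have "real_of_int n = real_of_int (k * int p)" using assms(2) by (simp add: field_simps)
  then have "n = k * int p" by linarith
  then show ?thesis by simp
qed

lemma cis_cube: "cis x ^ 3 = cis (3 * x)"
  using DeMoivre[of x 3] by simp

lemma cis_plus_2pi: "cis (x + 2 * pi) = cis x"
  by (simp add: complex_eq_iff)

lemma cis_plus_cis_minus: "cis y + cis (- y) = of_real (2 * cos y)"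
  by (simp add: complex_eq_iff)

lemma Exps_iff:
  "\<mu> \<in> Exps p \<longleftrightarrow> 0 \<le> fst \<mu> \<and> fst \<mu> < int p \<and> 0 \<le> snd \<mu> \<and> snd \<mu> < int p"
proof -
  have "real_of_int x \<le> real p - 1 \<longleftrightarrow> x < int p" for x by linarith
  then show ?thesis
    unfolding Exps_def dominant_def ip_alpha1 ip_alpha2 by auto
qed

lemma eps_eq: "eps p (a - 1, b - 1) = (if a + b \<le> int p then 1 else - 1)"
proof -
  have "ip (a - 1, b - 1) theta = of_int (a + b - 2)"
    by (simp add: ip_def theta_pair)
  moreover have "real_of_int (a + b - 2) \<le> real p - 2 \<longleftrightarrow> a + b \<le> int p" by linarith
  ultimately show ?thesis by (simp only: eps_def)
qed

lemma hop_cis: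
  fixes a b :: int
  assumes "\<mu> = (a - 1, b - 1)"
  shows "hop p \<mu> = cis (- (2 * pi * of_int (a + b) / (3 * real p))) +
    cis (2 * pi * of_int a / (3 * real p)) + cis (2 * pi * of_int b / (3 * real p))"
proof -
  have mr: "\<mu> + rho = (a, b)" by (simp add: assms rho_pair)
  have "ip (1, 1) (a, b) = of_int (a + b)" "ip (- 2, 1) (a, b) = - of_int a" "ip (1, - 2) (a, b) = - of_int b"
    by (simp_all add: ip_def field_simps)
  then show ?thesis unfolding hop_eq wave_def mr by simp
qed

lemma unimodular_sum:
  fixes u1 u2 u3 :: complex
  assumes "u1 * u2 * u3 = 1" "norm u1 = 1" "norm u2 = 1" "norm u3 = 1"
  shows "cnj (u1 + u2 + u3) = u1 * u2 + u1 * u3 + u2 * u3"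
proof -
  have c: "z * cnj z = 1" if "norm z = 1" for z using that complex_norm_square[of z] by simp
  have "cnj u1 = (u1 * u2 * u3) * cnj u1" "cnj u2 = (u1 * u2 * u3) * cnj u2" "cnj u3 = (u1 * u2 * u3) * cnj u3"
    using assms(1) by simp_all
  then have "cnj u1 = u2 * u3" "cnj u2 = u1 * u3" "cnj u3 = u1 * u2"
    using c[OF assms(2)] c[OF assms(3)] c[OF assms(4)] by algebra+
  then show ?thesis by simp
qed

lemma eigenfun_rho: "eigenfun p \<mu> rho = hop p \<mu> * hop p \<mu> - Ffun p \<mu> * cnj (hop p \<mu>)"
  by (simp add: eigenfun_def honeycomb_def rho_pair reflsum_rho[unfolded rho_pair] hop_def[unfolded rho_pair])

text \<open>If three unimodular numbers with product 1 add up to zero, then so do their conjugates, hence they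
are roots of \<open>X\<^sup>3 = 1\<close>. This forces \<open>\<mu> + \<rho> = p \<rho>\<close>, where the three numbers coincide.\<close>

lemma hop_nonzero:
  assumes p: "p > 0" and \<mu>: "\<mu> \<in> Exps p"
  shows "hop p \<mu> \<noteq> 0"
proof
  assume 0: "hop p \<mu> = 0"
  define a b where "a = fst \<mu> + 1" and "b = snd \<mu> + 1"
  then have \<mu>': "\<mu> = (a - 1, b - 1)" by simp
  have ab: "1 \<le> a" "a \<le> int p" "1 \<le> b" "b \<le> int p" using \<mu> by (auto simp: Exps_iff a_def b_def)
  define t where "t = (\<lambda>n :: int. 2 * pi * of_int n / (3 * real p))"
  have t3: "3 * t n = 2 * pi * of_int n / of_nat p" for n
    by (simp add: t_def)
  define u1 u2 u3 where u: "u1 = cis (- t (a + b))" "u2 = cis (t a)" "u3 = cis (t b)"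
  have h: "hop p \<mu> = u1 + u2 + u3" by (simp add: hop_cis[OF \<mu>'] u t_def)
  have prod: "u1 * u2 * u3 = 1"
    by (simp add: u t_def cis_mult add_divide_distrib ring_distribs)
  have e2: "u1 * u2 + u1 * u3 + u2 * u3 = 0"
    using unimodular_sum[OF prod] 0 unfolding h by (metis complex_cnj_zero norm_cis u)
  have "u2 ^ 3 = 1" "u3 ^ 3 = 1"
    using 0 prod e2 unfolding h by algebra+
  then have c: "cis (2 * pi * of_int a / of_nat p) = 1" "cis (2 * pi * of_int b / of_nat p) = 1"
    by (simp_all only: u cis_cube t3)
  then have "int p dvd a" "int p dvd b" using cis_eq_1D p by blast+
  then have "a = int p" "b = int p" using ab by (auto dest: zdvd_imp_le)
  then have "u1 = cis (- (2 * pi * 2 / 3))" "u2 = cis (2 * pi / 3)" "u3 = cis (2 * pi / 3)"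
    using p by (simp_all add: u t_def)
  moreover have "cis (- (2 * pi * 2 / 3)) = cis (2 * pi / 3)"
    using cis_mult[of "- (2 * pi * 2 / 3)" "2 * pi"] by simp
  ultimately have "hop p \<mu> = 3 * cis (2 * pi / 3)" unfolding h by simp
  then show False using 0 by simp
qed

text \<open>On the three walls on which the Weyl denominator vanishes, the amplitude is a cube root of unity
times a real number, and the sign of that number is opposite to \<open>eps\<close>. This is where the
definition of \<open>eps\<close> enters.\<close>

lemma hop_right_wall:
  assumes p: "p > 0" and b: "1 \<le> b" "b \<le> int p"
  shows "\<exists>\<omega> r. \<omega> ^ 3 = 1 \<and> cmod \<omega> = 1 \<and> r > 0 \<and> hop p (int p - 1, b - 1) = \<omega> * of_real r"
proof -
  define x where "x = 2 * pi * of_int b / (3 * real p)"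
  have x: "0 < x" "x \<le> 2 * pi / 3"
    using b p by (simp_all add: x_def field_simps)
  have "\<bar>x - 2 * pi / 3\<bar> < 2 * pi / 3" using x by (simp add: abs_if)
  then have "cos (2 * pi / 3) < cos \<bar>x - 2 * pi / 3\<bar>"
    by (intro cos_monotone_0_pi) auto
  then have r: "1 + 2 * cos (x - 2 * pi / 3) > 0" by (simp add: cos_120)
  have "hop p (int p - 1, b - 1) = cis (- (2 * pi / 3 + x)) + cis (2 * pi / 3) + cis x"
    using p by (simp add: hop_cis[OF refl] x_def ring_distribs add_divide_distrib)
  also have "cis (- (2 * pi / 3 + x)) = cis (2 * pi / 3) * cis (- (x - 2 * pi / 3))"
  proof -
    have "cis (- (2 * pi / 3 + x)) = cis (- (2 * pi / 3 + x) + 2 * pi)" by (rule cis_plus_2pi[symmetric])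
    also have "- (2 * pi / 3 + x) + 2 * pi = 2 * pi / 3 + - (x - 2 * pi / 3)" by simp
    finally show ?thesis by (simp only: cis_mult)
  qed
  also have "cis x = cis (2 * pi / 3) * cis (x - 2 * pi / 3)"
    by (simp add: cis_mult)
  finally have "hop p (int p - 1, b - 1) = cis (2 * pi / 3) *
      (1 + (cis (x - 2 * pi / 3) + cis (- (x - 2 * pi / 3))))"
    by (simp add: distrib_left)
  then have "hop p (int p - 1, b - 1) = cis (2 * pi / 3) * of_real (1 + 2 * cos (x - 2 * pi / 3))"
    unfolding cis_plus_cis_minus by simp
  moreover have "cis (2 * pi / 3) ^ 3 = 1" by (simp add: cis_cube)
  ultimately show ?thesis using r by (metis norm_cis)
qed

lemma hop_upper_wall:
  assumes p: "p > 0" and a: "1 \<le> a" "a < int p"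
  shows "\<exists>\<omega> r. \<omega> ^ 3 = 1 \<and> cmod \<omega> = 1 \<and> r < 0 \<and> hop p (a - 1, int p - a - 1) = \<omega> * of_real r"
proof -
  define x where "x = 2 * pi * of_int a / (3 * real p)"
  have x: "0 < x" "x < 2 * pi / 3"
    using a p by (simp_all add: x_def field_simps)
  have "\<bar>x - pi / 3\<bar> < pi / 3" using x by (simp add: abs_if)
  then have "cos (pi / 3) < cos \<bar>x - pi / 3\<bar>"
    by (intro cos_monotone_0_pi) auto
  then have "1 / 2 < cos (x - pi / 3)" by (simp add: cos_60)
  moreover have "cos (x + 2 * pi / 3) = - cos (x - pi / 3)"
    using cos_periodic_pi[of "x - pi / 3"] by (simp add: algebra_simps)
  ultimately have r: "1 + 2 * cos (x + 2 * pi / 3) < 0" by simp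
  have "hop p (a - 1, int p - a - 1) = cis (- (2 * pi / 3)) + cis x + cis (2 * pi / 3 - x)"
    using p by (simp add: hop_cis[OF refl] x_def ring_distribs diff_divide_distrib)
  also have "cis x = cis (- (2 * pi / 3)) * cis (x + 2 * pi / 3)"
    by (simp add: cis_mult)
  also have "cis (2 * pi / 3 - x) = cis (- (2 * pi / 3)) * cis (- (x + 2 * pi / 3))"
  proof -
    have "2 * pi / 3 - x = - (2 * pi / 3) + - (x + 2 * pi / 3) + 2 * pi" by simp
    then show ?thesis by (simp only: cis_mult cis_plus_2pi)
  qed
  finally have "hop p (a - 1, int p - a - 1) = cis (- (2 * pi / 3)) *
      (1 + (cis (x + 2 * pi / 3) + cis (- (x + 2 * pi / 3))))"
    by (simp only: distrib_left mult_1_right add_ac)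
  then have "hop p (a - 1, int p - a - 1) = cis (- (2 * pi / 3)) * of_real (1 + 2 * cos (x + 2 * pi / 3))"
    unfolding cis_plus_cis_minus by simp
  moreover have "cis (- (2 * pi / 3)) ^ 3 = 1"
    by (simp add: cis_cube complex_eq_iff)
  ultimately show ?thesis using r by (metis norm_cis)
qed

lemma hop_swap: "hop p (b, a) = hop p (a, b)"
  using hop_cis[of "(a, b)" "a + 1" "b + 1" p] hop_cis[of "(b, a)" "b + 1" "a + 1" p]
  by (simp add: add.commute)

text \<open>A zero means \<open>h\<^sup>3 = eps * |h|\<^sup>3\<close> for \<open>h = hop p \<mu>\<close>. Then \<open>h\<^sup>3\<close> is real, and as
\<open>h\<^sup>3 - cnj h\<^sup>3\<close> is the Weyl denominator, \<open>\<mu> + \<rho>\<close> lies on a wall; but there the sign of \<open>h\<^sup>3\<close> is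
\<open>- eps\<close>.\<close>

lemma eigenfun_rho_nonzero:
  assumes p: "p > 0" and \<mu>: "\<mu> \<in> Exps p"
  shows "eigenfun p \<mu> rho \<noteq> 0"
proof
  assume "eigenfun p \<mu> rho = 0"
  let ?h = "hop p \<mu>"
  define s where "s = cmod ?h"
  have hh: "?h * cnj ?h = of_real s * of_real s"
    unfolding s_def by (simp add: complex_norm_square[symmetric] power2_eq_square)
  have "?h * ?h = eps p \<mu> * of_real s * cnj ?h"
    using \<open>eigenfun p \<mu> rho = 0\<close> by (simp add: eigenfun_rho Ffun_eq s_def)
  then have "?h ^ 3 = eps p \<mu> * of_real s * (?h * cnj ?h)"
    by (simp add: power3_eq_cube)
  then have h3: "?h ^ 3 = eps p \<mu> * of_real (s ^ 3)"
    unfolding hh by (simp add: power3_eq_cube)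
  have s: "s > 0" using hop_nonzero[OF p \<mu>] by (simp add: s_def)
  define a b where "a = fst \<mu> + 1" and "b = snd \<mu> + 1"
  then have \<mu>': "\<mu> = (a - 1, b - 1)" by simp
  have ab: "1 \<le> a" "a \<le> int p" "1 \<le> b" "b \<le> int p" using \<mu> by (auto simp: Exps_iff a_def b_def)
  have wall: "a \<noteq> int p \<and> b \<noteq> int p \<and> a + b \<noteq> int p"
  proof -
    have contra: False if "\<omega> ^ 3 = 1" "cmod \<omega> = 1" "?h = \<omega> * of_real r" "eps p \<mu> = - of_real (sgn r)" "r \<noteq> 0"
      for \<omega> and r :: real
    proof -
      have "s = \<bar>r\<bar>" using that by (simp add: s_def norm_mult)
      moreover have "complex_of_real (r ^ 3) = of_real (- sgn r * s ^ 3)"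
        using h3 that by (simp add: power_mult_distrib)
      then have "r ^ 3 = - sgn r * s ^ 3" by (simp only: of_real_eq_iff)
      ultimately have "r ^ 3 = - (sgn r * \<bar>r\<bar> ^ 3)" by simp
      also have "\<dots> = - (r ^ 3)"
        by (cases "r > 0") (simp_all add: sgn_if abs_if)
      finally show False using that(5) by simp
    qed
    have "a \<noteq> int p"
    proof
      assume "a = int p"
      then obtain \<omega> r where "\<omega> ^ 3 = 1" "cmod \<omega> = 1" "r > 0" "?h = \<omega> * of_real r"
        using hop_right_wall[OF p ab(3,4)] \<mu>' by auto
      moreover have "eps p \<mu> = - 1" unfolding \<mu>' eps_eq using \<open>a = int p\<close> ab by simp
      ultimately show False using contra[of \<omega> r] by simp
    qed
    moreover have "b \<noteq> int p"
    proof
      assume "b = int p"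
      then obtain \<omega> r where "\<omega> ^ 3 = 1" "cmod \<omega> = 1" "r > 0" "?h = \<omega> * of_real r"
        using hop_right_wall[OF p ab(1,2)] \<mu>' hop_swap[of p "a - 1" "b - 1"] by auto
      moreover have "eps p \<mu> = - 1" unfolding \<mu>' eps_eq using \<open>b = int p\<close> ab by simp
      ultimately show False using contra[of \<omega> r] by simp
    qed
    moreover have "a + b \<noteq> int p"
    proof
      assume ab': "a + b = int p"
      then have b: "b = int p - a" by simp
      obtain \<omega> r where "\<omega> ^ 3 = 1" "cmod \<omega> = 1" "r < 0" "?h = \<omega> * of_real r"
        using hop_upper_wall[OF p ab(1)] ab ab' unfolding \<mu>' b by auto
      moreover have "eps p \<mu> = 1" unfolding \<mu>' eps_eq using ab' by simp
      ultimately show False using contra[of \<omega> r] by simp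
    qed
    ultimately show ?thesis by blast
  qed
  define t where "t = (\<lambda>n :: int. 2 * pi * of_int n / (3 * real p))"
  have t3: "3 * t n = 2 * pi * of_int n / of_nat p" for n
    by (simp add: t_def)
  define u1 u2 u3 where u: "u1 = cis (- t (a + b))" "u2 = cis (t a)" "u3 = cis (t b)"
  have h: "?h = u1 + u2 + u3" by (simp add: hop_cis[OF \<mu>'] u t_def)
  have prod: "u1 * u2 * u3 = 1"
    by (simp add: u t_def cis_mult add_divide_distrib ring_distribs)
  have ch: "cnj ?h = u1 * u2 + u1 * u3 + u2 * u3"
    unfolding h by (rule unimodular_sum[OF prod]) (simp_all add: u)
  have "cnj ?h ^ 3 = cnj (?h ^ 3)" by simp
  also have "\<dots> = ?h ^ 3" unfolding h3 using eps_cases[of p \<mu>] by auto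
  finally have "(u1 ^ 3 - 1) * (u2 ^ 3 - 1) * (u3 ^ 3 - 1) = 0"
    using prod unfolding ch unfolding h by algebra
  then have "u1 ^ 3 = 1 \<or> u2 ^ 3 = 1 \<or> u3 ^ 3 = 1" by auto
  moreover have "u1 ^ 3 = cnj (cis (2 * pi * of_int (a + b) / of_nat p))"
  proof -
    have "3 * - t (a + b) = - (2 * pi * of_int (a + b) / of_nat p)" by (simp add: t_def)
    then show ?thesis by (simp only: u cis_cube cis_cnj)
  qed
  moreover have "u2 ^ 3 = cis (2 * pi * of_int a / of_nat p)" "u3 ^ 3 = cis (2 * pi * of_int b / of_nat p)"
    by (simp_all only: u cis_cube t3)
  ultimately have "int p dvd a + b \<or> int p dvd a \<or> int p dvd b"
    using cis_eq_1D[OF _ p] by (metis complex_cnj_one_iff)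
  then consider k where "a + b = int p * k" | "int p dvd a" | "int p dvd b" by (auto simp: dvd_def)
  then show False
  proof cases
    case 1
    have "0 < int p * k" using ab by (simp flip: 1)
    then have k: "k > 0" using p by (simp add: zero_less_mult_iff)
    have "int p * k \<le> int p * 2" using ab by (simp flip: 1)
    then have "k \<le> 2" using p by simp
    then have "k = 1 \<or> k = 2" using k by auto
    then show ?thesis using 1 wall ab by auto
  next
    case 2
    then show ?thesis using wall ab zdvd_imp_le[OF 2] by auto
  next
    case 3
    then show ?thesis using wall ab zdvd_imp_le[OF 3] by auto
  qed
qed

section \<open>The affine Weyl group on the honeycomb\<close>

lemma weyl_inv_simps:
  "inv id = (id :: weight \<Rightarrow> weight)" "inv refl1 = refl1" "inv refl2 = refl2"
  "inv (refl1 \<circ> refl2) = refl2 \<circ> refl1" "inv (refl2 \<circ> refl1) = refl1 \<circ> refl2"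
  "inv (refl1 \<circ> refl2 \<circ> refl1) = refl1 \<circ> refl2 \<circ> refl1"
  by (rule inv_unique_comp; force simp: fun_eq_iff refl_pair)+

lemma weyl_parts:
  assumes "w \<in> weyl" "\<kappa> \<in> root_lattice"
  shows "lin_part (w \<circ> transl (- \<kappa>)) = w" "shift_part (w \<circ> transl (- \<kappa>)) = \<kappa>"
proof -
  show "lin_part (w \<circ> transl (- \<kappa>)) = w"
    unfolding lin_part_def
    by (rule the_equality) (use assms affine_decomp_unique in blast)+
  show "shift_part (w \<circ> transl (- \<kappa>)) = \<kappa>"
    unfolding shift_part_def
    by (rule the_equality) (use assms affine_decomp_unique in blast)+
qed

lemma iota_eq:
  assumes "w \<in> weyl" "\<kappa> \<in> root_lattice"
  shows "iota (w \<circ> transl (- \<kappa>)) = scale 3 \<kappa> + dot (inv w) 0"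
  by (simp add: iota_def weyl_parts assms)

lemma iota_rho:
  assumes "w \<in> weyl" "\<kappa> \<in> root_lattice"
  shows "iota (w \<circ> transl (- \<kappa>)) + rho = scale 3 \<kappa> + inv w rho"
  by (simp add: iota_eq assms dot_def add.assoc)

definition alcove :: "nat \<Rightarrow> weight set" where
  "alcove p = {v \<in> honeycomb. 0 < fst v \<and> 0 < snd v \<and> fst v + snd v < 3 * int p}"

lemma finite_alcove [simp]: "finite (alcove p)"
proof -
  have "alcove p \<subseteq> {0..3 * int p} \<times> {0..3 * int p}"
    by (auto simp: alcove_def)
  then show ?thesis by (rule finite_subset) simp
qed

lemma honeycomb_alt: "(a, b) \<in> honeycomb \<longleftrightarrow> 3 dvd a - b \<and> \<not> 3 dvd a"
  by (simp add: honeycomb_iff mod_eq_dvd_iff mod_eq_0_iff_dvd)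

text \<open>The Weyl group element can be read off from a vertex: the residue of the first label modulo 3 and that
of the difference of the labels modulo 9 separate the six weights \<open>u \<rho>\<close>.\<close>

lemma honeycomb_param_inj:
  assumes "u \<in> weyl" "u' \<in> weyl" "\<kappa> \<in> root_lattice" "\<kappa>' \<in> root_lattice"
    and eq: "scale 3 \<kappa> + u rho = scale 3 \<kappa>' + u' rho"
  shows "u = u' \<and> \<kappa> = \<kappa>'"
proof -
  obtain a b a' b' where k: "\<kappa> = (a, b)" "\<kappa>' = (a', b')" by (cases \<kappa>; cases \<kappa>')
  obtain c where c: "a - b = 3 * c" using assms(3) by (auto simp: k root_lattice_iff elim: dvdE)
  obtain c' where c': "a' - b' = 3 * c'" using assms(4) by (auto simp: k root_lattice_iff elim: dvdE)
  define r where "r = u rho"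
  define r' where "r' = u' rho"
  have e: "3 * a + fst r = 3 * a' + fst r'" "3 * b + snd r = 3 * b' + snd r'"
    using eq by (simp_all add: k r_def r'_def prod_eq_iff)
  have *: "3 dvd fst r - fst r'" "9 dvd (fst r - snd r) - (fst r' - snd r')"
  proof -
    have "fst r - fst r' = 3 * (a' - a)" "(fst r - snd r) - (fst r' - snd r') = 9 * (c' - c)"
      using e c c' by (simp_all add: algebra_simps)
    then show "3 dvd fst r - fst r'" "9 dvd (fst r - snd r) - (fst r' - snd r')" by simp_all
  qed
  have "u = u'"
    using assms(1,2) *
    by (elim weyl_cases; simp add: r_def r'_def refl_pair rho_pair)
  then show ?thesis using e by (simp add: k r_def r'_def)
qed

lemma honeycomb_param:
  assumes "v \<in> honeycomb"
  obtains u \<kappa> where "u \<in> weyl" "\<kappa> \<in> root_lattice" "v = scale 3 \<kappa> + u rho"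
proof -
  obtain a b where v: "v = (a, b)" by (cases v)
  define c where "c = a div 3"
  obtain d where d: "a - b = 3 * d" using assms by (auto simp: v honeycomb_alt elim: dvdE)
  have W: "id \<in> weyl" "refl1 \<in> weyl" "refl2 \<in> weyl" "refl1 \<circ> refl2 \<in> weyl" "refl2 \<circ> refl1 \<in> weyl"
    "refl1 \<circ> refl2 \<circ> refl1 \<in> weyl" by (simp_all add: weyl_eq)
  have "a mod 3 = 1 \<or> a mod 3 = 2" using assms by (auto simp: v honeycomb_iff)
  then have a: "a = 3 * c + 1 \<or> a = 3 * c + 2" unfolding c_def by presburger
  define e where "e = d div 3"
  \<comment> \<open>The residues of \<open>a\<close> modulo 3 and of \<open>d\<close> modulo 3 determine \<open>u\<close>.\<close>
  have "d = 3 * e \<or> d = 3 * e + 1 \<or> d = 3 * e + 2" unfolding e_def by presburger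
  then show ?thesis using a
  proof (elim disjE)
    assume "d = 3 * e" "a = 3 * c + 1"
    then have "b = 3 * (c - 3 * e) + 1" using d by (simp add: algebra_simps)
    then show ?thesis using that[OF W(1), of "(c, c - 3 * e)"] \<open>a = _\<close>
      by (simp add: v root_lattice_iff rho_pair refl_pair)
  next
    assume "d = 3 * e" "a = 3 * c + 2"
    then have "b = 3 * (c - 3 * e) + 2" using d by (simp add: algebra_simps)
    then show ?thesis using that[OF W(6), of "(c + 1, c + 1 - 3 * e)"] \<open>a = _\<close>
      by (simp add: v root_lattice_iff rho_pair refl_pair)
  next
    assume "d = 3 * e + 1" "a = 3 * c + 1"
    then have "b = 3 * (c - 3 * e) - 2" using d by (simp add: algebra_simps)
    then show ?thesis using that[OF W(5), of "(c, c - 3 * e)"] \<open>a = _\<close>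
      by (simp add: v root_lattice_iff rho_pair refl_pair)
  next
    assume "d = 3 * e + 1" "a = 3 * c + 2"
    then have "b = 3 * (c - 3 * e) - 1" using d by (simp add: algebra_simps)
    then show ?thesis using that[OF W(3), of "(c, c - 3 * e)"] \<open>a = _\<close>
      by (simp add: v root_lattice_iff rho_pair refl_pair)
  next
    assume "d = 3 * e + 2" "a = 3 * c + 1"
    then have "b = 3 * (c + 1 - 3 * (e + 1)) + 1" using d by (simp add: algebra_simps)
    then show ?thesis using that[OF W(4), of "(c + 1, c + 1 - 3 * (e + 1))"] \<open>a = _\<close>
      by (simp add: v root_lattice_iff rho_pair refl_pair)
  next
    assume "d = 3 * e + 2" "a = 3 * c + 2"
    then have "b = 3 * (c + 1 - 3 * (e + 1)) + 2" using d by (simp add: algebra_simps)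
    then show ?thesis using that[OF W(2), of "(c + 1, c + 1 - 3 * (e + 1))"] \<open>a = _\<close>
      by (simp add: v root_lattice_iff rho_pair refl_pair)
  qed
qed

lemma scale3_honeycomb:
  assumes "u \<in> weyl" "\<kappa> \<in> root_lattice"
  shows "scale 3 \<kappa> + u rho \<in> honeycomb"
proof -
  have "rho + scale (3 * 1) (inv u \<kappa>) \<in> honeycomb"
    unfolding honeycomb_shift by (simp add: rho_pair honeycomb_iff)
  then have "u (rho + scale 3 (inv u \<kappa>)) \<in> honeycomb"
    by (simp add: honeycomb_weyl assms)
  then show ?thesis by (simp add: weyl_add weyl_scale assms add.commute)
qed

text \<open>The product of \<open>inv w rho\<close> with a root \<open>\<alpha>\<close> is the height of \<open>w \<alpha>\<close>, which is 1 or 2 in absolute value.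
So \<open>3 \<langle>\<kappa>, \<alpha>\<rangle>\<close> plus this height is positive iff \<open>\<langle>\<kappa>, \<alpha>\<rangle>\<close> is nonnegative or positive, according to the
sign of \<open>w \<alpha>\<close>; similarly for the upper bound.\<close>

lemma dominant_level_iff:
  assumes "w \<in> weyl" "\<kappa> \<in> root_lattice"
  shows "\<kappa> \<in> dominant_level p w \<longleftrightarrow> scale 3 \<kappa> + inv w rho \<in> alcove p"
proof -
  have h: "scale 3 \<kappa> + inv w rho \<in> honeycomb"
    by (rule scale3_honeycomb[OF weyl_inv[OF assms(1)] assms(2)])
  obtain c d where k: "\<kappa> = (c, d)" by (cases \<kappa>)
  have th: "ip (c, d) theta = of_int (c + d)" by (simp add: ip_def theta_pair)
  have real: "real_of_int x < real p \<longleftrightarrow> x < int p" "real_of_int x \<le> real p \<longleftrightarrow> x \<le> int p" for x by linarith+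
  have "scale 3 \<kappa> + inv w rho \<in> alcove p \<longleftrightarrow> 0 < fst (scale 3 \<kappa> + inv w rho) \<and>
     0 < snd (scale 3 \<kappa> + inv w rho) \<and> fst (scale 3 \<kappa> + inv w rho) + snd (scale 3 \<kappa> + inv w rho) < 3 * int p"
    using h by (simp add: alcove_def)
  moreover have "\<kappa> \<in> dominant_level p w \<longleftrightarrow> 0 \<le> c \<and> 0 \<le> d \<and> (negative (w alpha1) \<longrightarrow> 0 < c) \<and>
     (negative (w alpha2) \<longrightarrow> 0 < d) \<and> (positive (w theta) \<longrightarrow> c + d < int p) \<and>
     (negative (w theta) \<longrightarrow> c + d \<le> int p)"
    unfolding dominant_level_def dominant_def k mem_Collect_eq ip_alpha1 ip_alpha2 th real by simp
  ultimately show ?thesis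
    using assms(1)
    by (elim weyl_cases; simp only:)
      (simp_all add: k weyl_inv_simps refl_pair rho_pair pos_roots_def alpha1_def alpha2_def theta_pair, arith+)
qed

lemma Wplus_cases:
  assumes "y \<in> Wplus p"
  obtains w \<kappa> where "w \<in> weyl" "\<kappa> \<in> root_lattice" "y = w \<circ> transl (- \<kappa>)"
    "iota y + rho = scale 3 \<kappa> + inv w rho" "iota y + rho \<in> alcove p"
  using assms dominant_level_iff iota_rho unfolding Wplus_def by auto

lemma Wplus_bij: "bij_betw (\<lambda>y. iota y + rho) (Wplus p) (alcove p)"
  unfolding bij_betw_def
proof
  show "inj_on (\<lambda>y. iota y + rho) (Wplus p)"
  proof (rule inj_onI)
    fix x y assume "x \<in> Wplus p" "y \<in> Wplus p" and eq: "iota x + rho = iota y + rho"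
    obtain w \<kappa> where x: "w \<in> weyl" "\<kappa> \<in> root_lattice" "x = w \<circ> transl (- \<kappa>)"
      "iota x + rho = scale 3 \<kappa> + inv w rho" using \<open>x \<in> Wplus p\<close> by (rule Wplus_cases)
    obtain w' \<kappa>' where y: "w' \<in> weyl" "\<kappa>' \<in> root_lattice" "y = w' \<circ> transl (- \<kappa>')"
      "iota y + rho = scale 3 \<kappa>' + inv w' rho" using \<open>y \<in> Wplus p\<close> by (rule Wplus_cases)
    have "inv w = inv w'" "\<kappa> = \<kappa>'"
      using honeycomb_param_inj[OF weyl_inv[OF x(1)] weyl_inv[OF y(1)] x(2) y(2)] eq x(4) y(4) by auto
    then show "x = y" using x y by (metis weyl_inv_inv)
  qed
  show "(\<lambda>y. iota y + rho) ` Wplus p = alcove p"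
  proof (intro equalityI subsetI)
    fix v assume "v \<in> (\<lambda>y. iota y + rho) ` Wplus p"
    then show "v \<in> alcove p" by (auto elim: Wplus_cases)
  next
    fix v assume v: "v \<in> alcove p"
    then have "v \<in> honeycomb" by (simp add: alcove_def)
    then obtain u \<kappa> where u: "u \<in> weyl" "\<kappa> \<in> root_lattice" "v = scale 3 \<kappa> + u rho"
      by (rule honeycomb_param)
    have w: "inv u \<in> weyl" using u weyl_inv by blast
    have "\<kappa> \<in> dominant_level p (inv u)"
      using v u by (simp add: dominant_level_iff[OF w u(2)])
    then have "inv u \<circ> transl (- \<kappa>) \<in> Wplus p" using w u unfolding Wplus_def by blast
    moreover have "v = iota (inv u \<circ> transl (- \<kappa>)) + rho"
      using u by (simp add: iota_rho[OF w u(2)])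
    ultimately show "v \<in> (\<lambda>y. iota y + rho) ` Wplus p" by blast
  qed
qed

text \<open>The two sublattices have \<open>p (p + 1) / 2\<close> and \<open>p (p - 1) / 2\<close> vertices in the alcove. For this reason
the square \<open>Exps p\<close> is cut here along the diagonal next to the one at which \<open>eps\<close> changes its sign.\<close>

lemma Exps_bij:
  "bij_betw (\<lambda>\<mu>. if fst \<mu> + snd \<mu> < int p then scale 3 \<mu> + (1, 1)
      else scale 3 ((int p - 1, int p - 1) - \<mu>) + (2, 2)) (Exps p) (alcove p)"
  (is "bij_betw ?f _ _")
proof (rule bij_betw_byWitness[where f' = "\<lambda>v. if fst v mod 3 = 1 then (fst v div 3, snd v div 3)
      else (int p - 1 - fst v div 3, int p - 1 - snd v div 3)"], goal_cases)
  case 1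
  have "(3 * int p - 3 * a - 1) mod 3 = 2" "(3 * int p - 3 * a - 1) div 3 = int p - 1 - a" for a
    by presburger+
  then show ?case by (auto simp: scale_def)
next
  case 2
  have *: "\<exists>m n. v = (3 * m + 1, 3 * n + 1) \<or> v = (3 * m + 2, 3 * n + 2)" if "v \<in> honeycomb" for v
  proof -
    obtain a b where v: "v = (a, b)" by (cases v)
    have "a mod 3 = 1 \<or> a mod 3 = 2" "a mod 3 = b mod 3" using that by (auto simp: v honeycomb_iff)
    then have "a = 3 * (a div 3) + 1 \<and> b = 3 * (b div 3) + 1 \<or> a = 3 * (a div 3) + 2 \<and> b = 3 * (b div 3) + 2"
      by presburger
    then show ?thesis unfolding v by blast
  qed
  show ?case
  proof
    fix v assume "v \<in> alcove p"
    then have "v \<in> honeycomb" "fst v + snd v < 3 * int p" by (auto simp: alcove_def)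
    with *[of v] show "?f (if fst v mod 3 = 1 then (fst v div 3, snd v div 3)
      else (int p - 1 - fst v div 3, int p - 1 - snd v div 3)) = v"
      by auto
  qed
next
  case 3
  have "(3 * int p - 3 * m - 1) mod 3 = 2" for m
    by presburger
  then have "(3 * m + 1, 3 * n + 1) \<in> honeycomb"
    "(3 * int p - 3 * m - 1, 3 * int p - 3 * n - 1) \<in> honeycomb" for m n
    by (simp_all add: honeycomb_iff)
  then show ?case
    by (auto simp: alcove_def Exps_iff scale_def)
next
  case 4
  show ?case
  proof
    fix t assume "t \<in> (\<lambda>v. if fst v mod 3 = 1 then (fst v div 3, snd v div 3)
      else (int p - 1 - fst v div 3, int p - 1 - snd v div 3)) ` alcove p"
    then obtain v where v: "v \<in> alcove p" and t: "t = (if fst v mod 3 = 1 then (fst v div 3, snd v div 3)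
      else (int p - 1 - fst v div 3, int p - 1 - snd v div 3))" by blast
    obtain a b where ab: "v = (a, b)" by (cases v)
    have "0 < a" "0 < b" "a + b < 3 * int p" using v by (auto simp: ab alcove_def)
    then have "0 \<le> a div 3" "0 \<le> b div 3" "a div 3 < int p" "b div 3 < int p" by linarith+
    then show "t \<in> Exps p" unfolding t ab by (simp add: Exps_iff)
  qed
qed

lemma card_Wplus: "card (Wplus p) = card (Exps p)"
  using bij_betw_same_card[OF Wplus_bij] bij_betw_same_card[OF Exps_bij] by simp

lemma finite_Wplus [simp]: "finite (Wplus p)" and finite_Exps [simp]: "finite (Exps p)"
  using bij_betw_finite[OF Wplus_bij] bij_betw_finite[OF Exps_bij] by simp_all

text \<open>A shortest point in a coset of \<open>3 p Q\<close> satisfies \<open>\<langle>x, \<gamma>\<rangle> \<le> 3 p\<close> for all roots \<open>\<gamma>\<close>, so its dominant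
Weyl image lies in the closed alcove. It is not on a wall since the labels of a vertex and their sum
are not divisible by 3.\<close>

lemma alcove_tile:
  assumes p: "p > 0" and v: "v \<in> honeycomb"
  obtains w \<beta> u where "w \<in> weyl" "\<beta> \<in> root_lattice" "u \<in> alcove p"
    "v = w u + scale (3 * int p) \<beta>"
proof -
  define N where "N = 3 * int p"
  have N: "N > 0" using p by (simp add: N_def)
  \<comment> \<open>\<open>q x\<close> is the squared length of \<open>x\<close> times \<open>3 / 2\<close>, in order to stay in the integers.\<close>
  define q where "q = (\<lambda>x :: weight. fst x * fst x + fst x * snd x + snd x * snd x)"
  have q0: "q x \<ge> 0" for x
  proof -
    have "2 * q x = (fst x + snd x)\<^sup>2 + (fst x)\<^sup>2 + (snd x)\<^sup>2"
      by (simp add: q_def power2_eq_square algebra_simps)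
    also have "\<dots> \<ge> 0" by simp
    finally show ?thesis by simp
  qed
  obtain \<beta> where \<beta>: "\<beta> \<in> root_lattice"
    and min: "\<And>\<beta>'. \<beta>' \<in> root_lattice \<Longrightarrow> nat (q (v + scale N \<beta>)) \<le> nat (q (v + scale N \<beta>'))"
  proof -
    have "(0 :: weight) \<in> root_lattice" by (simp add: zero_prod_def root_lattice_iff)
    from exists_least_iff[THEN iffD1, of "\<lambda>n. \<exists>\<beta>\<in>root_lattice. n = nat (q (v + scale N \<beta>))"] this
    obtain n where n: "\<exists>\<beta>\<in>root_lattice. n = nat (q (v + scale N \<beta>))"
      and least: "\<And>m. m < n \<Longrightarrow> \<not> (\<exists>\<beta>\<in>root_lattice. m = nat (q (v + scale N \<beta>)))" by blast
    then show ?thesis using that by (metis not_less)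
  qed
  define x where "x = v + scale N \<beta>"
  obtain a b where ab: "x = (a, b)" by (cases x)
  have root: "fst \<gamma> * (2 * a + b) + snd \<gamma> * (a + 2 * b) \<le> 3 * N"
    if "\<gamma> \<in> root_lattice" "q \<gamma> = 3" for \<gamma>
  proof -
    have "q x \<le> q (v + scale N (\<beta> - \<gamma>))"
      using min[of "\<beta> - \<gamma>"] root_lattice_add[OF \<beta> root_lattice_minus[OF that(1)]] q0
      by (simp add: x_def nat_le_eq_zle)
    also have "v + scale N (\<beta> - \<gamma>) = x - scale N \<gamma>"
      by (simp add: x_def scale_diff)
    also have "q (x - scale N \<gamma>) = q x - N * (fst \<gamma> * (2 * a + b) + snd \<gamma> * (a + 2 * b)) + N * N * q \<gamma>"
      by (simp add: q_def ab scale_def algebra_simps)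
    finally have "N * (fst \<gamma> * (2 * a + b) + snd \<gamma> * (a + 2 * b)) \<le> N * (3 * N)"
      using that by (simp add: algebra_simps)
    then show ?thesis using N by simp
  qed
  have bounds: "a \<le> N" "- a \<le> N" "b \<le> N" "- b \<le> N" "a + b \<le> N" "- (a + b) \<le> N"
    using root[of "(2, -1)"] root[of "(-2, 1)"] root[of "(-1, 2)"] root[of "(1, -2)"]
      root[of "(1, 1)"] root[of "(-1, -1)"]
    by (simp_all add: root_lattice_iff q_def)
  have hx: "x \<in> honeycomb" using v unfolding x_def N_def by (simp add: honeycomb_shift)
  have "\<not> 3 dvd a" "\<not> 3 dvd b" "\<not> 3 dvd a + b"
    using hx unfolding ab honeycomb_alt by presburger+
  then have ne: "a \<noteq> 0" "b \<noteq> 0" "a + b \<noteq> 0" "a \<noteq> N" "- a \<noteq> N" "b \<noteq> N" "- b \<noteq> N" "a + b \<noteq> N" "- (a + b) \<noteq> N"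
    unfolding N_def by (metis dvd_0_right dvd_minus_iff dvd_triv_left)+
  have strict: "a < N" "- a < N" "b < N" "- b < N" "a + b < N" "- (a + b) < N"
    using bounds ne(4-) by (simp_all only: order.strict_iff_order simp_thms)
  have sgn: "a < 0 \<or> 0 < a" "b < 0 \<or> 0 < b" "a + b < 0 \<or> 0 < a + b"
    using ne(1-3) by (simp_all only: neq_iff)
  have "\<exists>w\<in>weyl. 0 < fst (w x) \<and> 0 < snd (w x) \<and> fst (w x) + snd (w x) < N"
  proof -
    consider "0 < a" "0 < b" | "a < 0" "0 < a + b" | "b < 0" "0 < a + b"
      | "0 < a" "a + b < 0" | "0 < b" "a + b < 0" | "a < 0" "b < 0" using sgn by linarith
    then show ?thesis
    proof cases
      case 1
      then show ?thesis using strict by (intro bexI[of _ id]) (auto simp: ab weyl_eq)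
    next
      case 2
      then show ?thesis using strict by (intro bexI[of _ refl1]) (auto simp: ab weyl_eq refl_pair)
    next
      case 3
      then show ?thesis using strict by (intro bexI[of _ refl2]) (auto simp: ab weyl_eq refl_pair)
    next
      case 4
      then show ?thesis using strict by (intro bexI[of _ "refl1 \<circ> refl2"]) (auto simp: ab weyl_eq refl_pair)
    next
      case 5
      then show ?thesis using strict by (intro bexI[of _ "refl2 \<circ> refl1"]) (auto simp: ab weyl_eq refl_pair)
    next
      case 6
      then show ?thesis using strict by (intro bexI[of _ "refl1 \<circ> refl2 \<circ> refl1"]) (auto simp: ab weyl_eq refl_pair)
    qed
  qed
  then obtain w where w: "w \<in> weyl" "0 < fst (w x)" "0 < snd (w x)" "fst (w x) + snd (w x) < N" by blast
  have "w x \<in> alcove p" using w hx by (simp add: alcove_def N_def honeycomb_weyl)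
  moreover have "v = inv w (w x) + scale (3 * int p) (- \<beta>)"
    using w by (simp add: x_def N_def scale_minus)
  ultimately show ?thesis
    using that[OF weyl_inv[OF w(1)] root_lattice_minus[OF \<beta>]] by blast
qed

text \<open>If the translation parts were arbitrary elements of \<open>3 p P\<close>, there would be two nontrivial rotations
that preserve the alcove. The assumption on \<open>\<beta>\<close> excludes them.\<close>

lemma alcove_strict:
  assumes u: "u \<in> alcove p" and u': "u' \<in> alcove p" and w: "w \<in> weyl" and \<beta>: "\<beta> \<in> root_lattice"
    and eq: "u' = w u + scale (3 * int p) \<beta>"
  shows "w = id \<and> \<beta> = 0"
proof -
  define N where "N = 3 * int p"
  obtain a b a' b' c d where ab: "u = (a, b)" "u' = (a', b')" "\<beta> = (c, d)"
    by (cases u; cases u'; cases \<beta>)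
  have bd: "0 < a" "0 < b" "a + b < N" "0 < a'" "0 < b'" "a' + b' < N"
    using u u' by (auto simp: alcove_def ab N_def)
  have cd: "3 dvd c - d" using \<beta> by (simp add: ab root_lattice_iff)
  have N: "N > 0" using bd by linarith
  have plus: "k = 0" if "0 < x" "x < N" "0 < y" "y < N" "x = y + N * k" for x y k :: int
  proof -
    have "N * k < N * 1" "N * (- 1) < N * k" using that by linarith+
    then have "k < 1" "- 1 < k" using N by (simp_all only: mult_less_cancel_left_pos)
    then show ?thesis by simp
  qed
  have minus: "k = 1" if "0 < x" "x < N" "0 < y" "y < N" "x = N * k - y" for x y k :: int
  proof -
    have "N * 0 < N * k" "N * k < N * 2" using that by linarith+
    then have "0 < k" "k < 2" using N by (simp_all only: mult_less_cancel_left_pos)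
    then show ?thesis by simp
  qed
  show ?thesis using w
  proof (cases rule: weyl_cases)
    case 1
    then have "a' = a + N * c" "b' = b + N * d" using eq by (simp_all add: ab N_def)
    then have "c = 0" "d = 0" using plus[of a' a c] plus[of b' b d] bd by auto
    then show ?thesis using 1 by (simp add: ab zero_prod_def)
  next
    case 2
    then have "a' = N * c - a" "b' = (a + b) + N * d" using eq by (simp_all add: ab N_def refl_pair)
    then have "c = 1" "d = 0" using minus[of a' a c] plus[of b' "a + b" d] bd by auto
    then show ?thesis using cd by simp
  next
    case 3
    then have "a' = (a + b) + N * c" "b' = N * d - b" using eq by (simp_all add: ab N_def refl_pair)
    then have "c = 0" "d = 1" using plus[of a' "a + b" c] minus[of b' b d] bd by auto
    then show ?thesis using cd by simp
  next
    case 4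
    then have "a' = N * c - (a + b)" "b' = a + N * d" using eq by (simp_all add: ab N_def refl_pair)
    then have "c = 1" "d = 0" using minus[of a' "a + b" c] plus[of b' a d] bd by auto
    then show ?thesis using cd by simp
  next
    case 5
    then have "a' = b + N * c" "b' = N * d - (a + b)" using eq by (simp_all add: ab N_def refl_pair)
    then have "c = 0" "d = 1" using plus[of a' b c] minus[of b' "a + b" d] bd by auto
    then show ?thesis using cd by simp
  next
    case 6
    then have e: "a' = N * c - b" "b' = N * d - a" using eq by (simp_all add: ab N_def refl_pair)
    then have "c = 1" "d = 1" using minus[of a' b c] minus[of b' a d] bd by auto
    moreover have "c + d = 1" using minus[of "a' + b'" "a + b" "c + d"] e bd by (simp add: algebra_simps)
    ultimately show ?thesis by simp
  qed
qed

section \<open>Convolutions on antisymmetric functions\<close>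

text \<open>The matrix, in the coordinates given by the alcove, of the convolution by \<open>m\<close> on functions that are
antisymmetric under the affine reflection group. Its elements \<open>u \<mapsto> w u + 3 p \<beta>\<close> are represented by
the pairs \<open>(w, \<beta>)\<close>.\<close>

definition kernel :: "nat \<Rightarrow> (weight \<Rightarrow> int) \<Rightarrow> weight \<Rightarrow> weight \<Rightarrow> int" where
  "kernel p m v u = (\<Sum>(w, \<beta>)\<in>{(w, \<beta>). w \<in> weyl \<and> \<beta> \<in> root_lattice \<and>
      m (w u + scale (3 * int p) \<beta> - v) \<noteq> 0}. wdet w * m (w u + scale (3 * int p) \<beta> - v))"

lemma tile_unique:
  assumes "u \<in> alcove p" "u' \<in> alcove p" "w \<in> weyl" "w' \<in> weyl" "\<beta> \<in> root_lattice" "\<beta>' \<in> root_lattice"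
    and eq: "w u + scale (3 * int p) \<beta> = w' u' + scale (3 * int p) \<beta>'"
  shows "u = u' \<and> w = w' \<and> \<beta> = \<beta>'"
proof -
  let ?g = "inv w (\<beta>' - \<beta>)"
  have iw: "inv w \<in> weyl" using assms weyl_inv by blast
  have "w u = w' u' + scale (3 * int p) (\<beta>' - \<beta>)"
    using eq by (simp add: scale_diff algebra_simps)
  then have "inv w (w u) = inv w (w' u' + scale (3 * int p) (\<beta>' - \<beta>))" by simp
  then have u: "u = (inv w \<circ> w') u' + scale (3 * int p) ?g"
    by (simp add: weyl_add[OF iw] weyl_scale[OF iw] assms(3))
  have "?g \<in> root_lattice"
    using root_lattice_weyl[OF iw root_lattice_add[OF assms(6) root_lattice_minus[OF assms(5)]]] by simp
  from alcove_strict[OF assms(2,1) weyl_comp[OF iw assms(4)] this u]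
  have id: "inv w \<circ> w' = id" "?g = 0" by blast+
  then have "w' = w" using weyl_inv_comp(2)[OF assms(3), of w'] by (metis comp_id)
  moreover have "\<beta>' = \<beta>" using id(2) by (simp add: weyl_zero_iff[OF iw])
  ultimately show ?thesis using eq weyl_bij[OF assms(3)]
    by (metis add_right_cancel assms(3) weyl_inv_apply(1))
qed

text \<open>The images of the alcove tile the honeycomb, so the double sum over the alcove and the reflection
group is a single sum over the honeycomb.\<close>

lemma kernel_sum:
  fixes g :: "weight \<Rightarrow> complex"
  assumes p: "p > 0" and fin: "finite {\<eta>. m \<eta> \<noteq> 0}"
    and g_weyl: "\<And>w v. w \<in> weyl \<Longrightarrow> g (w v) = of_int (wdet w) * g v"
    and g_per: "\<And>v \<beta>. \<beta> \<in> root_lattice \<Longrightarrow> g (v + scale (3 * int p) \<beta>) = g v"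
    and g_out: "\<And>v. v \<notin> honeycomb \<Longrightarrow> g v = 0"
  shows "(\<Sum>u\<in>alcove p. of_int (kernel p m v u) * g u) = (\<Sum>\<eta>\<in>{\<eta>. m \<eta> \<noteq> 0}. of_int (m \<eta>) * g (v + \<eta>))"
proof -
  define act where "act = (\<lambda>(u :: weight, w, \<beta>). w u + scale (3 * int p) \<beta> - v :: weight)"
  define G where "G = (\<lambda>u. {(w, \<beta>). w \<in> weyl \<and> \<beta> \<in> root_lattice \<and>
      m (w u + scale (3 * int p) \<beta> - v) \<noteq> 0})"
  define T where "T = {\<eta>. m \<eta> \<noteq> 0 \<and> v + \<eta> \<in> honeycomb}"
  have bij: "bij_betw act (Sigma (alcove p) G) T"
    unfolding bij_betw_def
  proof
    show "inj_on act (Sigma (alcove p) G)"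
    proof (rule inj_onI)
      fix s t assume "s \<in> Sigma (alcove p) G" "t \<in> Sigma (alcove p) G" and eq: "act s = act t"
      then obtain u w \<beta> u' w' \<beta>' where st: "s = (u, w, \<beta>)" "t = (u', w', \<beta>')"
        "u \<in> alcove p" "u' \<in> alcove p" "w \<in> weyl" "w' \<in> weyl" "\<beta> \<in> root_lattice" "\<beta>' \<in> root_lattice"
        unfolding G_def by blast
      have "w u + scale (3 * int p) \<beta> = w' u' + scale (3 * int p) \<beta>'"
        using eq unfolding st act_def split_conv by (metis diff_add_cancel)
      from tile_unique[OF st(3-8) this] show "s = t" unfolding st by blast
    qed
    show "act ` Sigma (alcove p) G = T"
    proof (intro equalityI subsetI)
      fix \<eta> assume "\<eta> \<in> act ` Sigma (alcove p) G"
      then obtain u w \<beta> where "\<eta> = act (u, w, \<beta>)" "u \<in> alcove p" "(w, \<beta>) \<in> G u" by fast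
      then have "u \<in> alcove p" "w \<in> weyl" "\<beta> \<in> root_lattice"
        "\<eta> = w u + scale (3 * int p) \<beta> - v" "m \<eta> \<noteq> 0"
        by (simp_all add: act_def G_def)
      then show "\<eta> \<in> T"
        by (simp add: T_def honeycomb_shift honeycomb_weyl alcove_def)
    next
      fix \<eta> assume \<eta>: "\<eta> \<in> T"
      then obtain w \<beta> u where *: "w \<in> weyl" "\<beta> \<in> root_lattice" "u \<in> alcove p"
        "v + \<eta> = w u + scale (3 * int p) \<beta>"
        using alcove_tile[OF p, of "v + \<eta>"] unfolding T_def by blast
      then have e: "w u + scale (3 * int p) \<beta> - v = \<eta>" by (metis add_diff_cancel_left')
      then have "(u, w, \<beta>) \<in> Sigma (alcove p) G" "act (u, w, \<beta>) = \<eta>"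
        using * \<eta> unfolding G_def act_def T_def by (simp_all add: e)
      then show "\<eta> \<in> act ` Sigma (alcove p) G" by (metis imageI)
    qed
  qed
  have finT: "finite T" by (rule finite_subset[OF _ fin]) (auto simp: T_def)
  then have finS: "finite (Sigma (alcove p) G)" using bij bij_betw_finite by blast
  have finG: "\<forall>u\<in>alcove p. finite (G u)"
  proof
    fix u assume "u \<in> alcove p"
    then have "Pair u ` G u \<subseteq> Sigma (alcove p) G" by auto
    then have "finite (Pair u ` G u)" using finS finite_subset by blast
    then show "finite (G u)" by (rule finite_imageD) (simp add: inj_on_def)
  qed
  have step: "of_int (wdet w * m (w u + scale (3 * int p) \<beta> - v)) * g u =
      of_int (m (act (u, w, \<beta>))) * g (v + act (u, w, \<beta>))" if "(w, \<beta>) \<in> G u" for u w \<beta>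
  proof -
    have wb: "w \<in> weyl" "\<beta> \<in> root_lattice" using that by (auto simp: G_def)
    have "v + act (u, w, \<beta>) = w u + scale (3 * int p) \<beta>" by (simp add: act_def)
    then show ?thesis by (simp add: g_per wb g_weyl act_def)
  qed
  have "(\<Sum>u\<in>alcove p. of_int (kernel p m v u) * g u) =
      (\<Sum>u\<in>alcove p. \<Sum>(w, \<beta>)\<in>G u. of_int (wdet w * m (w u + scale (3 * int p) \<beta> - v)) * g u)"
  proof -
    have "kernel p m v u = (\<Sum>(w, \<beta>)\<in>G u. wdet w * m (w u + scale (3 * int p) \<beta> - v))" for u
      by (simp only: kernel_def G_def)
    then show ?thesis by (simp only: of_int_sum sum_distrib_right split_def)
  qed
  also have "\<dots> = (\<Sum>u\<in>alcove p. \<Sum>(w, \<beta>)\<in>G u. of_int (m (act (u, w, \<beta>))) * g (v + act (u, w, \<beta>)))"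
    by (rule sum.cong[OF refl], rule sum.cong[OF refl]) (use step in auto)
  also have "\<dots> = (\<Sum>t\<in>Sigma (alcove p) G. of_int (m (act t)) * g (v + act t))"
    by (subst sum.Sigma) (use finG in \<open>auto simp: split_def\<close>)
  also have "\<dots> = (\<Sum>\<eta>\<in>T. of_int (m \<eta>) * g (v + \<eta>))"
    by (rule sum.reindex_bij_betw[OF bij])
  also have "\<dots> = (\<Sum>\<eta>\<in>{\<eta>. m \<eta> \<noteq> 0}. of_int (m \<eta>) * g (v + \<eta>))"
    using g_out by (intro sum.mono_neutral_left[OF fin]) (fastforce simp: T_def)+
  finally show ?thesis .
qed

text \<open>The substitution of the inverse for each element of the reflection group.\<close>

lemma kernel_symmetric:
  assumes "\<And>w x. w \<in> weyl \<Longrightarrow> m (w x) = m x"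
  shows "kernel p m u v = kernel p (\<lambda>x. m (- x)) v u"
  unfolding kernel_def
proof (rule sum.reindex_bij_witness[where i = "\<lambda>(w, \<beta>). (inv w, - inv w \<beta>)" and j = "\<lambda>(w, \<beta>). (inv w, - inv w \<beta>)"], goal_cases)
  have inv: "inv w (w' + scale n \<beta> - v) = inv w w' + scale n (inv w \<beta>) - inv w v" if "w \<in> weyl" for w w' \<beta> n v
    by (simp add: weyl_add weyl_diff weyl_scale weyl_inv that)
  have key: "m (- (inv w u + scale n (- inv w \<beta>) - v)) = m (w v + scale n \<beta> - u)"
    if "w \<in> weyl" for w n \<beta> u v
  proof -
    have "- (inv w u + scale n (- inv w \<beta>) - v) = inv w (w v + scale n \<beta> - u)"
      using that by (simp add: inv scale_minus)
    then show ?thesis using assms[OF weyl_inv[OF that]] by simp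
  qed
  have key': "m (inv w v + scale n (- inv w \<beta>) - u) = m (- (w u + scale n \<beta> - v))"
    if "w \<in> weyl" for w n \<beta> u v
    using key[OF weyl_inv[OF that], of u n "- inv w \<beta>" v] that by (simp add: weyl_minus[OF that])
  {
    case (1 a)
    then obtain w \<beta> where "a = (w, \<beta>)" "w \<in> weyl" by blast
    then show ?case by (simp add: weyl_inv weyl_minus)
  next
    case (2 a)
    then obtain w \<beta> where "a = (w, \<beta>)" "w \<in> weyl" "\<beta> \<in> root_lattice"
      "m (w v + scale (3 * int p) \<beta> - u) \<noteq> 0" by blast
    then show ?case
      by (simp only: mem_Collect_eq split_conv key weyl_inv root_lattice_minus root_lattice_weyl) simp
  next
    case (3 b)
    then obtain w \<beta> where "b = (w, \<beta>)" "w \<in> weyl" by blast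
    then show ?case by (simp add: weyl_inv weyl_minus)
  next
    case (4 b)
    then obtain w \<beta> where "b = (w, \<beta>)" "w \<in> weyl" "\<beta> \<in> root_lattice"
      "m (- (w u + scale (3 * int p) \<beta> - v)) \<noteq> 0" by blast
    then show ?case
      by (simp only: mem_Collect_eq split_conv key' weyl_inv root_lattice_minus root_lattice_weyl) simp
  next
    case (5 a)
    then obtain w \<beta> where "a = (w, \<beta>)" "w \<in> weyl" by blast
    then show ?case by (simp only: split_conv key wdet_inv)
  }
qed

text \<open>For \<open>g = inv u \<circ> transl (- p \<beta>)\<close> a computation in the affine Weyl group gives
\<open>iota (z \<circ> g \<circ> inv y) = w (u (iota z + rho) + 3 p \<beta> - (iota y + rho))\<close>, where \<open>w\<close> is the linear part of
\<open>y\<close>; this \<open>w\<close> can be dropped by \<open>mult_weyl\<close>.\<close>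

lemma fusion_kernel:
  assumes p: "p > 0" and "y \<in> Wplus p" "z \<in> Wplus p"
  shows "fusion p x y z = kernel p (mult (iota x)) (iota y + rho) (iota z + rho)"
proof -
  obtain wy ky where y: "wy \<in> weyl" "ky \<in> root_lattice" "y = wy \<circ> transl (- ky)"
    "iota y + rho = scale 3 ky + inv wy rho" using assms(2) by (rule Wplus_cases)
  obtain wz kz where z: "wz \<in> weyl" "kz \<in> root_lattice" "z = wz \<circ> transl (- kz)"
    "iota z + rho = scale 3 kz + inv wz rho" using assms(3) by (rule Wplus_cases)
  let ?f = "\<lambda>(u, \<beta>). inv u \<circ> transl (scale (int p) (- \<beta>))"
  let ?m = "mult (iota x)"
  have lin: "lin_part (inv u \<circ> transl (scale (int p) (- \<beta>))) = inv u"
    if "u \<in> weyl" "\<beta> \<in> root_lattice" for u \<beta>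
  proof -
    have "scale (int p) \<beta> \<in> root_lattice"
      using that(2) by (cases \<beta>) (simp add: root_lattice_iff flip: right_diff_distrib)
    from weyl_parts(1)[OF weyl_inv[OF that(1)] this] show ?thesis by (simp add: scale_minus)
  qed
  have inv_y: "inv y v = inv wy v + ky" for v
  proof -
    have "inv y = transl ky \<circ> inv wy"
      by (rule inv_unique_comp; rule ext; simp add: y(1,3) transl_def)
    then show ?thesis by (simp add: transl_def)
  qed
  have key: "?m (iota (z \<circ> ?f (u, \<beta>) \<circ> inv y)) =
      ?m (u (iota z + rho) + scale (3 * int p) \<beta> - (iota y + rho))"
    if u: "u \<in> weyl" and \<beta>: "\<beta> \<in> root_lattice" for u \<beta>
  proof -
    have iu: "inv u \<in> weyl" using u weyl_inv by blast
    have iwy: "inv wy \<in> weyl" using y weyl_inv by blast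
    define W where "W = wz \<circ> inv u \<circ> inv wy"
    define k where "k = wy (u kz - ky + scale (int p) \<beta>)"
    have W: "W \<in> weyl" unfolding W_def using weyl_comp z(1) iu iwy by blast
    have pb: "scale (int p) \<beta> \<in> root_lattice"
      using \<beta> by (cases \<beta>) (simp add: root_lattice_iff flip: right_diff_distrib)
    have k: "k \<in> root_lattice"
      using root_lattice_weyl[OF y(1) root_lattice_add[OF root_lattice_add[OF
        root_lattice_weyl[OF u z(2)] root_lattice_minus[OF y(2)]] pb]]
      by (simp add: k_def)
    have "z \<circ> ?f (u, \<beta>) \<circ> inv y = W \<circ> transl (- k)"
    proof
      fix v
      have "(z \<circ> ?f (u, \<beta>) \<circ> inv y) v = wz (inv u (inv wy v + ky + scale (int p) (- \<beta>)) - kz)"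
        by (simp add: z transl_def inv_y)
      also have "inv wy v + ky + scale (int p) (- \<beta>) = inv wy (v - k) + u kz"
        by (simp add: k_def weyl_diff[OF iwy] y(1) scale_minus)
      also have "inv u (inv wy (v - k) + u kz) - kz = inv u (inv wy (v - k))"
        by (simp add: weyl_add[OF iu] u)
      finally show "(z \<circ> ?f (u, \<beta>) \<circ> inv y) v = (W \<circ> transl (- k)) v"
        by (simp add: W_def transl_def)
    qed
    then have "iota (z \<circ> ?f (u, \<beta>) \<circ> inv y) = scale 3 k + inv W rho - rho"
      using iota_rho[OF W k] by (metis add_diff_cancel_right')
    also have "inv W = wy \<circ> u \<circ> inv wz"
      by (rule inv_unique_comp; rule ext; simp add: W_def y(1) z(1) u)
    also have "scale 3 k + (wy \<circ> u \<circ> inv wz) rho - rho =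
      wy (u (iota z + rho) + scale (3 * int p) \<beta> - (iota y + rho))"
    proof -
      have s: "scale 3 (scale (int p) \<beta>) = scale (3 * int p) \<beta>" by (cases \<beta>) simp
      show ?thesis
        unfolding y(4) z(4) k_def
        by (simp add: weyl_add weyl_diff weyl_scale[symmetric] y(1) z(1) u scale_add scale_diff s)
    qed
    finally show ?thesis by (simp only: mult_weyl[OF y(1)])
  qed
  show ?thesis
    unfolding fusion_def kernel_def
  proof (rule sum.reindex_bij_betw[symmetric, of ?f, THEN trans])
    let ?K = "{(w, \<beta>). w \<in> weyl \<and> \<beta> \<in> root_lattice \<and>
      ?m (w (iota z + rho) + scale (3 * int p) \<beta> - (iota y + rho)) \<noteq> 0}"
    show "bij_betw ?f ?K {w \<in> affine_weyl_lev p. ?m (iota (z \<circ> w \<circ> inv y)) \<noteq> 0}"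
      unfolding bij_betw_def
    proof
      show "inj_on ?f ?K"
      proof (rule inj_onI)
        fix s t assume "s \<in> ?K" "t \<in> ?K" and eq: "?f s = ?f t"
        then obtain u \<beta> u' \<beta>' where st: "s = (u, \<beta>)" "t = (u', \<beta>')" "u \<in> weyl" "u' \<in> weyl" by blast
        have "inv u \<circ> transl (- scale (int p) \<beta>) = inv u' \<circ> transl (- scale (int p) \<beta>')"
          using eq unfolding st split_conv scale_minus .
        from affine_decomp_unique[OF weyl_inv[OF st(3)] weyl_inv[OF st(4)] this]
        have "u = u'" "scale (int p) \<beta> = scale (int p) \<beta>'" using st(3,4) weyl_inv_inv by metis+
        then show "s = t" using p by (cases \<beta>; cases \<beta>') (simp add: st)
      qed
      show "?f ` ?K = {w \<in> affine_weyl_lev p. ?m (iota (z \<circ> w \<circ> inv y)) \<noteq> 0}"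
      proof (intro equalityI subsetI)
        fix g assume "g \<in> ?f ` ?K"
        then obtain u \<beta> where g: "g = ?f (u, \<beta>)" "u \<in> weyl" "\<beta> \<in> root_lattice"
          "?m (u (iota z + rho) + scale (3 * int p) \<beta> - (iota y + rho)) \<noteq> 0" by blast
        then have "g \<in> affine_weyl_lev p"
          unfolding affine_weyl_lev_def split_conv g(1)
          using weyl_inv[OF g(2)] root_lattice_minus[OF g(3)] by blast
        moreover have "?m (iota (z \<circ> g \<circ> inv y)) \<noteq> 0"
          unfolding g(1) key[OF g(2,3)] by (rule g(4))
        ultimately show "g \<in> {w \<in> affine_weyl_lev p. ?m (iota (z \<circ> w \<circ> inv y)) \<noteq> 0}" by blast
      next
        fix g assume "g \<in> {w \<in> affine_weyl_lev p. ?m (iota (z \<circ> w \<circ> inv y)) \<noteq> 0}"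
        then have nz: "?m (iota (z \<circ> g \<circ> inv y)) \<noteq> 0" and "g \<in> affine_weyl_lev p" by blast+
        then obtain w \<beta> where w: "g = w \<circ> transl (scale (int p) \<beta>)" "w \<in> weyl" "\<beta> \<in> root_lattice"
          unfolding affine_weyl_lev_def by blast
        then have g: "g = ?f (inv w, - \<beta>)" by simp
        have "(inv w, - \<beta>) \<in> ?K"
          using nz key[OF weyl_inv[OF w(2)] root_lattice_minus[OF w(3)]] unfolding g
          using weyl_inv[OF w(2)] root_lattice_minus[OF w(3)] by simp
        then show "g \<in> ?f ` ?K" unfolding g by (rule imageI)
      qed
    qed
    show "(\<Sum>t\<in>?K. wdet (lin_part (?f t)) * ?m (iota (z \<circ> ?f t \<circ> inv y))) =
      (\<Sum>(w, \<beta>)\<in>?K. wdet w * ?m (w (iota z + rho) + scale (3 * int p) \<beta> - (iota y + rho)))"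
    proof (rule sum.cong[OF refl])
      fix t assume "t \<in> ?K"
      then obtain u \<beta> where t: "t = (u, \<beta>)" "u \<in> weyl" "\<beta> \<in> root_lattice" by auto
      show "wdet (lin_part (?f t)) * ?m (iota (z \<circ> ?f t \<circ> inv y)) =
        (case t of (w, \<beta>) \<Rightarrow> wdet w * ?m (w (iota z + rho) + scale (3 * int p) \<beta> - (iota y + rho)))"
        unfolding t(1) key[OF t(2,3)] by (simp add: lin t(2,3) wdet_inv)
    qed
  qed
qed

section \<open>Orthogonality of the eigenfunctions\<close>

definition inner_alcove :: "nat \<Rightarrow> weight \<Rightarrow> weight \<Rightarrow> complex" where
  "inner_alcove p \<mu> \<mu>' = (\<Sum>v\<in>alcove p. eigenfun p \<mu> v * cnj (eigenfun p \<mu>' v))"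

text \<open>The convolution by the indicator function of \<open>S\<close> and that of \<open>- S\<close> are adjoint to each other, so
eigenfunctions with different eigenvalues are orthogonal.\<close>

lemma inner_alcove_eigen:
  assumes p: "p > 0" and S: "finite S" "\<And>w x. w \<in> weyl \<Longrightarrow> w x \<in> S \<longleftrightarrow> x \<in> S"
    and A: "\<And>v. v \<in> honeycomb \<Longrightarrow> (\<Sum>\<eta>\<in>S. eigenfun p \<mu> (v + \<eta>)) = c * eigenfun p \<mu> v"
    and B: "\<And>v. v \<in> honeycomb \<Longrightarrow> (\<Sum>\<eta>\<in>S. eigenfun p \<mu>' (v - \<eta>)) = c' * eigenfun p \<mu>' v"
  shows "c * inner_alcove p \<mu> \<mu>' = cnj c' * inner_alcove p \<mu> \<mu>'"
proof -
  define m :: "weight \<Rightarrow> int" where "m = (\<lambda>x. if x \<in> S then 1 else 0)"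
  define m' :: "weight \<Rightarrow> int" where "m' = (\<lambda>x. m (- x))"
  have supp: "{\<eta>. m \<eta> \<noteq> 0} = S" "{\<eta>. m' \<eta> \<noteq> 0} = uminus ` S"
  proof -
    show "{\<eta>. m \<eta> \<noteq> 0} = S" by (simp add: m_def)
    have "x \<in> uminus ` S \<longleftrightarrow> - x \<in> S" for x by (metis image_iff minus_minus)
    then show "{\<eta>. m' \<eta> \<noteq> 0} = uminus ` S" by (auto simp: m_def m'_def)
  qed
  have K: "(\<Sum>u\<in>alcove p. of_int (kernel p m v u) * eigenfun p \<mu> u) = c * eigenfun p \<mu> v"
    if "v \<in> alcove p" for v
  proof -
    have "(\<Sum>u\<in>alcove p. of_int (kernel p m v u) * eigenfun p \<mu> u) =
        (\<Sum>\<eta>\<in>{\<eta>. m \<eta> \<noteq> 0}. of_int (m \<eta>) * eigenfun p \<mu> (v + \<eta>))"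
      by (rule kernel_sum[OF p]) (simp_all add: supp S eigenfun_weyl eigenfun_period p, simp add: eigenfun_def)
    also have "\<dots> = (\<Sum>\<eta>\<in>S. eigenfun p \<mu> (v + \<eta>))"
      unfolding supp by (rule sum.cong) (simp_all add: m_def)
    also have "\<dots> = c * eigenfun p \<mu> v" by (rule A) (use that in \<open>simp add: alcove_def\<close>)
    finally show ?thesis .
  qed
  have K': "(\<Sum>u\<in>alcove p. of_int (kernel p m' v u) * eigenfun p \<mu>' u) = c' * eigenfun p \<mu>' v"
    if "v \<in> alcove p" for v
  proof -
    have "(\<Sum>u\<in>alcove p. of_int (kernel p m' v u) * eigenfun p \<mu>' u) =
        (\<Sum>\<eta>\<in>{\<eta>. m' \<eta> \<noteq> 0}. of_int (m' \<eta>) * eigenfun p \<mu>' (v + \<eta>))"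
      by (rule kernel_sum[OF p]) (simp_all add: supp S eigenfun_weyl eigenfun_period p, simp add: eigenfun_def)
    also have "\<dots> = (\<Sum>\<eta>\<in>S. eigenfun p \<mu>' (v - \<eta>))"
      unfolding supp by (subst sum.reindex) (simp_all add: m_def m'_def)
    also have "\<dots> = c' * eigenfun p \<mu>' v" by (rule B) (use that in \<open>simp add: alcove_def\<close>)
    finally show ?thesis .
  qed
  have sym: "kernel p m v u = kernel p m' u v" for u v
    unfolding m'_def by (rule kernel_symmetric) (simp add: m_def S)
  have "c * inner_alcove p \<mu> \<mu>' = (\<Sum>v\<in>alcove p. (c * eigenfun p \<mu> v) * cnj (eigenfun p \<mu>' v))"
    by (simp add: inner_alcove_def sum_distrib_left mult.assoc)
  also have "\<dots> = (\<Sum>v\<in>alcove p. \<Sum>u\<in>alcove p.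
      of_int (kernel p m v u) * eigenfun p \<mu> u * cnj (eigenfun p \<mu>' v))"
    by (rule sum.cong[OF refl]) (simp only: K[symmetric] sum_distrib_right)
  also have "\<dots> = (\<Sum>u\<in>alcove p. \<Sum>v\<in>alcove p.
      eigenfun p \<mu> u * cnj (of_int (kernel p m' u v) * eigenfun p \<mu>' v))"
    by (subst sum.swap) (simp add: sym mult_ac)
  also have "\<dots> = (\<Sum>u\<in>alcove p. eigenfun p \<mu> u * cnj (c' * eigenfun p \<mu>' u))"
    by (rule sum.cong[OF refl]) (simp only: K'[symmetric] sum_distrib_left cnj_sum)
  also have "\<dots> = cnj c' * inner_alcove p \<mu> \<mu>'"
    by (simp add: inner_alcove_def sum_distrib_left mult_ac)
  finally show ?thesis .
qed

lemma diff_pair: "(v :: weight) - (i, j) = v + (- i, - j)"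
  by (cases v) simp

lemma weyl_invariant_set:
  assumes "\<And>x. x \<in> S \<Longrightarrow> refl1 x \<in> S" "\<And>x. x \<in> S \<Longrightarrow> refl2 x \<in> S" "w \<in> weyl"
  shows "w x \<in> S \<longleftrightarrow> x \<in> S"
proof -
  have inv: "refl1 (refl1 x) = x" "refl2 (refl2 x) = x" for x
    by (cases x; simp add: refl_pair)+
  have r: "refl1 x \<in> S \<longleftrightarrow> x \<in> S" "refl2 x \<in> S \<longleftrightarrow> x \<in> S" for x
    by (metis assms(1) inv(1), metis assms(2) inv(2))
  from assms(3) show ?thesis by (induction rule: weyl.induct) (simp_all add: r)
qed

lemma cnj_wchar_Lam: "cnj (wchar p Lam2 \<mu>) = wchar p Lam1 \<mu>"
  by (simp add: wchar_charsum charsum_Lam1 charsum_Lam2 flip: wave_minus)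

lemma inner_alcove_Ffun:
  assumes "p > 0"
  shows "Ffun p \<mu> * inner_alcove p \<mu> \<mu>' = Ffun p \<mu>' * inner_alcove p \<mu> \<mu>'"
proof -
  let ?S = "{(2, -1), (-1, 2), (1, 1), (-2, 1), (1, -2), (-1, -1)} :: weight set"
  have "Ffun p \<mu> * inner_alcove p \<mu> \<mu>' = cnj (Ffun p \<mu>') * inner_alcove p \<mu> \<mu>'"
  proof (rule inner_alcove_eigen[OF assms, of ?S])
    show "w x \<in> ?S \<longleftrightarrow> x \<in> ?S" if "w \<in> weyl" for w x
      by (rule weyl_invariant_set[OF _ _ that]) (auto simp: refl_pair)
    show "(\<Sum>\<eta>\<in>?S. eigenfun p \<mu> (v + \<eta>)) = Ffun p \<mu> * eigenfun p \<mu> v" if "v \<in> honeycomb" for v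
      unfolding eigenfun_roots[OF that, symmetric] rootsum_def by simp
    show "(\<Sum>\<eta>\<in>?S. eigenfun p \<mu>' (v - \<eta>)) = Ffun p \<mu>' * eigenfun p \<mu>' v" if "v \<in> honeycomb" for v
      unfolding eigenfun_roots[OF that, symmetric] rootsum_def by (simp add: diff_pair)
  qed simp
  then show ?thesis by (simp add: cnj_Ffun)
qed

lemma inner_alcove_wchar:
  assumes "p > 0"
  shows "wchar p Lam1 \<mu> * inner_alcove p \<mu> \<mu>' = wchar p Lam1 \<mu>' * inner_alcove p \<mu> \<mu>'"
proof -
  let ?S = "{(3, 0), (-3, 3), (0, -3)} :: weight set"
  have "wchar p Lam1 \<mu> * inner_alcove p \<mu> \<mu>' = cnj (wchar p Lam2 \<mu>') * inner_alcove p \<mu> \<mu>'"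
  proof (rule inner_alcove_eigen[OF assms, of ?S])
    show "w x \<in> ?S \<longleftrightarrow> x \<in> ?S" if "w \<in> weyl" for w x
      by (rule weyl_invariant_set[OF _ _ that]) (auto simp: refl_pair)
    show "(\<Sum>\<eta>\<in>?S. eigenfun p \<mu> (v + \<eta>)) = wchar p Lam1 \<mu> * eigenfun p \<mu> v" for v
      unfolding charsum_eigenfun_scale3[symmetric] charsum_Lam1 by simp
    show "(\<Sum>\<eta>\<in>?S. eigenfun p \<mu>' (v - \<eta>)) = wchar p Lam2 \<mu>' * eigenfun p \<mu>' v" for v
      unfolding charsum_eigenfun_scale3[symmetric] charsum_Lam2 by (simp add: diff_pair add_ac)
  qed simp
  then show ?thesis by (simp only: cnj_wchar_Lam)
qed

text \<open>The numbers \<open>2 a + b\<close>, \<open>b - a\<close>, \<open>- a - 2 b\<close> are three times the products of \<open>(a, b)\<close> with the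
weights of highest weight \<open>Lam1\<close>, and the Weyl group permutes them. The statement says that each of the two triangles of \<open>Exps\<close> meets every orbit of the
affine Weyl group with translations \<open>q Q\<close> at most once.\<close>

lemma triangle_rigid:
  fixes a b a' b' q :: int
  assumes bd: "1 \<le> a" "a \<le> q" "1 \<le> b" "b \<le> q" "1 \<le> a'" "a' \<le> q" "1 \<le> b'" "b' \<le> q"
    and side: "a + b \<le> q \<longleftrightarrow> a' + b' \<le> q"
    and dvd: "3 * q dvd (2 * a' + b') - x" "3 * q dvd (b' - a') - y"
    and xy: "x = 2 * a + b \<and> y = b - a \<or> x = 2 * a + b \<and> y = - a - 2 * b \<or>
     x = b - a \<and> y = 2 * a + b \<or> x = b - a \<and> y = - a - 2 * b \<or>
     x = - a - 2 * b \<and> y = 2 * a + b \<or> x = - a - 2 * b \<and> y = b - a"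
  shows "a = a' \<and> b = b'"
proof -
  have small: "d = - 6 * q \<or> d = - 3 * q \<or> d = 0 \<or> d = 3 * q \<or> d = 6 * q"
    if "3 * q dvd d" "- 6 * q \<le> d" "d \<le> 6 * q" for d
  proof -
    obtain k where k: "d = 3 * q * k" using \<open>3 * q dvd d\<close> by (auto elim: dvdE)
    have q: "0 < 3 * q" using bd by linarith
    have "3 * q * (- 2) \<le> 3 * q * k" "3 * q * k \<le> 3 * q * 2"
      using that unfolding k by linarith+
    then have "- 2 \<le> k" "k \<le> 2" using q by (simp_all only: mult_le_cancel_left_pos)
    then have "k = - 2 \<or> k = - 1 \<or> k = 0 \<or> k = 1 \<or> k = 2" by auto
    then show ?thesis using k by auto
  qed
  have xb: "- 3 * q \<le> x" "x \<le> 3 * q" "- 3 * q \<le> y" "y \<le> 3 * q"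
    using xy bd by (elim disjE conjE; linarith)+
  define c where "c = 2 * a' + b'"
  define d where "d = b' - a'"
  have b6: "- 6 * q \<le> c - x" "c - x \<le> 6 * q" "- 6 * q \<le> d - y" "d - y \<le> 6 * q"
    unfolding c_def d_def using xb bd by linarith+
  have 1: "c - x = - 6 * q \<or> c - x = - 3 * q \<or> c - x = 0 \<or> c - x = 3 * q \<or> c - x = 6 * q"
    by (rule small[OF dvd(1)[folded c_def] b6(1,2)])
  have 2: "d - y = - 6 * q \<or> d - y = - 3 * q \<or> d - y = 0 \<or> d - y = 3 * q \<or> d - y = 6 * q"
    by (rule small[OF dvd(2)[folded d_def] b6(3,4)])
  \<comment> \<open>In each triangle the bounds leave at most two multiples of \<open>3 q\<close> for each difference.\<close>
  have cd: "c = 2 * a' + b'" "d = b' - a'" by (simp_all add: c_def d_def)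
  consider "a + b \<le> q" "a' + b' \<le> q" | "q + 1 \<le> a + b" "q + 1 \<le> a' + b'" using side by linarith
  then show ?thesis
  proof cases
    case low: 1
    have c: "x = 2 * a + b \<Longrightarrow> c = 2 * a + b" "x = b - a \<Longrightarrow> c = b - a" "x = - a - 2 * b \<Longrightarrow> c = - a - 2 * b + 3 * q"
      using 1 low bd cd by (elim disjE; linarith)+
    have d: "y = 2 * a + b \<Longrightarrow> d = 2 * a + b" "y = b - a \<Longrightarrow> d = b - a" "y = - a - 2 * b \<Longrightarrow> d = - a - 2 * b"
      using 2 low bd cd by (elim disjE; linarith)+
    have "c = 2 * a + b \<and> d = b - a \<or>
        c = 2 * a + b \<and> d = - a - 2 * b \<or>
        c = b - a \<and> d = 2 * a + b \<or>
        c = b - a \<and> d = - a - 2 * b \<or>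
        c = - a - 2 * b + 3 * q \<and> d = 2 * a + b \<or>
        c = - a - 2 * b + 3 * q \<and> d = b - a"
      using xy c d by blast
    then show ?thesis using low bd cd by (elim disjE conjE; intro conjI; linarith)
  next
    case up: 2
    have c: "x = 2 * a + b \<Longrightarrow> c = 2 * a + b" "x = b - a \<Longrightarrow> c = b - a + 3 * q"
        "x = - a - 2 * b \<Longrightarrow> c = - a - 2 * b + 3 * q \<or> c = - a - 2 * b + 6 * q"
      using 1 up bd cd by (elim disjE; linarith)+
    have d: "y = 2 * a + b \<Longrightarrow> d = 2 * a + b - 3 * q" "y = b - a \<Longrightarrow> d = b - a" "y = - a - 2 * b \<Longrightarrow> d = - a - 2 * b + 3 * q"
      using 2 up bd cd by (elim disjE; linarith)+
    have "c = 2 * a + b \<and> d = b - a \<or>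
        c = 2 * a + b \<and> d = - a - 2 * b + 3 * q \<or>
        c = b - a + 3 * q \<and> d = 2 * a + b - 3 * q \<or>
        c = b - a + 3 * q \<and> d = - a - 2 * b + 3 * q \<or>
        c = - a - 2 * b + 3 * q \<and> d = 2 * a + b - 3 * q \<or>
        c = - a - 2 * b + 6 * q \<and> d = 2 * a + b - 3 * q \<or>
        c = - a - 2 * b + 3 * q \<and> d = b - a \<or>
        c = - a - 2 * b + 6 * q \<and> d = b - a"
      using xy c d by blast
    then show ?thesis using up bd cd by (elim disjE conjE; intro conjI; linarith)
  qed
qed

text \<open>\<open>wchar p Lam1 \<mu>\<close> determines the elementary symmetric functions of three unimodular numbers with product
1, hence these numbers up to order, hence the orbit of \<open>\<mu> + \<rho>\<close> modulo \<open>p Q\<close>. The sign of \<open>Ffun\<close>, which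
is nonzero, tells the two triangles apart.\<close>

lemma eigenvalues_distinct:
  assumes p: "p > 0" and \<mu>: "\<mu> \<in> Exps p" "\<mu>' \<in> Exps p"
    and F: "Ffun p \<mu> = Ffun p \<mu>'" and X: "wchar p Lam1 \<mu> = wchar p Lam1 \<mu>'"
  shows "\<mu> = \<mu>'"
proof -
  define a b a' b' where ab: "a = fst \<mu> + 1" "b = snd \<mu> + 1" "a' = fst \<mu>' + 1" "b' = snd \<mu>' + 1"
  then have \<mu>': "\<mu> = (a - 1, b - 1)" "\<mu>' = (a' - 1, b' - 1)" by simp_all
  have bd: "1 \<le> a" "a \<le> int p" "1 \<le> b" "b \<le> int p" "1 \<le> a'" "a' \<le> int p" "1 \<le> b'" "b' \<le> int p"
    using \<mu> by (auto simp: Exps_iff ab)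
  have "wchar p Lam2 \<mu> = wchar p Lam2 \<mu>'"
    using X cnj_wchar_Lam by (metis complex_cnj_cnj)
  then have "hop p \<mu> * cnj (hop p \<mu>) = hop p \<mu>' * cnj (hop p \<mu>')"
    using X by (simp only: hop_square[symmetric])
  then have "(cmod (hop p \<mu>))\<^sup>2 = (cmod (hop p \<mu>'))\<^sup>2"
    by (simp only: complex_norm_square[symmetric] of_real_eq_iff)
  then have "cmod (hop p \<mu>) = cmod (hop p \<mu>')" by simp
  then have "eps p \<mu> = eps p \<mu>'" using F hop_nonzero[OF p \<mu>(2)] by (simp add: Ffun_eq)
  then have side: "a + b \<le> int p \<longleftrightarrow> a' + b' \<le> int p"
    unfolding \<mu>' eps_eq by (simp split: if_splits)
  define z where "z = (\<lambda>n :: int. cis (2 * pi * of_int n / of_nat (3 * p)))"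
  have z_mult: "z (n + n') = z n * z n'" for n n'
    by (simp add: z_def cis_mult ring_distribs add_divide_distrib)
  have z_ne: "z n \<noteq> 0" for n by (simp add: z_def)
  have z_dvd: "int (3 * p) dvd n - n'" if "z n = z n'" for n n'
  proof (rule cis_eq_1D)
    have "z (n - n') * z n' = z n'" using z_mult[of "n - n'" n'] that by simp
    then have "z (n - n') = 1" using z_ne by simp
    then show "cis (2 * pi * of_int (n - n') / of_nat (3 * p)) = 1" by (simp only: z_def)
  qed (use p in simp)
  have z_dvd': "3 * int p dvd n - n'" if "z n = z n'" for n n' using z_dvd[OF that] by simp
  have wz: "cnj (wchar p Lam1 (a - 1, b - 1)) = z (2 * a + b) + z (b - a) + z (- a - 2 * b)" for a b
  proof -
    have mr: "(a - 1, b - 1) + rho = (a, b)" by (simp add: rho_pair)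
    have "ip (3, 0) (a, b) = of_int (2 * a + b)" "ip (- 3, 3) (a, b) = of_int (b - a)"
      "ip (0, - 3) (a, b) = of_int (- a - 2 * b)"
      by (simp_all add: ip_def field_simps)
    then show ?thesis
      unfolding wchar_charsum charsum_Lam1
      by (simp add: wave_def mr z_def cis_cnj)
  qed
  have z_cnj: "cnj (z n) = z (- n)" for n by (simp add: z_def cis_cnj)
  define z1 z2 z3 y1 y2 y3 where zs: "z1 = z (2 * a + b)" "z2 = z (b - a)" "z3 = z (- a - 2 * b)"
    "y1 = z (2 * a' + b')" "y2 = z (b' - a')" "y3 = z (- a' - 2 * b')"
  have "z 0 = 1" by (simp add: z_def)
  then have prod: "z1 * z2 * z3 = 1" "y1 * y2 * y3 = 1"
    by (simp_all add: zs flip: z_mult)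
  have e1: "y1 + y2 + y3 = z1 + z2 + z3"
    using arg_cong[OF X, of cnj] unfolding \<mu>' wz by (simp add: zs)
  have n1: "norm (z n) = 1" for n by (simp add: z_def)
  have e2: "y1 * y2 + y1 * y3 + y2 * y3 = z1 * z2 + z1 * z3 + z2 * z3"
    using arg_cong[OF e1, of cnj] unimodular_sum[OF prod(1)] unimodular_sum[OF prod(2)]
    by (simp add: zs n1)
  have "(y1 - z1) * (y1 - z2) * (y1 - z3) = 0" using e1 e2 prod by algebra
  moreover have "(y2 - z2) * (y2 - z3) = 0" if "y1 = z1" using e1 e2 prod that by algebra
  moreover have "(y2 - z1) * (y2 - z3) = 0" if "y1 = z2" using e1 e2 prod that by algebra
  moreover have "(y2 - z1) * (y2 - z2) = 0" if "y1 = z3" using e1 e2 prod that by algebra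
  ultimately consider "y1 = z1" "y2 = z2" | "y1 = z1" "y2 = z3" | "y1 = z2" "y2 = z1"
    | "y1 = z2" "y2 = z3" | "y1 = z3" "y2 = z1" | "y1 = z3" "y2 = z2" by auto
  then have "a = a' \<and> b = b'"
  proof cases
    case 1
    show ?thesis by (rule triangle_rigid[OF bd side z_dvd'[OF 1(1)[unfolded zs]] z_dvd'[OF 1(2)[unfolded zs]]]) simp
  next
    case 2
    show ?thesis by (rule triangle_rigid[OF bd side z_dvd'[OF 2(1)[unfolded zs]] z_dvd'[OF 2(2)[unfolded zs]]]) simp
  next
    case 3
    show ?thesis by (rule triangle_rigid[OF bd side z_dvd'[OF 3(1)[unfolded zs]] z_dvd'[OF 3(2)[unfolded zs]]]) simp
  next
    case 4
    show ?thesis by (rule triangle_rigid[OF bd side z_dvd'[OF 4(1)[unfolded zs]] z_dvd'[OF 4(2)[unfolded zs]]]) simp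
  next
    case 5
    show ?thesis by (rule triangle_rigid[OF bd side z_dvd'[OF 5(1)[unfolded zs]] z_dvd'[OF 5(2)[unfolded zs]]]) simp
  next
    case 6
    show ?thesis by (rule triangle_rigid[OF bd side z_dvd'[OF 6(1)[unfolded zs]] z_dvd'[OF 6(2)[unfolded zs]]]) simp
  qed
  then show ?thesis by (simp add: \<mu>')
qed

lemma inner_alcove_orthogonal:
  assumes "p > 0" "\<mu> \<in> Exps p" "\<mu>' \<in> Exps p" "\<mu> \<noteq> \<mu>'"
  shows "inner_alcove p \<mu> \<mu>' = 0"
  using eigenvalues_distinct[OF assms(1-3)] inner_alcove_Ffun[OF assms(1), of \<mu> \<mu>']
    inner_alcove_wchar[OF assms(1), of \<mu> \<mu>'] assms(4) by auto

section \<open>The eigenvector matrix\<close>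

lemma chi_eq:
  assumes "w \<in> weyl" "\<kappa> \<in> root_lattice"
  shows "chi p (w \<circ> transl (- \<kappa>)) \<mu> =
    (\<Sum>j\<in>{0, scale 2 Lam1, scale 2 Lam2}. wchar p (\<kappa> + dot (inv w) (- j)) \<mu>) +
     (Ffun p \<mu> + 2) * (\<Sum>j\<in>{rho, Lam1, Lam2}. wchar p (\<kappa> + dot (inv w) (- j)) \<mu>)"
proof -
  have "triality \<kappa> = 0"
    using assms(2) by (cases \<kappa>) (simp add: triality_def root_lattice_iff, presburger)
  moreover have "scale 2 Lam1 \<noteq> 0" "scale 2 Lam2 \<noteq> 0" "scale 2 Lam1 \<noteq> scale 2 Lam2"
    "rho \<noteq> Lam1" "rho \<noteq> Lam2" "Lam1 \<noteq> Lam2"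
    by (simp_all add: Lam1_def Lam2_def rho_pair zero_prod_def)
  ultimately show ?thesis
    by (simp add: chi_def weyl_parts assms Let_def add_ac)
qed

lemma charsum_iota:
  assumes "y \<in> Wplus p" "v \<in> honeycomb"
  shows "charsum (iota y) (\<lambda>\<nu>. eigenfun p \<mu> (v + \<nu>)) = chi p y \<mu> * eigenfun p \<mu> v"
proof -
  obtain w \<kappa> where y: "w \<in> weyl" "\<kappa> \<in> root_lattice" "y = w \<circ> transl (- \<kappa>)"
    using assms(1) by (rule Wplus_cases)
  show ?thesis
    unfolding y(3) iota_eq[OF y(1,2)] chi_eq[OF y(1,2)]
    by (rule charsum_eigenfun[OF assms(2) weyl_inv[OF y(1)]])
qed

lemma chi_eigenfun:
  assumes "y \<in> Wplus p"
  shows "eigenfun p \<mu> (iota y + rho) = chi p y \<mu> * eigenfun p \<mu> rho"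
proof -
  have "rho \<in> honeycomb" by (simp add: rho_pair honeycomb_iff)
  then show ?thesis
    using charsum_iota[OF assms, of rho \<mu>]
      charsum_antisym[of "eigenfun p \<mu>" "iota y", OF eigenfun_weyl]
    by (simp add: add.commute)
qed

lemma id_Wplus:
  assumes "p > 0" shows "id \<in> Wplus p" "iota id = 0"
proof -
  have z: "(0 :: weight) \<in> root_lattice" "id \<in> weyl"
    by (simp_all add: zero_prod_def root_lattice_iff weyl_eq)
  have e: "id \<circ> transl (- 0) = id" by (auto simp: transl_def)
  have "rho \<in> alcove p" using assms by (simp add: alcove_def rho_pair honeycomb_iff)
  then have "0 \<in> dominant_level p id"
    by (simp add: dominant_level_iff[OF z(2,1)] weyl_inv_simps)
  then have "\<exists>w \<kappa>. id = w \<circ> transl (- \<kappa>) \<and> w \<in> weyl \<and> \<kappa> \<in> dominant_level p w \<inter> root_lattice"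
    by (intro exI[of _ id] exI[of _ 0]) (simp only: e z Int_iff simp_thms)
  then show "id \<in> Wplus p" unfolding Wplus_def mem_Collect_eq .
  show "iota id = 0" using iota_eq[OF z(2,1)] unfolding e by (simp add: weyl_inv_simps dot_def)
qed

lemma chi_id:
  assumes "p > 0" "\<mu> \<in> Exps p" shows "chi p id \<mu> = 1"
proof -
  have "eigenfun p \<mu> rho = chi p id \<mu> * eigenfun p \<mu> rho"
    using chi_eigenfun[OF id_Wplus(1)[OF assms(1)], of \<mu>]
    unfolding id_Wplus(2)[OF assms(1)] add_0 .
  then show ?thesis using eigenfun_rho_nonzero[OF assms] by (metis mult_cancel_right1)
qed

lemma psi_norm_square:
  assumes "p > 0" "\<mu> \<in> Exps p"
  shows "psi_norm p \<mu> > 0" "(psi_norm p \<mu>)\<^sup>2 * (\<Sum>y\<in>Wplus p. (cmod (chi p y \<mu>))\<^sup>2) = 1"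
proof -
  define S where "S = (\<Sum>y\<in>Wplus p. (cmod (chi p y \<mu>))\<^sup>2)"
  have "(cmod (chi p id \<mu>))\<^sup>2 \<le> S"
    unfolding S_def by (rule member_le_sum[OF id_Wplus(1)[OF assms(1)]]) simp_all
  then have S: "S \<ge> 1" by (simp add: chi_id assms)
  have n: "psi_norm p \<mu> = S powr (- (1 / 2))" by (simp only: psi_norm_def S_def)
  show "psi_norm p \<mu> > 0" using S by (simp add: n)
  have "(psi_norm p \<mu>)\<^sup>2 = S powr (- 1)"
    unfolding n power2_eq_square by (simp flip: powr_add)
  also have "\<dots> = 1 / S" using S by (simp add: powr_minus_divide)
  finally show "(psi_norm p \<mu>)\<^sup>2 * (\<Sum>y\<in>Wplus p. (cmod (chi p y \<mu>))\<^sup>2) = 1"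
    using S by (simp flip: S_def)
qed

lemma psi_columns:
  assumes p: "p > 0" and \<mu>: "\<mu> \<in> Exps p" "\<mu>' \<in> Exps p"
  shows "(\<Sum>y\<in>Wplus p. psi p y \<mu> * cnj (psi p y \<mu>')) = (if \<mu> = \<mu>' then 1 else 0)"
proof (cases "\<mu> = \<mu>'")
  case True
  have "(\<Sum>y\<in>Wplus p. psi p y \<mu> * cnj (psi p y \<mu>)) =
      of_real ((psi_norm p \<mu>)\<^sup>2 * (\<Sum>y\<in>Wplus p. (cmod (chi p y \<mu>))\<^sup>2))"
    unfolding of_real_mult of_real_sum sum_distrib_left complex_norm_square
    by (simp add: psi_def power2_eq_square mult_ac)
  also have "\<dots> = 1" by (simp only: psi_norm_square(2)[OF p \<mu>(1)] of_real_1)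
  finally show ?thesis using True by simp
next
  case False
  have "(eigenfun p \<mu> rho * cnj (eigenfun p \<mu>' rho)) * (\<Sum>y\<in>Wplus p. chi p y \<mu> * cnj (chi p y \<mu>')) =
      (\<Sum>y\<in>Wplus p. eigenfun p \<mu> (iota y + rho) * cnj (eigenfun p \<mu>' (iota y + rho)))"
    unfolding sum_distrib_left by (rule sum.cong) (simp_all add: chi_eigenfun mult_ac)
  also have "\<dots> = inner_alcove p \<mu> \<mu>'"
    unfolding inner_alcove_def by (rule sum.reindex_bij_betw[OF Wplus_bij])
  also have "\<dots> = 0" using inner_alcove_orthogonal[OF p \<mu> False] .
  finally have "(\<Sum>y\<in>Wplus p. chi p y \<mu> * cnj (chi p y \<mu>')) = 0"
    using eigenfun_rho_nonzero[OF p] \<mu> by simp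
  then have "of_real (psi_norm p \<mu> * psi_norm p \<mu>') * (\<Sum>y\<in>Wplus p. chi p y \<mu> * cnj (chi p y \<mu>')) = (0 :: complex)"
    by simp
  then show ?thesis using False by (simp add: psi_def sum_distrib_left mult_ac)
qed

text \<open>A square matrix with orthonormal columns has orthonormal rows: \<open>P = A A\<^sup>*\<close> is a projection whose trace
is the dimension, so its Hilbert-Schmidt distance from the identity is zero.\<close>

lemma orthonormal_rows:
  fixes A :: "'a \<Rightarrow> 'b \<Rightarrow> complex"
  assumes fin: "finite S" "finite T" and card: "card S = card T"
    and cols: "\<And>s t. s \<in> T \<Longrightarrow> t \<in> T \<Longrightarrow> (\<Sum>y\<in>S. A y s * cnj (A y t)) = (if s = t then 1 else 0)"
    and xy: "x \<in> S" "y \<in> S"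
  shows "(\<Sum>t\<in>T. A x t * cnj (A y t)) = (if x = y then 1 else 0)"
proof -
  define P where "P = (\<lambda>x y. \<Sum>t\<in>T. A x t * cnj (A y t))"
  define d where "d = (\<lambda>x y :: 'a. if x = y then 1 else 0 :: complex)"
  have "of_real (\<Sum>x\<in>S. \<Sum>y\<in>S. (cmod (d x y - P x y))\<^sup>2) =
      (\<Sum>x\<in>S. \<Sum>y\<in>S. (d x y - P x y) * cnj (d x y - P x y))"
    by (simp only: of_real_sum complex_norm_square)
  also have "\<dots> = (\<Sum>x\<in>S. \<Sum>y\<in>S. d x y) - (\<Sum>x\<in>S. \<Sum>y\<in>S. d x y * cnj (P x y))
      - (\<Sum>x\<in>S. \<Sum>y\<in>S. d x y * P x y) + (\<Sum>x\<in>S. \<Sum>y\<in>S. P x y * cnj (P x y))"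
  proof -
    have "(d x y - P x y) * cnj (d x y - P x y) =
        d x y - d x y * cnj (P x y) - d x y * P x y + P x y * cnj (P x y)" for x y
      by (simp add: d_def algebra_simps)
    then show ?thesis by (simp add: sum.distrib sum_subtractf)
  qed
  also have "(\<Sum>x\<in>S. \<Sum>y\<in>S. d x y) = of_nat (card S)"
    using fin by (simp add: d_def)
  also have diag: "(\<Sum>x\<in>S. \<Sum>y\<in>S. d x y * P x y) = of_nat (card T)"
  proof -
    have "(\<Sum>x\<in>S. \<Sum>y\<in>S. d x y * P x y) = (\<Sum>x\<in>S. P x x)"
      using fin by (intro sum.cong refl) (simp add: d_def if_distrib[of "\<lambda>c. c * _"] cong: if_cong)
    also have "\<dots> = (\<Sum>t\<in>T. \<Sum>x\<in>S. A x t * cnj (A x t))"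
      unfolding P_def by (rule sum.swap)
    also have "\<dots> = of_nat (card T)" by (simp add: cols)
    finally show ?thesis .
  qed
  also have "(\<Sum>x\<in>S. \<Sum>y\<in>S. d x y * cnj (P x y)) = cnj (\<Sum>x\<in>S. \<Sum>y\<in>S. d x y * P x y)"
    by (simp add: d_def if_distrib[of cnj] cong: if_cong)
  also have "\<dots> = of_nat (card T)" unfolding diag by simp
  also have "(\<Sum>x\<in>S. \<Sum>y\<in>S. P x y * cnj (P x y)) = of_nat (card T)"
  proof -
    have "(\<Sum>x\<in>S. \<Sum>y\<in>S. P x y * cnj (P x y)) =
        (\<Sum>x\<in>S. \<Sum>y\<in>S. \<Sum>s\<in>T. \<Sum>t\<in>T. (A x s * cnj (A x t)) * (A y t * cnj (A y s)))"
      by (simp add: P_def sum_product mult_ac)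
    also have "\<dots> = (\<Sum>s\<in>T. \<Sum>t\<in>T. \<Sum>x\<in>S. \<Sum>y\<in>S. (A x s * cnj (A x t)) * (A y t * cnj (A y s)))"
      by (simp only: sum.swap[of _ S T])
    also have "\<dots> = (\<Sum>s\<in>T. \<Sum>t\<in>T. (\<Sum>x\<in>S. A x s * cnj (A x t)) * (\<Sum>y\<in>S. A y t * cnj (A y s)))"
      by (simp only: sum_product)
    also have "\<dots> = (\<Sum>s\<in>T. \<Sum>t\<in>T. if s = t then 1 else 0)"
      by (intro sum.cong refl) (simp add: cols)
    also have "\<dots> = of_nat (card T)" using fin by simp
    finally show ?thesis .
  qed
  finally have "complex_of_real (\<Sum>x\<in>S. \<Sum>y\<in>S. (cmod (d x y - P x y))\<^sup>2) = 0"
    unfolding card by (rule trans) simp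
  then have "(\<Sum>x\<in>S. \<Sum>y\<in>S. (cmod (d x y - P x y))\<^sup>2) = 0"
    by (simp only: of_real_eq_0_iff)
  then have "(\<Sum>y\<in>S. (cmod (d x y - P x y))\<^sup>2) = 0"
    using fin xy by (subst (asm) sum_nonneg_eq_0_iff) (auto intro: sum_nonneg)
  then have "(cmod (d x y - P x y))\<^sup>2 = 0"
    using fin xy by (subst (asm) sum_nonneg_eq_0_iff) auto
  then show ?thesis by (simp add: d_def P_def)
qed

lemma psi_rows:
  assumes "p > 0" "x \<in> Wplus p" "y \<in> Wplus p"
  shows "(\<Sum>\<mu>\<in>Exps p. psi p x \<mu> * cnj (psi p y \<mu>)) = (if x = y then 1 else 0)"
  by (rule orthonormal_rows[OF _ _ card_Wplus psi_columns]) (use assms in auto)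

text \<open>The column of values \<open>chi p z \<mu>\<close> is proportional to the eigenfunction, and the fusion matrix of \<open>x\<close> acts
on the latter as the character of highest weight \<open>iota x\<close>.\<close>

lemma fusion_chi:
  assumes p: "p > 0" and x: "x \<in> Wplus p" and y: "y \<in> Wplus p" and \<mu>: "\<mu> \<in> Exps p"
  shows "(\<Sum>z\<in>Wplus p. of_int (fusion p x y z) * chi p z \<mu>) = chi p x \<mu> * chi p y \<mu>"
proof -
  let ?\<phi> = "eigenfun p \<mu>"
  have jy: "iota y + rho \<in> honeycomb" using y by (rule Wplus_cases) (simp add: alcove_def)
  have "(\<Sum>z\<in>Wplus p. of_int (fusion p x y z) * chi p z \<mu>) * ?\<phi> rho =
      (\<Sum>z\<in>Wplus p. of_int (kernel p (mult (iota x)) (iota y + rho) (iota z + rho)) * ?\<phi> (iota z + rho))"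
    unfolding sum_distrib_right
    by (rule sum.cong) (simp_all add: fusion_kernel[OF p y] chi_eigenfun mult.assoc)
  also have "\<dots> = (\<Sum>u\<in>alcove p. of_int (kernel p (mult (iota x)) (iota y + rho) u) * ?\<phi> u)"
    by (rule sum.reindex_bij_betw[OF Wplus_bij])
  also have "\<dots> = charsum (iota x) (\<lambda>\<nu>. ?\<phi> (iota y + rho + \<nu>))"
    unfolding charsum_def
    by (rule kernel_sum[OF p]) (simp_all add: eigenfun_weyl eigenfun_period p, simp add: eigenfun_def)
  also have "\<dots> = chi p x \<mu> * (chi p y \<mu> * ?\<phi> rho)"
    by (simp only: charsum_iota[OF x jy] chi_eigenfun[OF y])
  finally show ?thesis using eigenfun_rho_nonzero[OF p \<mu>] by simp
qed

theorem mainTheorem20: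
  fixes p :: nat
  assumes "p \<ge> 2" and "\<not> 3 dvd p"
  shows "card (Wplus p) = card (Exps p) \<and>
    (\<forall>\<mu>\<in>Exps p. \<forall>\<mu>'\<in>Exps p.
       (\<Sum>y\<in>Wplus p. psi p y \<mu> * cnj (psi p y \<mu>')) = (if \<mu> = \<mu>' then 1 else 0)) \<and>
    (\<forall>y\<in>Wplus p. \<forall>x\<in>Wplus p.
       (\<Sum>\<mu>\<in>Exps p. psi p y \<mu> * cnj (psi p x \<mu>)) = (if y = x then 1 else 0)) \<and>
    (\<forall>x\<in>Wplus p. \<forall>y\<in>Wplus p. \<forall>z\<in>Wplus p.
       of_int (fusion p x y z) =
       (\<Sum>\<mu>\<in>Exps p. psi p x \<mu> / psi p id \<mu> * psi p y \<mu> * cnj (psi p z \<mu>)))"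
proof (intro conjI ballI)
  have p: "p > 0" using assms by simp
  show "card (Wplus p) = card (Exps p)" by (rule card_Wplus)
  show "(\<Sum>y\<in>Wplus p. psi p y \<mu> * cnj (psi p y \<mu>')) = (if \<mu> = \<mu>' then 1 else 0)"
    if "\<mu> \<in> Exps p" "\<mu>' \<in> Exps p" for \<mu> \<mu>'
    using psi_columns[OF p that] .
  show "(\<Sum>\<mu>\<in>Exps p. psi p y \<mu> * cnj (psi p x \<mu>)) = (if y = x then 1 else 0)"
    if "y \<in> Wplus p" "x \<in> Wplus p" for x y
    using psi_rows[OF p that] .
  show "of_int (fusion p x y z) =
       (\<Sum>\<mu>\<in>Exps p. psi p x \<mu> / psi p id \<mu> * psi p y \<mu> * cnj (psi p z \<mu>))"
    if x: "x \<in> Wplus p" and y: "y \<in> Wplus p" and z: "z \<in> Wplus p" for x y z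
  proof -
    have "(\<Sum>\<mu>\<in>Exps p. psi p x \<mu> / psi p id \<mu> * psi p y \<mu> * cnj (psi p z \<mu>)) =
        (\<Sum>\<mu>\<in>Exps p. (\<Sum>z'\<in>Wplus p. of_int (fusion p x y z') * psi p z' \<mu>) * cnj (psi p z \<mu>))"
    proof (rule sum.cong[OF refl])
      fix \<mu> assume \<mu>: "\<mu> \<in> Exps p"
      have "psi p x \<mu> / psi p id \<mu> = chi p x \<mu>"
        using psi_norm_square(1)[OF p \<mu>] by (simp add: psi_def chi_id[OF p \<mu>])
      then have "psi p x \<mu> / psi p id \<mu> * psi p y \<mu> = (chi p x \<mu> * chi p y \<mu>) * of_real (psi_norm p \<mu>)"
        by (simp add: psi_def)
      also have "\<dots> = (\<Sum>z'\<in>Wplus p. of_int (fusion p x y z') * psi p z' \<mu>)"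
        unfolding fusion_chi[OF p x y \<mu>, symmetric] sum_distrib_right by (simp add: psi_def mult.assoc)
      finally show "psi p x \<mu> / psi p id \<mu> * psi p y \<mu> * cnj (psi p z \<mu>) =
          (\<Sum>z'\<in>Wplus p. of_int (fusion p x y z') * psi p z' \<mu>) * cnj (psi p z \<mu>)" by simp
    qed
    also have "\<dots> = (\<Sum>z'\<in>Wplus p. of_int (fusion p x y z') *
        (\<Sum>\<mu>\<in>Exps p. psi p z' \<mu> * cnj (psi p z \<mu>)))"
      by (simp only: sum_distrib_left sum_distrib_right mult.assoc) (rule sum.swap)
    also have "\<dots> = (\<Sum>z'\<in>Wplus p. if z' = z then of_int (fusion p x y z') else 0)"
      by (rule sum.cong) (simp_all add: psi_rows[OF p _ z])
    also have "\<dots> = of_int (fusion p x y z)" using z by simp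
    finally show ?thesis by simp
  qed
qed

end
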